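(* Let $t>1$, let $R>0$ and let $h^*=h^*_R$ be a global minimizer of $I$ in $\mathcal{A}_h$. Then $h^*$ is a solution of $$\frac{d^2 h}{dr^2}+\frac{2}{r}\frac{dh}{dr}-\frac{6h}{r^2}=-h+h^3+\frac{3h_+}{t}\left(h^3-h^2\right)$$ on $(0,R)$ subject to $h(0)=0$, $h(R)=1$. As $r\to0$ one has the series expansion $$h^*(r)=\sum_{n=0}^\infty a_nr^n=a_2r^2\left[1-\frac{r^2}{14}+o(r^2)\right]\quad\text{as }r\to0,$$ where $a_n=0$ for all odd $n$ and $a_2>0$ is a constant. In addition, as the domain size $R\to\infty$, for every $r>0$, $$\frac{r^2}{r^2+14}\le\liminf_{R\to\infty}h_R^*(r)\le\limsup_{R\to\infty}h_R^*(r)\le\frac{r^2}{r^2+t\lambda_t^2},\qquad \lambda_t^2=\frac{24}{9+8t+3\sqrt{9+8t}}\le\frac3t\le3 .$$ Moreover, for $R$ sufficiently large, the constant $a_2$ satisfies $$\frac1{14}\le a_2\le\frac13+\frac{3}{8t}+\frac{1}{8t}\sqrt{9+8t}.$$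
   Context: $t>1$ is a fixed reduced temperature and $h_+=\frac{3+\sqrt{9+8t}}{4}$. For $R>0$, $\mathcal{A}_h=\{h\in W^{1,2}([0,R],\mathbb{R}):h(R)=1\}$ and $$I[h]=\int_0^R r^2\left(\frac12\left(\frac{dh}{dr}\right)^2+\frac{3h^2}{r^2}+f(h)\right)dr,\qquad f(h)=-\frac{h^2}{2}-\frac{h_+}{t}h^3+\frac{h_+^2}{2t}h^4+C(t),$$ where the constant $C(t)$ is chosen so that $f\ge0$ and $f(1)=0$. *)

theory Defs
  imports "HOL-Analysis.Analysis" "HOL-Library.Landau_Symbols"
begin

definition h_plus :: "real \<Rightarrow> real" where
  "h_plus t = (3 + sqrt (9 + 8 * t)) / 4"

text \<open>The value of the constant is forced by the normalisation \<open>bulk t 1 = 0\<close>;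
  that \<open>bulk t\<close> is then nonnegative is \<open>bulk_nonneg\<close> below.\<close>

definition bulk_const :: "real \<Rightarrow> real" where
  "bulk_const t = 1 / 2 + h_plus t / t - (h_plus t)\<^sup>2 / (2 * t)"

definition bulk :: "real \<Rightarrow> real \<Rightarrow> real" where
  "bulk t x = - (x\<^sup>2 / 2) - h_plus t / t * x ^ 3 + (h_plus t)\<^sup>2 / (2 * t) * x ^ 4 + bulk_const t"

lemma bulk_one: "bulk t 1 = 0"
  by (simp add: bulk_def bulk_const_def)

lemma h_plus_quadratic:
  assumes "t > 1"
  shows "2 * (h_plus t)\<^sup>2 = 3 * h_plus t + t"
proof -
  have "(sqrt (9 + 8 * t))\<^sup>2 = 9 + 8 * t" using assms by simp
  then show ?thesis unfolding h_plus_def by (simp add: power2_eq_square field_simps)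
qed

lemma bulk_nonneg:
  assumes "t > 1"
  shows "bulk t x \<ge> 0"
proof -
  define k where "k = h_plus t / t"
  have "h_plus t > 0"
    unfolding h_plus_def using assms by (intro divide_pos_pos add_pos_nonneg) auto
  then have k: "k > 0" unfolding k_def using assms by simp
  have "(h_plus t)\<^sup>2 / (2 * t) = (2 * (h_plus t)\<^sup>2) / (4 * t)" by simp
  also have "\<dots> = (1 + 3 * k) / 4"
    unfolding h_plus_quadratic[OF assms] k_def using assms by (simp add: field_simps)
  finally have q: "(h_plus t)\<^sup>2 / (2 * t) = (1 + 3 * k) / 4" .
  have "bulk t x = (x - 1)\<^sup>2 * ((1 + k) / 4 * (x + 1)\<^sup>2 + k / 2 * x\<^sup>2)"
    unfolding bulk_def bulk_const_def q k_def[symmetric]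
    by (simp add: power2_eq_square power3_eq_cube power4_eq_xxxx field_simps)
  then show ?thesis using k by simp
qed

definition L2_on :: "real \<Rightarrow> (real \<Rightarrow> real) \<Rightarrow> bool" where
  "L2_on R g \<longleftrightarrow> set_borel_measurable lborel {0..R} g \<and> set_integrable lborel {0..R} (\<lambda>r. (g r)\<^sup>2)"

definition test_function :: "real \<Rightarrow> (real \<Rightarrow> real) \<Rightarrow> bool" where
  "test_function R \<phi> \<longleftrightarrow> \<phi> C1_differentiable_on UNIV \<and>
     compact (closure {x. \<phi> x \<noteq> 0}) \<and> closure {x. \<phi> x \<noteq> 0} \<subseteq> {0<..<R}"

definition is_weak_deriv :: "real \<Rightarrow> (real \<Rightarrow> real) \<Rightarrow> (real \<Rightarrow> real) \<Rightarrow> bool" where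
  "is_weak_deriv R h g \<longleftrightarrow>
     (\<forall>\<phi>. test_function R \<phi> \<longrightarrow>
        (LINT r:{0..R}|lborel. h r * deriv \<phi> r) = - (LINT r:{0..R}|lborel. g r * \<phi> r))"

text \<open>An element of \<open>W\<^sup>1\<^sup>,\<^sup>2([0,R])\<close> is an almost-everywhere class with a unique continuous
  member on \<open>[0,R]\<close>.  It is represented here by that member, which gives meaning to point
  values such as \<open>h R\<close>.  Values outside \<open>[0,R]\<close> are irrelevant.\<close>

definition W12 :: "real \<Rightarrow> (real \<Rightarrow> real) set" where
  "W12 R = {h. continuous_on {0..R} h \<and> L2_on R h \<and> (\<exists>g. L2_on R g \<and> is_weak_deriv R h g)}"

text \<open>Weak derivatives are unique up to null sets, so the choice does not affect integrals.\<close>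

definition weak_deriv :: "real \<Rightarrow> (real \<Rightarrow> real) \<Rightarrow> real \<Rightarrow> real" where
  "weak_deriv R h = (SOME g. L2_on R g \<and> is_weak_deriv R h g)"

definition admissible :: "real \<Rightarrow> (real \<Rightarrow> real) set" where
  "admissible R = {h \<in> W12 R. h R = 1}"

definition energy :: "real \<Rightarrow> real \<Rightarrow> (real \<Rightarrow> real) \<Rightarrow> real" where
  "energy t R h =
     (LINT r:{0..R}|lborel.
        r\<^sup>2 * (1 / 2 * (weak_deriv R h r)\<^sup>2 + 3 * (h r)\<^sup>2 / r\<^sup>2 + bulk t (h r)))"

definition global_minimizer :: "real \<Rightarrow> real \<Rightarrow> (real \<Rightarrow> real) \<Rightarrow> bool" where
  "global_minimizer t R h \<longleftrightarrow> is_arg_min (energy t R) (\<lambda>u. u \<in> admissible R) h"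

definition solves_bvp :: "real \<Rightarrow> real \<Rightarrow> (real \<Rightarrow> real) \<Rightarrow> bool" where
  "solves_bvp t R h \<longleftrightarrow> continuous_on {0..R} h \<and> h 0 = 0 \<and> h R = 1 \<and>
     (\<exists>h' h''. \<forall>r\<in>{0<..<R}.
        (h has_real_derivative h' r) (at r) \<and> (h' has_real_derivative h'' r) (at r) \<and>
        h'' r + 2 / r * h' r - 6 * h r / r\<^sup>2
          = - h r + (h r) ^ 3 + 3 * h_plus t / t * ((h r) ^ 3 - (h r)\<^sup>2))"

text \<open>The series is a convergent power series on a right neighbourhood of the origin.\<close>

definition origin_expansion :: "real \<Rightarrow> (real \<Rightarrow> real) \<Rightarrow> (nat \<Rightarrow> real) \<Rightarrow> bool" where
  "origin_expansion R h a \<longleftrightarrow>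
     (\<forall>n. odd n \<longrightarrow> a n = 0) \<and> a 2 > 0 \<and>
     (\<exists>\<delta> \<rho>. 0 < \<delta> \<and> \<delta> \<le> R \<and> \<rho> \<in> o[at_right 0](\<lambda>r::real. r\<^sup>2) \<and>
        (\<forall>r\<in>{0..<\<delta>}. (\<lambda>n. a n * r ^ n) sums h r \<and>
                       h r = a 2 * r\<^sup>2 * (1 - r\<^sup>2 / 14 + \<rho> r)))"

definition lambda_sq :: "real \<Rightarrow> real" where
  "lambda_sq t = 24 / (9 + 8 * t + 3 * sqrt (9 + 8 * t))"

end

theory Submission
  imports Defs "HOL-Real_Asymp.Real_Asymp"
begin

text \<open>The first variation and the lemma of du Bois-Reymond make a minimizer \<open>h\<close> a classical solution
  on \<open>(0,R)\<close>. With \<open>q = h / r\<^sup>2\<close> the equation reads \<open>(r\<^sup>6 q')' = r\<^sup>4 F(h)\<close>, where \<open>F\<close> (below: \<open>force t\<close>)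
  is the derivative of the bulk potential, so boundedness of
  \<open>h\<close> bootstraps to continuity of \<open>q\<close> at \<open>0\<close>. The maximum principle gives \<open>h \<le> 1\<close>, and flipping the
  sign of \<open>h\<close> on an interval where \<open>h < 0\<close> lowers the energy, hence \<open>0 \<le> h \<le> 1\<close>. Then \<open>F(h) \<le> 0\<close>,
  so \<open>q\<close> decreases and \<open>q \<ge> 1 / R\<^sup>2 > 0\<close>. The functions \<open>r\<^sup>2 / (r\<^sup>2 + c)\<close> are strict subsolutions
  for \<open>c > 14\<close>, and sliding \<open>c\<close> down to \<open>14\<close> gives the lower bounds for every \<open>R\<close>. For
  \<open>c \<le> t \<lambda>\<^sub>t\<^sup>2\<close> they are supersolutions with boundary value below \<open>1\<close>; multiplying by \<open>1 + \<beta>\<close> and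
  replacing \<open>c\<close> by \<open>(1 + \<beta>) c\<close> keeps the value \<open>1 / c\<close> of \<open>q\<close> at the origin and, once \<open>\<beta> R\<^sup>2\<close> is large,
  repairs the boundary condition, so no compactness in \<open>R\<close> is needed. The power series comes from the
  recursion for its coefficients and uniqueness for the equation in \<open>q\<close> near \<open>0\<close>.\<close>

subsection \<open>Weak derivatives on an interval\<close>

text \<open>The operator \<open>h'' + 2 h' / r - 6 h / r^2\<close> has indicial exponents 2 and -3
  at the origin. Putting \<open>h = r^2 q\<close> factors out the first and leaves
  \<open>r^2 (q'' + 6 q' / r)\<close>, a radial Laplacian in dimension 7. The second is excluded
  because the flux \<open>r^6 q'\<close> tends to 0, and this vanishing flux acts as the initial
  condition for \<open>q\<close> from then on. Comparison is done for \<open>q\<close> and not for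
  \<open>h\<close>: all barriers for \<open>h\<close> vanish to the same order at 0, so contact at
  the origin would be invisible, whereas for \<open>q\<close> it is an ordinary contact that the
  flux can exclude. The constant 14 is 2 times 7: near 0 the equation is
  \<open>q'' + 6 q' / r = - q\<close> to leading order, so
  \<open>q = q(0) (1 - r^2 / 14 + ...)\<close>, and \<open>1 / (r^2 + 14)\<close> has the same ratio
  of its first two coefficients. The constant in the upper bound comes instead from the far field:
  with \<open>k = h_plus t / t\<close> and \<open>\<beta> = 0\<close>, the residual has the
  coefficient \<open>6 - c (2 + 3 k)\<close> at \<open>r^2\<close>, and it vanishes exactly for
  \<open>c = t * lambda_sq t\<close>.\<close>

abbreviation icc :: "real \<Rightarrow> real measure" where
  "icc R \<equiv> restrict_space lborel {0..R}"

text \<open>Integrals over the interval are moved to one restricted finite measure, where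
  almost-everywhere statements and dominated convergence apply without indicator functions.\<close>

lemma LINT_icc: "(LINT r:{0..R}|lborel. f r) = integral\<^sup>L (icc R) (f :: real \<Rightarrow> real)"
  unfolding set_lebesgue_integral_def by (subst integral_restrict_space) auto

lemma integrable_icc: "set_integrable lborel {0..R} f \<longleftrightarrow> integrable (icc R) (f :: real \<Rightarrow> real)"
  unfolding set_integrable_def by (subst integrable_restrict_space) auto

lemma L2_on_iff:
  "L2_on R g \<longleftrightarrow> g \<in> borel_measurable (icc R) \<and> integrable (icc R) (\<lambda>r. (g r)\<^sup>2)"
  unfolding L2_on_def integrable_icc set_borel_measurable_def
  by (subst borel_measurable_restrict_space_iff) auto

lemma space_icc [simp]: "space (icc R) = {0..R}"
  by (simp add: space_restrict_space)

lemma finite_measure_icc: "finite_measure (icc R)"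
  by (rule finite_measureI, cases "0 \<le> R") (simp_all add: emeasure_restrict_space)

lemma AE_icc: "(AE x in icc R. P x) \<longleftrightarrow> (AE x in lborel. x \<in> {0..R} \<longrightarrow> P x)"
  by (subst AE_restrict_space_iff) auto

lemma AE_icc_neq: "AE x in icc R. x \<noteq> c"
  unfolding AE_icc using AE_lborel_singleton[of c] by eventually_elim auto

lemma has_integral_icc:
  fixes f :: "real \<Rightarrow> real"
  assumes "integrable (icc R) f"
  shows "(f has_integral (integral\<^sup>L (icc R) f)) {0..R}"
  using set_borel_integral_eq_integral[of "{0..R}" f] assms
  by (simp add: integrable_icc LINT_icc has_integral_iff)

lemma measurable_icc_continuous:
  fixes f :: "real \<Rightarrow> real"
  assumes "continuous_on {0..R} f" shows "f \<in> borel_measurable (icc R)"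
proof -
  have "sets (icc R) = sets (restrict_space borel {0..R})"
    by (intro sets_restrict_space_cong) simp
  then show ?thesis
    using borel_measurable_continuous_on_restrict[OF assms] measurable_cong_sets by blast
qed

lemma measurable_icc_borel:
  assumes "f \<in> borel_measurable borel" shows "f \<in> borel_measurable (icc R)"
  using assms by (intro measurable_restrict_space1) auto

lemma bounded_icc:
  fixes f :: "real \<Rightarrow> real"
  assumes "continuous_on {0..R} f"
  obtains B where "B \<ge> 0" "\<And>x. x \<in> {0..R} \<Longrightarrow> \<bar>f x\<bar> \<le> B"
proof -
  have "bounded (f ` {0..R})"
    using assms by (intro compact_imp_bounded compact_continuous_image) auto
  then obtain B where "\<forall>x\<in>f ` {0..R}. norm x \<le> B" by (auto simp: bounded_iff)
  then show ?thesis by (intro that[of "max B 0"]) (auto simp: le_max_iff_disj)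
qed

lemma integrable_icc_bounded_mult:
  fixes f g :: "real \<Rightarrow> real"
  assumes "integrable (icc R) g" "f \<in> borel_measurable (icc R)"
    and B: "\<And>x. x \<in> {0..R} \<Longrightarrow> \<bar>f x\<bar> \<le> B"
  shows "integrable (icc R) (\<lambda>x. f x * g x)"
proof (rule Bochner_Integration.integrable_bound[where f = "\<lambda>x. B * g x"])
  show "(\<lambda>x. f x * g x) \<in> borel_measurable (icc R)" using assms by measurable
  show "AE x in icc R. norm (f x * g x) \<le> norm (B * g x)"
  proof (rule AE_I2)
    fix x assume "x \<in> space (icc R)"
    then have "\<bar>f x\<bar> \<le> \<bar>B\<bar>" using B[of x] abs_ge_self[of B] by auto
    then show "norm (f x * g x) \<le> norm (B * g x)" by (simp add: abs_mult mult_right_mono)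
  qed
qed (use assms in auto)

lemma integrable_icc_continuous_mult:
  fixes f g :: "real \<Rightarrow> real"
  assumes "integrable (icc R) g" "continuous_on {0..R} f"
  shows "integrable (icc R) (\<lambda>x. f x * g x)"
  using bounded_icc[OF assms(2)] integrable_icc_bounded_mult[OF assms(1) measurable_icc_continuous[OF assms(2)]]
  by metis

lemma integrable_icc_const: "integrable (icc R) (\<lambda>x. c :: real)"
  using finite_measure_icc finite_measure.integrable_const by blast

lemma integrable_icc_continuous:
  fixes f :: "real \<Rightarrow> real"
  assumes "continuous_on {0..R} f"
  shows "integrable (icc R) f"
  using integrable_icc_continuous_mult[OF integrable_icc_const[of _ 1] assms] by simp

section \<open>Square-integrable functions on the interval\<close>

lemma L2_on_mult_integrable:
  assumes "L2_on R f" "L2_on R g"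
  shows "integrable (icc R) (\<lambda>x. f x * g x)"
proof (rule Bochner_Integration.integrable_bound[where f = "\<lambda>x. (f x)\<^sup>2 + (g x)\<^sup>2"])
  show "(\<lambda>x. f x * g x) \<in> borel_measurable (icc R)" using assms by (auto simp: L2_on_iff)
  show "AE x in icc R. norm (f x * g x) \<le> norm ((f x)\<^sup>2 + (g x)\<^sup>2)"
  proof (rule AE_I2)
    fix x
    have "2 * (\<bar>f x\<bar> * \<bar>g x\<bar>) \<le> (f x)\<^sup>2 + (g x)\<^sup>2"
      using sum_squares_bound[of "\<bar>f x\<bar>" "\<bar>g x\<bar>"] by (simp add: algebra_simps)
    then show "norm (f x * g x) \<le> norm ((f x)\<^sup>2 + (g x)\<^sup>2)"
      unfolding real_norm_def abs_mult
      using mult_nonneg_nonneg[OF abs_ge_zero[of "f x"] abs_ge_zero[of "g x"]] abs_ge_self[of "(f x)\<^sup>2 + (g x)\<^sup>2"]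
      by linarith
  qed
qed (use assms in \<open>auto simp: L2_on_iff\<close>)

lemma L2_on_continuous:
  assumes "continuous_on {0..R} f" shows "L2_on R f"
  unfolding L2_on_iff using assms
  by (auto intro!: measurable_icc_continuous integrable_icc_continuous continuous_intros)

lemma L2_on_integrable:
  assumes "L2_on R f" shows "integrable (icc R) f"
  using L2_on_mult_integrable[OF assms L2_on_continuous[of R "\<lambda>_. 1"]] by simp

lemma L2_on_add:
  assumes "L2_on R f" "L2_on R g"
  shows "L2_on R (\<lambda>x. f x + g x)"
  unfolding L2_on_iff power2_sum
  using assms L2_on_mult_integrable[OF assms] by (auto simp: L2_on_iff mult.assoc)

lemma L2_on_cmult:
  assumes "L2_on R f" shows "L2_on R (\<lambda>x. c * f x)"
  using assms unfolding L2_on_iff by (auto simp: power_mult_distrib)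

lemma L2_on_cong_AE:
  assumes "L2_on R f" "AE x in icc R. f x = g x" "g \<in> borel_measurable (icc R)"
  shows "L2_on R g"
  unfolding L2_on_iff
proof
  show "integrable (icc R) (\<lambda>r. (g r)\<^sup>2)"
    using assms by (subst integrable_cong_AE[where g = "\<lambda>r. (f r)\<^sup>2"]) (auto simp: L2_on_iff)
qed (rule assms)

section \<open>Test functions and smooth cutoffs\<close>

lemma test_functionI:
  assumes "\<And>x. (\<phi> has_real_derivative D x) (at x)" "continuous_on UNIV D"
    and "\<And>x. x \<notin> {a..b} \<Longrightarrow> \<phi> x = 0" "0 < a" "b < R"
  shows "test_function R \<phi>"
proof -
  have "closure {x. \<phi> x \<noteq> 0} \<subseteq> {a..b}"
    using assms(3) by (intro closure_minimal) (blast, simp)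
  then show ?thesis
    using assms unfolding test_function_def C1_differentiable_on_def has_real_derivative_iff_has_vector_derivative
    by (auto simp: compact_eq_bounded_closed intro: bounded_subset[of "{a..b}"])
qed

lemma test_functionE:
  assumes "test_function R \<phi>" "R > 0"
  obtains a b D where "0 < a" "a \<le> b" "b < R" "\<And>x. x \<notin> {a..b} \<Longrightarrow> \<phi> x = 0"
    "\<And>x. x \<notin> {a..b} \<Longrightarrow> D x = 0" "\<And>x. (\<phi> has_real_derivative D x) (at x)"
    "continuous_on UNIV D" "deriv \<phi> = D"
proof -
  let ?S = "closure {x. \<phi> x \<noteq> 0}"
  obtain D where D: "\<And>x. (\<phi> has_real_derivative D x) (at x)" "continuous_on UNIV D"
    using assms(1) unfolding test_function_def C1_differentiable_on_def
      has_real_derivative_iff_has_vector_derivative by blast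
  obtain a b where ab: "0 < a" "a \<le> b" "b < R" "?S \<subseteq> {a..b}"
  proof (cases "?S = {}")
    \<comment> \<open>The zero function has empty support; any degenerate interval inside
      \<open>(0,R)\<close> then serves as \<open>[a,b]\<close>.\<close>
    case True then show ?thesis using assms(2) that[of "R/2" "R/2"] by auto
  next
    case False
    have c: "compact ?S" and s: "?S \<subseteq> {0<..<R}" using assms(1) by (auto simp: test_function_def)
    obtain x where "x \<in> ?S" "\<forall>y\<in>?S. x \<le> y" using compact_attains_inf[OF c False] by blast
    moreover obtain z where "z \<in> ?S" "\<forall>y\<in>?S. y \<le> z" using compact_attains_sup[OF c False] by blast
    ultimately show ?thesis using s by (intro that[of x z]) (blast | force)+
  qed
  have z: "\<phi> x = 0" if "x \<notin> {a..b}" for x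
    using that ab(4) closure_subset[of "{x. \<phi> x \<noteq> 0}"] by blast
  have "D x = 0" if "x \<notin> {a..b}" for x
  proof -
    have "(\<phi> has_real_derivative 0) (at x)"
      by (rule has_field_derivative_transform_within_open[OF DERIV_const, where S = "- {a..b}"])
        (use z that in auto)
    then show ?thesis using D(1) DERIV_unique by blast
  qed
  moreover have "deriv \<phi> = D" using D(1) DERIV_imp_deriv by blast
  ultimately show ?thesis using that ab D z by metis
qed

text \<open>Squaring flattens the kink of the positive part. At a zero of \<open>f\<close> the
  difference quotient is at most that of \<open>f\<close> times \<open>\<bar>f y\<bar>\<close>,
  which tends to 0.\<close>

lemma max0_sq_deriv:
  assumes "(f has_real_derivative D) (at x)"
  shows "((\<lambda>x. (max 0 (f x))\<^sup>2) has_real_derivative 2 * max 0 (f x) * D) (at x)"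
proof -
  have c: "isCont f x" using assms DERIV_isCont by blast
  consider "f x > 0" | "f x < 0" | "f x = 0" by linarith
  then show ?thesis
  proof cases
    case 1
    have "((\<lambda>x. (f x)\<^sup>2) has_real_derivative 2 * max 0 (f x) * D) (at x)"
      using 1 by (auto intro!: derivative_eq_intros assms)
    moreover have "\<forall>\<^sub>F y in nhds x. f y > 0"
      using c 1 by (simp add: eventually_nhds_conv_at isCont_def order_tendsto_iff)
    then have "\<forall>\<^sub>F y in nhds x. (f y)\<^sup>2 = (max 0 (f y))\<^sup>2" by eventually_elim auto
    ultimately show ?thesis by (rule DERIV_cong_ev[OF refl _ refl, THEN iffD1, rotated])
  next
    case 2
    have "((\<lambda>x. 0) has_real_derivative 2 * max 0 (f x) * D) (at x)"
      using 2 by (auto intro!: derivative_eq_intros assms)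
    moreover have "\<forall>\<^sub>F y in nhds x. f y < 0"
      using c 2 by (simp add: eventually_nhds_conv_at isCont_def order_tendsto_iff)
    then have "\<forall>\<^sub>F y in nhds x. 0 = (max 0 (f y))\<^sup>2" by eventually_elim auto
    ultimately show ?thesis by (rule DERIV_cong_ev[OF refl _ refl, THEN iffD1, rotated])
  next
    case 3
    have "((\<lambda>y. ((f y) - f x) / (y - x)) \<longlongrightarrow> D) (at x)"
      using assms by (simp add: has_field_derivative_iff)
    moreover have "(f \<longlongrightarrow> 0) (at x)" using c 3 by (simp add: isCont_def)
    ultimately have "((\<lambda>y. \<bar>((f y) - f x) / (y - x)\<bar> * \<bar>f y\<bar>) \<longlongrightarrow> \<bar>D\<bar> * \<bar>0\<bar>) (at x)"
      by (intro tendsto_intros)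
    then have t: "((\<lambda>y. \<bar>((f y) - f x) / (y - x)\<bar> * \<bar>f y\<bar>) \<longlongrightarrow> 0) (at x)" by simp
    have "((\<lambda>y. ((max 0 (f y))\<^sup>2 - (max 0 (f x))\<^sup>2) / (y - x)) \<longlongrightarrow> 0) (at x)"
    proof (rule Lim_null_comparison[OF _ t])
      have "\<bar>(max 0 (f y))\<^sup>2\<bar> \<le> \<bar>f y\<bar> * \<bar>f y\<bar>" for y
        by (auto simp: max_def power2_eq_square)
      then show "\<forall>\<^sub>F y in at x. norm (((max 0 (f y))\<^sup>2 - (max 0 (f x))\<^sup>2) / (y - x)) \<le> \<bar>((f y) - f x) / (y - x)\<bar> * \<bar>f y\<bar>"
        using 3 by (auto simp: abs_mult abs_divide divide_right_mono)
    qed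
    then show ?thesis using 3 by (simp add: has_field_derivative_iff)
  qed
qed

text \<open>Test functions are only required to be C1, so the square of the positive part of a
  parabola is smooth enough and no exponential bump is needed.\<close>

definition bump :: "real \<Rightarrow> real \<Rightarrow> real \<Rightarrow> real" where
  "bump a b x = (max 0 ((x - a) * (b - x)))\<^sup>2"

lemma bump_deriv:
  "(bump a b has_real_derivative 2 * max 0 ((x - a) * (b - x)) * (a + b - 2 * x)) (at x)"
  unfolding bump_def [abs_def]
  by (rule max0_sq_deriv) (auto intro!: derivative_eq_intros simp: algebra_simps)

lemma bump_pos_iff: "a < b \<Longrightarrow> bump a b x > 0 \<longleftrightarrow> a < x \<and> x < b"
proof -
  assume ab: "a < b"
  have "bump a b x > 0 \<longleftrightarrow> (x - a) * (b - x) > 0"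
    by (cases "(x - a) * (b - x) > 0") (auto simp: bump_def)
  also have "\<dots> \<longleftrightarrow> a < x \<and> x < b"
    using ab by (auto simp: zero_less_mult_iff)
  finally show ?thesis .
qed

lemma bump_nonneg: "bump a b x \<ge> 0" by (simp add: bump_def)

lemma continuous_on_bump [continuous_intros]: "continuous_on A (bump a b)"
  unfolding bump_def [abs_def] by (intro continuous_intros)

lemma saturate_deriv:
  fixes f :: "real \<Rightarrow> real"
  assumes "(f has_real_derivative D) (at x)" "1 + c * f x > 0"
  shows "((\<lambda>x. c * f x / (1 + c * f x)) has_real_derivative c * D / (1 + c * f x)\<^sup>2) (at x)"
proof -
  have "((\<lambda>x. c * f x / (1 + c * f x)) has_real_derivative
     ((c * D) * (1 + c * f x) - (c * f x) * (0 + c * D)) / ((1 + c * f x) * (1 + c * f x))) (at x)"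
    using assms by (intro DERIV_divide DERIV_add DERIV_cmult DERIV_const) auto
  moreover have "(c * D) * (1 + c * f x) - (c * f x) * (0 + c * D) = c * D" by (simp add: algebra_simps)
  ultimately show ?thesis by (simp add: power2_eq_square)
qed

text \<open>The test functions \<open>n * bump / (1 + n * bump)\<close> increase to the indicator of the interval.\<close>

lemma interval_integral_zero:
  assumes g: "integrable (icc R) g"
    and z: "\<And>\<phi>. test_function R \<phi> \<Longrightarrow> integral\<^sup>L (icc R) (\<lambda>r. g r * \<phi> r) = 0"
    and ab: "0 < a" "a < b" "b < R"
  shows "integral\<^sup>L (icc R) (\<lambda>r. g r * indicator {a<..<b} r) = 0"
proof -
  define p where "p n x = real n * bump a b x / (1 + real n * bump a b x)" for n x
  have pos: "1 + real n * bump a b x > 0" for n x using bump_nonneg[of a b x] by (simp add: add_pos_nonneg)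
  then have pos': "1 + real n * bump a b x \<noteq> 0" for n x by (metis less_irrefl)
  have test: "test_function R (p n)" for n
  proof (rule test_functionI)
    show "(p n has_real_derivative
        real n * (2 * max 0 ((x - a) * (b - x)) * (a + b - 2 * x)) / (1 + real n * bump a b x)^2) (at x)" for x
      unfolding p_def [abs_def] by (rule saturate_deriv[OF bump_deriv pos])
    show "continuous_on UNIV (\<lambda>x. real n * (2 * max 0 ((x - a) * (b - x)) * (a + b - 2 * x)) / (1 + real n * bump a b x)^2)"
      using pos' by (intro continuous_intros) auto
    show "p n x = 0" if "x \<notin> {a..b}" for x
    proof -
      have "\<not> bump a b x > 0" using that ab by (subst bump_pos_iff) auto
      then have "bump a b x = 0" using bump_nonneg[of a b x] by linarith
      then show ?thesis by (simp add: p_def)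
    qed
  qed (use ab in auto)
  have m: "p n \<in> borel_measurable (icc R)" for n
    unfolding p_def[abs_def] using pos'
    by (intro measurable_icc_continuous continuous_intros) auto
  have "(\<lambda>n. integral\<^sup>L (icc R) (\<lambda>r. g r * p n r)) \<longlonglongrightarrow> integral\<^sup>L (icc R) (\<lambda>r. g r * indicator {a<..<b} r)"
  proof (rule integral_dominated_convergence[where w = "\<lambda>r. \<bar>g r\<bar>"])
    show "AE x in icc R. (\<lambda>n. g x * p n x) \<longlonglongrightarrow> g x * indicator {a<..<b} x"
    proof (rule AE_I2, rule tendsto_mult_left)
      fix x
      show "(\<lambda>n. p n x) \<longlonglongrightarrow> indicator {a<..<b} x"
      proof (cases "x \<in> {a<..<b}")
        case True
        then have "bump a b x > 0" using ab bump_pos_iff by auto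
        then have "(\<lambda>n. p n x) \<longlonglongrightarrow> 1" unfolding p_def by real_asymp
        then show ?thesis using True by simp
      next
        case False
        then have "\<not> bump a b x > 0" using ab by (subst bump_pos_iff) auto
        then have "bump a b x = 0" using bump_nonneg[of a b x] by linarith
        then show ?thesis using False by (simp add: p_def)
      qed
    qed
    have "\<bar>p n x\<bar> \<le> 1" for n x
      using pos[of n x] bump_nonneg[of a b x] by (simp add: p_def)
    then show "AE x in icc R. norm (g x * p n x) \<le> \<bar>g x\<bar>" for n
      by (simp add: abs_mult mult_left_le)
    show "(\<lambda>r. g r * indicator {a<..<b} r) \<in> borel_measurable (icc R)"
      by (rule borel_measurable_times[OF borel_measurable_integrable[OF g] measurable_icc_borel]) auto
  qed (use g m in auto)
  then show ?thesis using z[OF test] by (simp add: LIMSEQ_const_iff)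
qed

text \<open>A Dynkin argument: open intervals are stable under intersection and generate the Borel
  sets. The bounded support makes the total integral itself an interval integral, which the
  complement step needs.\<close>

lemma AE_zero_if_box_integrals_zero:
  fixes f :: "real \<Rightarrow> real"
  assumes f: "integrable lborel f"
    and z: "\<And>a b. a < b \<Longrightarrow> (LINT x:{a<..<b}|lborel. f x) = 0"
    and supp: "\<And>x. x \<notin> {c<..<d} \<Longrightarrow> f x = 0"
  shows "AE x in lborel. f x = 0"
proof -
  have si: "set_integrable lborel A f" if "A \<in> sets lborel" for A
    unfolding set_integrable_def by (rule integrable_mult_indicator[OF that f])
  have tot: "integral\<^sup>L lborel f = 0"
  proof (cases "c < d")
    case True
    have "integral\<^sup>L lborel f = (LINT x:{c<..<d}|lborel. f x)"
      unfolding set_lebesgue_integral_def using supp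
      by (intro Bochner_Integration.integral_cong) (auto simp: indicator_def)
    then show ?thesis using z[OF True] by simp
  next
    case False
    then have "f = (\<lambda>x. 0)" using supp by auto
    then show ?thesis by simp
  qed
  have zero: "(LINT x:A|lborel. f x) = 0" if "A \<in> sets lborel" for A
  proof -
    have stable: "Int_stable (range (\<lambda>(a, b). box a b :: real set))"
        "range (\<lambda>(a, b). box a b :: real set) \<subseteq> Pow UNIV"
      by (auto simp: Int_stable_def box_Int_box)
    from that have "A \<in> sigma_sets UNIV (range (\<lambda>(a, b). box a b :: real set))"
      by (simp add: borel_eq_box)
    with stable show ?thesis
    proof (induction rule: sigma_sets_induct_disjoint)
      case (basic A)
      then obtain a b where "A = {a<..<b}" by (auto simp: box_real)
      then show ?case using z[of a b] by (cases "a < b") (auto simp: set_lebesgue_integral_def)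
    next
      case empty then show ?case by (simp add: set_lebesgue_integral_def)
    next
      case (compl A)
      then have A: "A \<in> sets lborel" by (simp add: borel_eq_box)
      have "(LINT x:UNIV - A|lborel. f x) = integral\<^sup>L lborel f - (LINT x:A|lborel. f x)"
        unfolding set_lebesgue_integral_def
        by (subst Bochner_Integration.integral_diff[OF f si[OF A, unfolded set_integrable_def], symmetric],
            rule Bochner_Integration.integral_cong) (auto simp: indicator_def)
      then show ?case using compl tot by simp
    next
      case (union A)
      have A: "A i \<in> sets lborel" for i using union by (auto simp: borel_eq_box)
      have "(LINT x:(\<Union>i. A i)|lborel. f x) = (\<Sum>i. (LINT x:(A i)|lborel. f x))"
      proof (rule lebesgue_integral_countable_add)
        show "set_integrable lborel (\<Union>i. A i) f" using A by (intro si) auto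
      qed (use A union in \<open>auto simp: disjoint_family_on_def\<close>)
      then show ?case using union by simp
    qed
  qed
  show ?thesis
    using zero
    by (intro density_unique_real[OF f, of "\<lambda>_. 0"]) (auto simp: set_lebesgue_integral_def)
qed

lemma fundamental_lemma:
  assumes g: "integrable (icc R) g" and R: "R > 0"
    and z: "\<And>\<phi>. test_function R \<phi> \<Longrightarrow> integral\<^sup>L (icc R) (\<lambda>r. g r * \<phi> r) = 0"
  shows "AE x in icc R. g x = 0"
proof -
  \<comment> \<open>Extension by zero from the open interval turns an integral over any interval of
    the line into one over its intersection with \<open>(0,R)\<close>; only two null points are
    lost.\<close>
  let ?f = "\<lambda>x. indicator {0<..<R} x * g x"
  have ig: "integrable lborel (\<lambda>x. indicator {0..R} x * g x)"
    using g by (subst (asm) integrable_restrict_space) auto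
  have "integrable lborel (\<lambda>x. indicator {0<..<R} x *\<^sub>R (indicator {0..R} x * g x))"
    by (rule integrable_mult_indicator[OF _ ig]) auto
  then have i: "integrable lborel ?f"
    by (rule Bochner_Integration.integrable_cong[THEN iffD1, rotated 2]) (auto simp: indicator_def)
  have eq: "(LINT x:{a<..<b}|lborel. ?f x) = integral\<^sup>L (icc R) (\<lambda>x. g x * indicator {max 0 a<..<min R b} x)" for a b
    unfolding set_lebesgue_integral_def
    by (subst integral_restrict_space) (auto simp: indicator_def intro!: Bochner_Integration.integral_cong)
  have "(LINT x:{a<..<b}|lborel. ?f x) = 0" for a b
  proof -
    define a' where "a' = max 0 a"
    define b' where "b' = min R b"
    have "integral\<^sup>L (icc R) (\<lambda>x. g x * indicator {a'<..<b'} x) = 0"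
    proof (cases "a' < b'")
      case True
      \<comment> \<open>\<open>interval_integral_zero\<close> wants endpoints strictly inside
        \<open>(0,R)\<close>, so an interval reaching 0 or \<open>R\<close> is exhausted from
        within.\<close>
      have lim: "(\<lambda>n. integral\<^sup>L (icc R) (\<lambda>x. g x * indicator {a' + 1 / Suc n<..<b' - 1 / Suc n} x))
         \<longlonglongrightarrow> integral\<^sup>L (icc R) (\<lambda>x. g x * indicator {a'<..<b'} x)"
      proof (rule integral_dominated_convergence[where w = "\<lambda>r. \<bar>g r\<bar>"])
        show "AE x in icc R. (\<lambda>n. g x * indicator {a' + 1 / Suc n<..<b' - 1 / Suc n} x) \<longlonglongrightarrow> g x * indicator {a'<..<b'} x"
        proof (rule AE_I2, rule tendsto_mult_left)
          fix x
          show "(\<lambda>n. indicat_real {a' + 1 / Suc n<..<b' - 1 / Suc n} x) \<longlonglongrightarrow> indicator {a'<..<b'} x"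
          proof (cases "x \<in> {a'<..<b'}")
            case True
            have "(\<lambda>n. a' + 1 / Suc n) \<longlonglongrightarrow> a'" "(\<lambda>n. b' - 1 / Suc n) \<longlonglongrightarrow> b'" by real_asymp+
            then have "\<forall>\<^sub>F n in sequentially. a' + 1 / Suc n < x" "\<forall>\<^sub>F n in sequentially. x < b' - 1 / Suc n"
              using True by (auto simp: order_tendsto_iff)
            then have "\<forall>\<^sub>F n in sequentially. indicat_real {a' + 1 / Suc n<..<b' - 1 / Suc n} x = indicator {a'<..<b'} x"
              by eventually_elim (use True in auto)
            then show ?thesis by (rule tendsto_eventually)
          next
            case False
            moreover have "1 / Suc n > (0::real)" for n by simp
            ultimately have "x \<notin> {a' + 1 / Suc n<..<b' - 1 / Suc n}" for n
              by (smt (verit) greaterThanLessThan_iff)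
            then show ?thesis using False by simp
          qed
        qed
        show "(\<lambda>r. g r * indicator {a'<..<b'} r) \<in> borel_measurable (icc R)"
        by (rule borel_measurable_times[OF borel_measurable_integrable[OF g] measurable_icc_borel]) auto
        show "(\<lambda>r. g r * indicator {a' + 1 / Suc n<..<b' - 1 / Suc n} r) \<in> borel_measurable (icc R)" for n
        by (rule borel_measurable_times[OF borel_measurable_integrable[OF g] measurable_icc_borel]) auto
      qed (use g in \<open>auto simp: indicator_def\<close>)
      have "integral\<^sup>L (icc R) (\<lambda>x. g x * indicator {a' + 1 / Suc n<..<b' - 1 / Suc n} x) = 0" for n
      proof (cases "a' + 1 / Suc n < b' - 1 / Suc n")
        case True
        have p: "1 / Suc n > (0::real)" by simp
        have "0 \<le> a'" "b' \<le> R" by (auto simp: a'_def b'_def)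
        then have "0 < a' + 1 / Suc n" "b' - 1 / Suc n < R" using p by linarith+
        then show ?thesis using True by (intro interval_integral_zero[OF g z])
      next
        case False
        then show ?thesis by simp
      qed
      then show ?thesis using lim by (simp add: LIMSEQ_const_iff)
    qed auto
    then show ?thesis unfolding eq a'_def b'_def .
  qed
  then have "AE x in lborel. ?f x = 0"
    by (intro AE_zero_if_box_integrals_zero[OF i, of 0 R]) (auto simp: indicator_def)
  moreover have "AE x in lborel. x \<noteq> (0::real)" "AE x in lborel. x \<noteq> R" by (rule AE_lborel_singleton)+
  ultimately have "AE x in lborel. x \<in> {0..R} \<longrightarrow> g x = 0"
    by eventually_elim (auto simp: indicator_def split: if_splits)
  then show ?thesis by (simp add: AE_icc)
qed


text \<open>Makes the arbitrary choice in \<open>weak_deriv\<close> harmless: the difference of two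
  candidates is annihilated by every test function.\<close>

lemma weak_deriv_unique:
  assumes "R > 0" "L2_on R g1" "L2_on R g2" "is_weak_deriv R h g1" "is_weak_deriv R h g2"
  shows "AE x in icc R. g1 x = g2 x"
proof -
  have "AE x in icc R. g1 x - g2 x = 0"
  proof (rule fundamental_lemma)
    show "integrable (icc R) (\<lambda>x. g1 x - g2 x)" using assms L2_on_integrable by auto
    fix \<phi> assume t: "test_function R \<phi>"
    then obtain D where "\<And>x. (\<phi> has_real_derivative D x) (at x)" using test_functionE assms by metis
    then have "continuous_on {0..R} \<phi>" by (meson DERIV_isCont continuous_at_imp_continuous_on)
    then have i: "integrable (icc R) (\<lambda>x. g x * \<phi> x)" if "L2_on R g" for g
      using that L2_on_mult_integrable L2_on_continuous by blast
    have "integral\<^sup>L (icc R) (\<lambda>r. g1 r * \<phi> r) = integral\<^sup>L (icc R) (\<lambda>r. g2 r * \<phi> r)"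
      using assms t by (simp add: is_weak_deriv_def LINT_icc)
    then show "integral\<^sup>L (icc R) (\<lambda>r. (g1 r - g2 r) * \<phi> r) = 0"
      using i assms by (simp add: left_diff_distrib)
  qed (use assms in auto)
  then show ?thesis by simp
qed

lemma weak_deriv_some:
  assumes "h \<in> W12 R"
  shows "L2_on R (weak_deriv R h)" "is_weak_deriv R h (weak_deriv R h)"
  using someI_ex[of "\<lambda>g. L2_on R g \<and> is_weak_deriv R h g"] assms
  by (auto simp: W12_def weak_deriv_def)

lemma test_function_continuous:
  assumes "test_function R \<phi>" "R > 0" shows "continuous_on A \<phi>" "continuous_on A (deriv \<phi>)"
  using test_functionE[OF assms]
  by (metis DERIV_isCont continuous_at_imp_continuous_on) (metis continuous_on_subset subset_UNIV test_functionE[OF assms])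

text \<open>The fundamental theorem applied to \<open>u * \<phi>\<close>, whose boundary values
  vanish. The finite exceptional set admits corners, as produced later by reflecting a minimizer on
  an interval.\<close>

lemma classical_weak_deriv:
  assumes R: "R > 0" and S: "finite S" and c: "continuous_on {0..R} u"
    and d: "\<And>x. x \<in> {0<..<R} - S \<Longrightarrow> (u has_real_derivative g x) (at x)" and g: "L2_on R g"
  shows "is_weak_deriv R u g"
  unfolding is_weak_deriv_def LINT_icc
proof (intro allI impI)
  fix \<phi> assume t: "test_function R \<phi>"
  then obtain a b D where D: "0 < a" "a \<le> b" "b < R" "\<And>x. x \<notin> {a..b} \<Longrightarrow> \<phi> x = 0"
    "\<And>x. (\<phi> has_real_derivative D x) (at x)" "deriv \<phi> = D" using test_functionE R by metis
  note tc = test_function_continuous[OF t R]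
  have "((\<lambda>x. u x * deriv \<phi> x + g x * \<phi> x) has_integral (u R * \<phi> R - u 0 * \<phi> 0)) {0..R}"
  proof (rule fundamental_theorem_of_calculus_interior_strong[OF S])
    show "continuous_on {0..R} (\<lambda>x. u x * \<phi> x)" by (intro continuous_intros c tc)
    show "((\<lambda>x. u x * \<phi> x) has_vector_derivative u x * deriv \<phi> x + g x * \<phi> x) (at x)"
      if "x \<in> {0<..<R} - S" for x
      using DERIV_mult[OF d[OF that] D(5)] D(6)
      by (simp add: has_real_derivative_iff_has_vector_derivative algebra_simps)
  qed (use R in auto)
  moreover have "\<phi> R = 0" "\<phi> 0 = 0" using D by auto
  ultimately have 1: "((\<lambda>x. u x * deriv \<phi> x + g x * \<phi> x) has_integral 0) {0..R}" by simp
  have i: "integrable (icc R) (\<lambda>x. u x * deriv \<phi> x)" "integrable (icc R) (\<lambda>x. g x * \<phi> x)"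
    using L2_on_mult_integrable L2_on_continuous tc c g by blast+
  have "((\<lambda>x. u x * deriv \<phi> x + g x * \<phi> x) has_integral
      (integral\<^sup>L (icc R) (\<lambda>x. u x * deriv \<phi> x) + integral\<^sup>L (icc R) (\<lambda>x. g x * \<phi> x))) {0..R}"
    by (intro has_integral_add has_integral_icc i)
  with 1 have "integral\<^sup>L (icc R) (\<lambda>x. u x * deriv \<phi> x) + integral\<^sup>L (icc R) (\<lambda>x. g x * \<phi> x) = 0"
    using has_integral_unique by blast
  then show "integral\<^sup>L (icc R) (\<lambda>x. u x * deriv \<phi> x) = - integral\<^sup>L (icc R) (\<lambda>x. g x * \<phi> x)" by simp
qed

text \<open>The lemma of du Bois-Reymond: subtracting a multiple of a fixed bump of unit mass turns
  any test function into the derivative of one.\<close>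

lemma du_bois_reymond:
  assumes R: "R > 0" and v: "integrable (icc R) v"
    and z: "\<And>\<phi>. test_function R \<phi> \<Longrightarrow> integral\<^sup>L (icc R) (\<lambda>r. v r * deriv \<phi> r) = 0"
  shows "\<exists>c. AE x in icc R. v x = c"
proof -
  define \<beta> where "\<beta> = bump (R/3) (2*R/3)"
  have bc: "continuous_on A \<beta>" for A unfolding \<beta>_def by (rule continuous_on_bump)
  have b0: "\<beta> x = 0" if "x \<notin> {R/3..2*R/3}" for x
  proof -
    have "\<not> bump (R/3) (2*R/3) x > 0" using that R by (subst bump_pos_iff) auto
    then show ?thesis using bump_nonneg[of "R/3" "2*R/3" x] unfolding \<beta>_def by linarith
  qed
  have bint: "integrable (icc R) (\<lambda>x. f x * \<beta> x)" if "integrable (icc R) f" for f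
    using integrable_icc_continuous_mult[OF that bc] by (simp add: mult.commute)
  define M where "M = integral {0..R} \<beta>"
  have M: "M > 0"
  proof -
    have "\<beta> integrable_on {0..R}" using bc by (intro integrable_continuous_real)
    moreover have "\<beta> (R/2) > 0" unfolding \<beta>_def using R by (subst bump_pos_iff) auto
    ultimately have "integral {0..R} \<beta> \<noteq> 0"
      using integral_eq_0_iff[of 0 R \<beta>] bc bump_nonneg R unfolding \<beta>_def
      by (metis atLeastAtMost_iff divide_pos_pos half_gt_zero_iff less_eq_real_def less_irrefl field_sum_of_halves le_add_same_cancel1)
    moreover have "M \<ge> 0" unfolding M_def \<beta>_def by (rule integral_nonneg) (use bc bump_nonneg in \<open>auto simp: \<beta>_def intro: integrable_continuous_real\<close>)
    ultimately show ?thesis by (simp add: M_def)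
  qed
  \<comment> \<open>If \<open>v\<close> is almost everywhere constant, pairing it with
    \<open>\<beta>\<close> forces this value.\<close>
  define c where "c = integral\<^sup>L (icc R) (\<lambda>r. v r * \<beta> r) / M"
  have "AE x in icc R. v x - c = 0"
  proof (rule fundamental_lemma)
    show "integrable (icc R) (\<lambda>x. v x - c)" using v integrable_icc_const by auto
    fix \<phi> assume t: "test_function R \<phi>"
    then obtain a b where ab: "0 < a" "a \<le> b" "b < R" "\<And>x. x \<notin> {a..b} \<Longrightarrow> \<phi> x = 0"
      using test_functionE R by metis
    note tc = test_function_continuous[OF t R]
    \<comment> \<open>Chosen so that \<open>D\<close> has total integral 0; its antiderivative
      \<open>\<psi>\<close> then vanishes beyond the support on the right as well as on the
      left.\<close>
    define k where "k = integral {0..R} \<phi> / M"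
    define D where "D = (\<lambda>x. \<phi> x - k * \<beta> x)"
    define a' where "a' = min a (R/3)"
    define b' where "b' = max b (2*R/3)"
    have ab': "0 < a'" "a' \<le> b'" "b' < R" using ab R by (auto simp: a'_def b'_def)
    have D0: "D x = 0" if "x \<notin> {a'..b'}" for x
    proof -
      have "x \<notin> {a..b}" "x \<notin> {R/3..2*R/3}" using that unfolding a'_def b'_def by auto
      then show ?thesis using b0[of x] ab(4)[of x] by (simp add: D_def)
    qed
    have Dc: "continuous_on A D" for A unfolding D_def by (intro continuous_intros tc bc)
    have Di: "D integrable_on {x..y}" for x y by (intro integrable_continuous_real Dc)
    define \<psi> where "\<psi> x = integral {- 1..x} D" for x
    have z0: "integral {x..y} D = 0" if "\<And>z. z \<in> {x..y} \<Longrightarrow> D z = 0" for x y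
      using integral_cong[of "{x..y}" D "\<lambda>_. 0"] that by simp
    have i0: "integral {0..R} D = 0"
    proof -
      have "integral {0..R} D = integral {0..R} \<phi> - integral {0..R} (\<lambda>x. k * \<beta> x)"
        unfolding D_def by (intro integral_diff integrable_continuous_real continuous_intros tc bc)
      also have "\<dots> = 0" using M by (simp add: k_def M_def)
      finally show ?thesis .
    qed
    have psi1: "\<psi> x = 0" if "x < a'" for x
      unfolding \<psi>_def by (rule z0) (use that D0 in auto)
    have psi2: "\<psi> x = 0" if "x > b'" for x
    proof -
      have "\<psi> x = integral {-1..0} D + integral {0..x} D" unfolding \<psi>_def
        using that ab' by (intro Henstock_Kurzweil_Integration.integral_combine[symmetric] Di) auto
      also have "integral {-1..0} D = 0" by (rule z0) (use D0 ab' in auto)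
      also have "integral {0..x} D = integral {0..b'} D + integral {b'..x} D"
        using that ab' by (intro Henstock_Kurzweil_Integration.integral_combine[symmetric] Di) auto
      also have "integral {b'..x} D = integral {b'..R} D"
      proof -
        \<comment> \<open>\<open>D0\<close> covers only points outside the closed interval, so the
          value at its right end is obtained as a limit from the right.\<close>
        have "D b' = 0"
        proof (rule LIMSEQ_unique)
          show "(\<lambda>n. D (b' + 1 / Suc n)) \<longlonglongrightarrow> D b'"
            using Dc[of UNIV] by (intro isCont_tendsto_compose[of b' D]) (auto simp: continuous_on_eq_continuous_at, real_asymp)
          have "D (b' + 1 / Suc n) = 0" for n by (rule D0) (auto simp: divide_le_0_iff)
          then show "(\<lambda>n. D (b' + 1 / Suc n)) \<longlonglongrightarrow> 0" by simp
        qed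
        then have "D z = 0" if "z \<ge> b'" for z using that D0[of z] by (cases "z = b'") auto
        then have "integral {b'..y} D = 0" for y by (intro z0) auto
        then show ?thesis by simp
      qed
      also have "integral {0..b'} D + integral {b'..R} D = integral {0..R} D"
        using ab' by (intro Henstock_Kurzweil_Integration.integral_combine Di) auto
      finally show ?thesis using i0 by simp
    qed
    have der: "(\<psi> has_real_derivative D x) (at x)" for x
    proof (cases "x < a'")
      case True
      show ?thesis
        by (rule has_field_derivative_transform_within_open[of "\<lambda>_. 0" _ _ "{..<a'}"])
          (use True psi1 D0 in auto)
    next
      case False
      have "((\<lambda>u. integral {- 1..u} D) has_vector_derivative D x) (at x within ({-1..x+1} - {}))"
        using False ab' Dc[of "{-1..x+1}"]
        by (intro integral_has_vector_derivative_continuous_at Di) (auto simp: continuous_on_eq_continuous_within)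
      moreover have "at x within ({-1..x+1} - {}) = at x" using False ab' by (auto intro!: at_within_interior)
      ultimately show ?thesis unfolding \<psi>_def [abs_def] has_real_derivative_iff_has_vector_derivative by simp
    qed
    have "test_function R \<psi>"
      by (rule test_functionI[OF der Dc _ ab'(1,3)]) (use psi1 psi2 in force)
    then have "integral\<^sup>L (icc R) (\<lambda>r. v r * D r) = 0"
      using z der DERIV_imp_deriv by (metis (no_types, lifting) Bochner_Integration.integral_cong)
    moreover have iv: "integrable (icc R) (\<lambda>r. v r * \<phi> r)"
      using integrable_icc_continuous_mult[OF v tc(1)] by (simp add: mult.commute)
    moreover have "(\<lambda>r. v r * D r) = (\<lambda>r. v r * \<phi> r - k * (v r * \<beta> r))"
      by (auto simp: D_def algebra_simps)
    ultimately have "integral\<^sup>L (icc R) (\<lambda>r. v r * \<phi> r) = k * (c * M)"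
      using bint[OF v] M by (simp add: c_def)
    moreover have "integral\<^sup>L (icc R) \<phi> = k * M"
      using integral_unique[OF has_integral_icc[OF integrable_icc_continuous[OF tc(1)], where R = R]] M
      by (simp add: k_def)
    ultimately show "integral\<^sup>L (icc R) (\<lambda>r. (v r - c) * \<phi> r) = 0"
      using iv integrable_icc_continuous[OF tc(1)] by (simp add: left_diff_distrib)
  qed (use R in auto)
  then show ?thesis by auto
qed

subsection \<open>Regularity of minimizers\<close>

text \<open>With \<open>k = h_plus t / t\<close> the quadratic equation for \<open>h_plus t\<close>
  turns the cubic coefficient of the derivative of \<open>bulk t\<close> into
  \<open>1 + 3 k\<close>, and the cubic then factors. Its zeros are 0, 1 and the negative number
  \<open>- 1 / (1 + 3 k)\<close>, so its signs on \<open>[0,1]\<close> and above 1 can be read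
  off.\<close>

definition force :: "real \<Rightarrow> real \<Rightarrow> real" where
  "force t x = x * (x - 1) * ((1 + 3 * (h_plus t / t)) * x + 1)"

lemma h_plus_pos:
  assumes "t > 1" shows "h_plus t / t > 0"
proof -
  have "h_plus t > 0"
    unfolding h_plus_def using assms by (intro divide_pos_pos add_pos_nonneg) auto
  then show ?thesis using assms by simp
qed

lemma h_plus_sq_div:
  assumes "t > 1"
  shows "(h_plus t)\<^sup>2 / (2 * t) = (1 + 3 * (h_plus t / t)) / 4"
proof -
  have "(h_plus t)\<^sup>2 / (2 * t) = (2 * (h_plus t)\<^sup>2) / (4 * t)" by simp
  also have "\<dots> = (1 + 3 * (h_plus t / t)) / 4"
    unfolding h_plus_quadratic[OF assms] using assms by (simp add: field_simps)
  finally show ?thesis .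
qed

lemma bulk_eq:
  assumes "t > 1"
  shows "bulk t x = - (x\<^sup>2 / 2) - h_plus t / t * x ^ 3 + (1 + 3 * (h_plus t / t)) / 4 * x ^ 4 + bulk_const t"
  unfolding bulk_def h_plus_sq_div[OF assms] ..

lemma continuous_on_bulk [continuous_intros]:
  "continuous_on A f \<Longrightarrow> continuous_on A (\<lambda>x. bulk t (f x))"
  unfolding bulk_def divide_inverse by (intro continuous_intros)

lemma continuous_on_force [continuous_intros]:
  "continuous_on A f \<Longrightarrow> continuous_on A (\<lambda>x. force t (f x))"
  unfolding force_def by (intro continuous_intros)

text \<open>The weight \<open>r^2\<close> is multiplied out, which removes the division by
  \<open>r^2\<close>, and the derivative is an argument, so that any representative may be
  inserted.\<close>

definition energy_density :: "real \<Rightarrow> (real \<Rightarrow> real) \<Rightarrow> (real \<Rightarrow> real) \<Rightarrow> real \<Rightarrow> real" where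
  "energy_density t u g r = r\<^sup>2 * (g r)\<^sup>2 / 2 + (3 * (u r)\<^sup>2 + r\<^sup>2 * bulk t (u r))"

lemma integrable_energy_density:
  assumes "continuous_on {0..R} u" "L2_on R g"
  shows "integrable (icc R) (energy_density t u g)"
proof -
  have "integrable (icc R) (\<lambda>r. (r\<^sup>2 / 2) * (g r)\<^sup>2)"
    using assms(2) by (intro integrable_icc_continuous_mult continuous_intros) (auto simp: L2_on_iff)
  moreover have "integrable (icc R) (\<lambda>r. 3 * (u r)\<^sup>2 + r\<^sup>2 * bulk t (u r))"
    by (intro integrable_icc_continuous continuous_intros assms)
  ultimately have "integrable (icc R) (\<lambda>r. (r\<^sup>2 / 2) * (g r)\<^sup>2 + (3 * (u r)\<^sup>2 + r\<^sup>2 * bulk t (u r)))"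
    by (rule Bochner_Integration.integrable_add)
  then show ?thesis unfolding energy_density_def [abs_def] by simp
qed

lemma admissibleI:
  assumes "continuous_on {0..R} u" "L2_on R g" "is_weak_deriv R u g" "u R = 1"
  shows "u \<in> admissible R"
  using assms L2_on_continuous unfolding admissible_def W12_def by blast

lemma energy_eq:
  assumes "R > 0" "continuous_on {0..R} u" "L2_on R g" "is_weak_deriv R u g"
  shows "energy t R u = integral\<^sup>L (icc R) (energy_density t u g)"
proof -
  have w: "u \<in> W12 R" using assms L2_on_continuous unfolding W12_def by blast
  have ae: "AE x in icc R. weak_deriv R u x = g x"
    using weak_deriv_unique[OF assms(1) weak_deriv_some(1)[OF w] assms(3) weak_deriv_some(2)[OF w] assms(4)] .
  have [measurable]: "weak_deriv R u \<in> borel_measurable (icc R)" "g \<in> borel_measurable (icc R)"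
    "u \<in> borel_measurable (icc R)" "(\<lambda>r. bulk t (u r)) \<in> borel_measurable (icc R)"
    "(\<lambda>r. r) \<in> borel_measurable (icc R)"
    using assms weak_deriv_some[OF w]
    by (auto simp: L2_on_iff intro!: measurable_icc_continuous continuous_intros)
  show ?thesis
    unfolding energy_def LINT_icc
  proof (rule integral_cong_AE)
    show "(\<lambda>r. r\<^sup>2 * (1 / 2 * (weak_deriv R u r)\<^sup>2 + 3 * (u r)\<^sup>2 / r\<^sup>2 + bulk t (u r))) \<in> borel_measurable (icc R)"
      by measurable
    show "energy_density t u g \<in> borel_measurable (icc R)"
      unfolding energy_density_def [abs_def] by measurable
    \<comment> \<open>The two integrands can differ at \<open>r = 0\<close>, where division by zero
      yields 0; that point is null.\<close>
    show "AE r in icc R. r\<^sup>2 * (1 / 2 * (weak_deriv R u r)\<^sup>2 + 3 * (u r)\<^sup>2 / r\<^sup>2 + bulk t (u r)) = energy_density t u g r"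
      using ae AE_icc_neq[of 0 R]
      by eventually_elim (simp add: energy_density_def field_simps)
  qed
qed

section \<open>First variation of the energy\<close>

lemma minimizer_admissible:
  assumes "global_minimizer t R h"
  shows "h \<in> admissible R" "\<And>u. u \<in> admissible R \<Longrightarrow> energy t R h \<le> energy t R u"
  using assms unfolding global_minimizer_def is_arg_min_linorder by auto

lemma is_weak_deriv_add_test:
  assumes R: "R > 0" and h: "continuous_on {0..R} h" "L2_on R g" "is_weak_deriv R h g"
    and t: "test_function R \<phi>"
  shows "is_weak_deriv R (\<lambda>x. h x + e * \<phi> x) (\<lambda>x. g x + e * deriv \<phi> x)"
  unfolding is_weak_deriv_def LINT_icc
proof (intro allI impI)
  fix \<psi> assume p: "test_function R \<psi>"
  note tc = test_function_continuous[OF t R] and pc = test_function_continuous[OF p R]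
  have "is_weak_deriv R \<phi> (deriv \<phi>)"
  proof (rule classical_weak_deriv[where S = "{}"])
    show "(\<phi> has_real_derivative deriv \<phi> x) (at x)" for x
      using test_functionE[OF t R] by metis
  qed (use R tc L2_on_continuous in auto)
  then have 1: "integral\<^sup>L (icc R) (\<lambda>r. \<phi> r * deriv \<psi> r) = - integral\<^sup>L (icc R) (\<lambda>r. deriv \<phi> r * \<psi> r)"
    using p unfolding is_weak_deriv_def LINT_icc by blast
  have 2: "integral\<^sup>L (icc R) (\<lambda>r. h r * deriv \<psi> r) = - integral\<^sup>L (icc R) (\<lambda>r. g r * \<psi> r)"
    using p h unfolding is_weak_deriv_def LINT_icc by blast
  have i: "integrable (icc R) (\<lambda>r. h r * deriv \<psi> r)" "integrable (icc R) (\<lambda>r. g r * \<psi> r)"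
    "integrable (icc R) (\<lambda>r. \<phi> r * deriv \<psi> r)" "integrable (icc R) (\<lambda>r. deriv \<phi> r * \<psi> r)"
    using L2_on_mult_integrable L2_on_continuous tc pc h by blast+
  show "integral\<^sup>L (icc R) (\<lambda>r. (h r + e * \<phi> r) * deriv \<psi> r) = - integral\<^sup>L (icc R) (\<lambda>r. (g r + e * deriv \<phi> r) * \<psi> r)"
    using i 1 2 by (simp add: distrib_right mult.assoc)
qed

text \<open>Because the bulk potential is a quartic, the energy along \<open>h + e * \<phi>\<close>
  is a polynomial in \<open>e\<close>. The first variation is therefore a coefficient, and no
  differentiation under the integral sign is required.\<close>

lemma quartic_min_at_zero:
  fixes b c d e :: real
  assumes "\<And>x. 0 \<le> x * b + x\<^sup>2 * c + x ^ 3 * d + x ^ 4 * e"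
  shows "b = 0"
proof (rule DERIV_local_min)
  show "((\<lambda>x. x * b + x\<^sup>2 * c + x ^ 3 * d + x ^ 4 * e) has_real_derivative b) (at 0)"
    by (auto intro!: derivative_eq_intros)
  show "(0::real) < 1" by simp
qed (use assms in auto)

lemma euler_lagrange_weak:
  assumes t: "t > 1" and R: "R > 0" and min: "global_minimizer t R h"
    and g: "L2_on R g" "is_weak_deriv R h g" and test: "test_function R \<phi>"
  shows "integral\<^sup>L (icc R) (\<lambda>r. r\<^sup>2 * g r * deriv \<phi> r)
       = - integral\<^sup>L (icc R) (\<lambda>r. (6 * h r + r\<^sup>2 * force t (h r)) * \<phi> r)"
proof -
  define k where "k = h_plus t / t"
  have h: "continuous_on {0..R} h" "h R = 1"
    using minimizer_admissible(1)[OF min] by (auto simp: admissible_def W12_def)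
  note tc = test_function_continuous[OF test R]
  \<comment> \<open>\<open>E1\<close> to \<open>E4\<close> are the coefficients of \<open>e\<close>
    to \<open>e ^ 4\<close> in the energy density along the variation.\<close>
  define E1 where "E1 r = r\<^sup>2 * g r * deriv \<phi> r + (6 * h r + r\<^sup>2 * force t (h r)) * \<phi> r" for r
  define E2 where "E2 r = r\<^sup>2 * (deriv \<phi> r)\<^sup>2 / 2 + 3 * (\<phi> r)\<^sup>2
      + r\<^sup>2 * (\<phi> r)\<^sup>2 * (3 / 2 * (1 + 3 * k) * (h r)\<^sup>2 - 3 * k * h r - 1 / 2)" for r
  define E3 where "E3 r = r\<^sup>2 * (\<phi> r) ^ 3 * ((1 + 3 * k) * h r - k)" for r
  define E4 where "E4 r = r\<^sup>2 * (\<phi> r) ^ 4 * ((1 + 3 * k) / 4)" for r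
  have "integrable (icc R) (\<lambda>r. (r\<^sup>2 * deriv \<phi> r) * g r)"
    using g by (intro integrable_icc_continuous_mult continuous_intros tc L2_on_integrable)
  then have i1a: "integrable (icc R) (\<lambda>r. r\<^sup>2 * g r * deriv \<phi> r)" by (simp add: mult_ac)
  have i1b: "integrable (icc R) (\<lambda>r. (6 * h r + r\<^sup>2 * force t (h r)) * \<phi> r)"
    by (intro integrable_icc_continuous continuous_intros h tc)
  have i1: "integrable (icc R) E1"
    unfolding E1_def [abs_def] by (intro Bochner_Integration.integrable_add i1a i1b)
  have i2: "integrable (icc R) E2" "integrable (icc R) E3" "integrable (icc R) E4"
    unfolding E2_def [abs_def] E3_def [abs_def] E4_def [abs_def] divide_inverse
    by (intro integrable_icc_continuous continuous_intros h tc)+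
  note i0 = integrable_energy_density[OF h(1) g(1), of t]
  have exp: "energy_density t (\<lambda>x. h x + e * \<phi> x) (\<lambda>x. g x + e * deriv \<phi> x) r
      = energy_density t h g r + (e * E1 r + (e\<^sup>2 * E2 r + (e ^ 3 * E3 r + e ^ 4 * E4 r)))" for e r
    unfolding energy_density_def E1_def E2_def E3_def E4_def bulk_eq[OF t] force_def k_def[symmetric]
    by algebra
  have "0 \<le> e * integral\<^sup>L (icc R) E1 + e\<^sup>2 * integral\<^sup>L (icc R) E2 + e ^ 3 * integral\<^sup>L (icc R) E3
        + e ^ 4 * integral\<^sup>L (icc R) E4" for e
  proof -
    let ?u = "\<lambda>x. h x + e * \<phi> x" and ?g = "\<lambda>x. g x + e * deriv \<phi> x"
    have u: "continuous_on {0..R} ?u" by (intro continuous_intros h tc)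
    have l: "L2_on R ?g" by (intro L2_on_add L2_on_cmult L2_on_continuous g tc)
    have w: "is_weak_deriv R ?u ?g" by (rule is_weak_deriv_add_test[OF R h(1) g test])
    have "\<phi> R = 0" using test_functionE[OF test R] by (metis atLeastAtMost_iff not_le)
    then have "?u \<in> admissible R" using h by (intro admissibleI[OF u l w]) auto
    then have "energy t R h \<le> energy t R ?u" by (rule minimizer_admissible(2)[OF min])
    also have "energy t R ?u = integral\<^sup>L (icc R) (energy_density t h g) + (e * integral\<^sup>L (icc R) E1
       + (e\<^sup>2 * integral\<^sup>L (icc R) E2 + (e ^ 3 * integral\<^sup>L (icc R) E3 + e ^ 4 * integral\<^sup>L (icc R) E4)))"
      unfolding energy_eq[OF R u l w] exp [abs_def] using i0 i1 i2 by simp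
    also have "integral\<^sup>L (icc R) (energy_density t h g) = energy t R h"
      using energy_eq[OF R h(1) g] by simp
    finally show ?thesis by simp
  qed
  then have "integral\<^sup>L (icc R) E1 = 0" by (rule quartic_min_at_zero)
  then show ?thesis unfolding E1_def [abs_def] using i1a i1b by simp
qed

lemma continuous_AE_const:
  fixes f :: "real \<Rightarrow> real"
  assumes R: "R > 0" and c: "continuous_on {0..R} f" and ae: "AE x in icc R. f x = c" and x: "x \<in> {0..R}"
  shows "f x = c"
proof -
  let ?q = "\<lambda>x. (f x - c)\<^sup>2"
  have cq: "continuous_on {0..R} ?q" by (intro continuous_intros c)
  have "integral\<^sup>L (icc R) ?q = integral\<^sup>L (icc R) (\<lambda>x. 0)"
    by (rule integral_cong_AE) (use ae cq in \<open>auto intro!: measurable_icc_continuous\<close>)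
  then have "integral {0..R} ?q = 0"
    using integral_unique[OF has_integral_icc[OF integrable_icc_continuous[OF cq]]] by simp
  then have "?q x = 0" using integral_eq_0_iff[of 0 R ?q] cq R x by auto
  then show ?thesis by simp
qed

text \<open>du Bois-Reymond is used twice: first to find a continuous representative of the weak
  derivative, then to show that \<open>h\<close> is an antiderivative of it. The bound on
  \<open>r^2 h'\<close> is what is known near the origin at this stage.\<close>

lemma minimizer_regularity:
  assumes t: "t > 1" and R: "R > 0" and min: "global_minimizer t R h"
  obtains h' B where
    "\<And>r. r \<in> {0<..<R} \<Longrightarrow> (h has_real_derivative h' r) (at r)"
    "\<And>r. r \<in> {0<..<R} \<Longrightarrow> ((\<lambda>r. r\<^sup>2 * h' r) has_real_derivative 6 * h r + r\<^sup>2 * force t (h r)) (at r)"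
    "\<And>r. r \<in> {0<..<R} \<Longrightarrow> \<bar>r\<^sup>2 * h' r\<bar> \<le> B"
    "L2_on R h'" "is_weak_deriv R h h'"
proof -
  have hW: "h \<in> W12 R" and h: "continuous_on {0..R} h" "h R = 1"
    using minimizer_admissible(1)[OF min] by (auto simp: admissible_def W12_def)
  define g where "g = weak_deriv R h"
  have g: "L2_on R g" "is_weak_deriv R h g" using weak_deriv_some[OF hW] by (auto simp: g_def)
  define w where "w r = 6 * h r + r\<^sup>2 * force t (h r)" for r
  have wc: "continuous_on {0..R} w" unfolding w_def [abs_def] by (intro continuous_intros h)
  define W where "W x = integral {0..x} w" for x
  have Wc: "continuous_on {0..R} W" unfolding W_def [abs_def]
    by (intro indefinite_integral_continuous_1 integrable_continuous_real wc)
  have Wd: "(W has_real_derivative w x) (at x)" if "x \<in> {0<..<R}" for x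
  proof -
    have "(W has_vector_derivative w x) (at x within ({0..R} - {}))" unfolding W_def [abs_def]
      using that wc by (intro integral_has_vector_derivative_continuous_at integrable_continuous_real)
        (auto simp: continuous_on_eq_continuous_within)
    moreover have "at x within ({0..R} - {}) = at x" using that by (auto intro!: at_within_interior)
    ultimately show ?thesis by (simp add: has_real_derivative_iff_has_vector_derivative)
  qed
  have Ww: "is_weak_deriv R W w"
    by (rule classical_weak_deriv[where S = "{}"]) (use R Wc Wd wc L2_on_continuous in auto)
  have ri: "integrable (icc R) (\<lambda>r. r\<^sup>2 * g r)"
    using g by (intro integrable_icc_continuous_mult L2_on_integrable continuous_intros)
  \<comment> \<open>Integrating by parts against the antiderivative \<open>W\<close> of the
    right-hand side puts both terms of the weak equation onto \<open>deriv \<phi>\<close>.\<close>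
  have "\<exists>c. AE x in icc R. x\<^sup>2 * g x - W x = c"
  proof (rule du_bois_reymond[OF R])
    show "integrable (icc R) (\<lambda>x. x\<^sup>2 * g x - W x)"
      by (intro Bochner_Integration.integrable_diff ri integrable_icc_continuous Wc)
    fix \<phi> assume p: "test_function R \<phi>"
    note tc = test_function_continuous[OF p R]
    have i: "integrable (icc R) (\<lambda>r. r\<^sup>2 * g r * deriv \<phi> r)"
      using integrable_icc_continuous_mult[OF ri tc(2)] by (simp add: mult_ac)
    have j: "integrable (icc R) (\<lambda>r. W r * deriv \<phi> r)"
      by (intro integrable_icc_continuous continuous_intros Wc tc)
    have "integral\<^sup>L (icc R) (\<lambda>r. W r * deriv \<phi> r) = - integral\<^sup>L (icc R) (\<lambda>r. w r * \<phi> r)"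
      using Ww p unfolding is_weak_deriv_def LINT_icc by blast
    moreover have "integral\<^sup>L (icc R) (\<lambda>r. r\<^sup>2 * g r * deriv \<phi> r) = - integral\<^sup>L (icc R) (\<lambda>r. w r * \<phi> r)"
      using euler_lagrange_weak[OF t R min g p] unfolding w_def .
    ultimately show "integral\<^sup>L (icc R) (\<lambda>r. (r\<^sup>2 * g r - W r) * deriv \<phi> r) = 0"
      using i j by (simp add: left_diff_distrib)
  qed
  then obtain c where c: "AE x in icc R. x\<^sup>2 * g x - W x = c" by blast
  \<comment> \<open>The formula for \<open>g\<close> almost everywhere, solved for \<open>g\<close>;
    it is continuous on \<open>(0,R)\<close> because \<open>W\<close> is.\<close>
  define h' where "h' x = (c + W x) / x\<^sup>2" for x
  have h'm: "h' \<in> borel_measurable (icc R)" unfolding h'_def [abs_def]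
    using measurable_icc_continuous[OF Wc] measurable_icc_continuous[OF continuous_on_id, of R] by measurable
  have ae: "AE x in icc R. g x = h' x"
    using c AE_icc_neq[of 0 R] by eventually_elim (auto simp: h'_def field_simps)
  have h'L: "L2_on R h'" by (rule L2_on_cong_AE[OF g(1) ae h'm])
  have h'w: "is_weak_deriv R h h'" unfolding is_weak_deriv_def LINT_icc
  proof (intro allI impI)
    fix \<phi> assume p: "test_function R \<phi>"
    have "integral\<^sup>L (icc R) (\<lambda>r. h' r * \<phi> r) = integral\<^sup>L (icc R) (\<lambda>r. g r * \<phi> r)"
    proof (rule integral_cong_AE)
      show "AE x in icc R. h' x * \<phi> x = g x * \<phi> x" using ae by eventually_elim simp
    qed (use g(1) h'm measurable_icc_continuous[OF test_function_continuous(1)[OF p R]] in \<open>auto simp: L2_on_iff\<close>)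
    then show "integral\<^sup>L (icc R) (\<lambda>r. h r * deriv \<phi> r) = - integral\<^sup>L (icc R) (\<lambda>r. h' r * \<phi> r)"
      using g(2) p unfolding is_weak_deriv_def LINT_icc by auto
  qed
  have h'c: "isCont h' x" if "x \<in> {0<..<R}" for x
    unfolding h'_def [abs_def] using that DERIV_isCont[OF Wd[OF that]] by (intro continuous_intros) auto
  \<comment> \<open>Integrating from 0 is legitimate in spite of the factor \<open>1 / x^2\<close>:
    \<open>h'\<close> equals \<open>g\<close> almost everywhere and is thus square
    integrable.\<close>
  define H where "H x = integral {0..x} h'" for x
  have h'i: "h' integrable_on {0..R}"
    using has_integral_icc[OF L2_on_integrable[OF h'L]] by blast
  have Hc: "continuous_on {0..R} H" unfolding H_def [abs_def]
    by (intro indefinite_integral_continuous_1 h'i)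
  have Hd: "(H has_real_derivative h' x) (at x)" if "x \<in> {0<..<R}" for x
  proof -
    have "(H has_vector_derivative h' x) (at x within ({0..R} - {}))" unfolding H_def [abs_def]
      using that h'c[OF that] by (intro integral_has_vector_derivative_continuous_at h'i)
        (auto intro: continuous_at_imp_continuous_at_within)
    moreover have "at x within ({0..R} - {}) = at x" using that by (auto intro!: at_within_interior)
    ultimately show ?thesis by (simp add: has_real_derivative_iff_has_vector_derivative)
  qed
  have Hw: "is_weak_deriv R H h'"
    by (rule classical_weak_deriv[where S = "{}"]) (use R Hc Hd h'L in auto)
  have dc: "continuous_on {0..R} (\<lambda>x. h x - H x)" by (intro continuous_intros h Hc)
  have "\<exists>d. AE x in icc R. h x - H x = d"
  proof (rule du_bois_reymond[OF R])
    show "integrable (icc R) (\<lambda>x. h x - H x)" by (intro integrable_icc_continuous dc)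
    fix \<phi> assume p: "test_function R \<phi>"
    note tc = test_function_continuous[OF p R]
    have "integrable (icc R) (\<lambda>r. h r * deriv \<phi> r)" "integrable (icc R) (\<lambda>r. H r * deriv \<phi> r)"
      by (intro integrable_icc_continuous continuous_intros h Hc tc)+
    moreover have "integral\<^sup>L (icc R) (\<lambda>r. h r * deriv \<phi> r) = integral\<^sup>L (icc R) (\<lambda>r. H r * deriv \<phi> r)"
      using Hw h'w p unfolding is_weak_deriv_def LINT_icc by auto
    ultimately show "integral\<^sup>L (icc R) (\<lambda>r. (h r - H r) * deriv \<phi> r) = 0"
      by (simp add: left_diff_distrib)
  qed
  then obtain d where "AE x in icc R. h x - H x = d" by blast
  then have d: "h x = H x + d" if "x \<in> {0..R}" for x
    using continuous_AE_const[OF R dc _ that] by (simp add: algebra_simps)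
  obtain B where B: "\<And>x. x \<in> {0..R} \<Longrightarrow> \<bar>W x\<bar> \<le> B" using bounded_icc[OF Wc] by metis
  show ?thesis
  proof (rule that[of h' "\<bar>c\<bar> + B"])
    fix r assume r: "r \<in> {0<..<R}"
    show "(h has_real_derivative h' r) (at r)"
    proof (rule has_field_derivative_transform_within_open[where S = "{0<..<R}"])
      show "((\<lambda>x. H x + d) has_real_derivative h' r) (at r)"
        using Hd[OF r] by (auto intro!: derivative_eq_intros)
    qed (use r d in auto)
    have e: "x\<^sup>2 * h' x = c + W x" if "x \<in> {0<..<R}" for x using that by (simp add: h'_def)
    show "((\<lambda>r. r\<^sup>2 * h' r) has_real_derivative 6 * h r + r\<^sup>2 * force t (h r)) (at r)"
    proof (rule has_field_derivative_transform_within_open[where S = "{0<..<R}"])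
      show "((\<lambda>x. c + W x) has_real_derivative 6 * h r + r\<^sup>2 * force t (h r)) (at r)"
        using Wd[OF r] by (auto intro!: derivative_eq_intros simp: w_def)
    qed (use r e in auto)
    show "\<bar>r\<^sup>2 * h' r\<bar> \<le> \<bar>c\<bar> + B" unfolding e[OF r]
      using B[of r] r abs_triangle_ineq[of c "W r"] by auto
  qed (use h'L h'w in auto)
qed

subsection \<open>Behaviour at the origin and the bounds 0 and 1\<close>

text \<open>The mean value theorem on \<open>[s,r]\<close> followed by \<open>s\<close> tending to
  0. Only a right limit at 0 is assumed, since the flux \<open>r^6 q'\<close> is controlled on the
  open interval alone.\<close>

lemma abs_le_of_deriv_bound:
  fixes P :: "real \<Rightarrow> real"
  assumes d: "\<And>x. x \<in> {0<..r} \<Longrightarrow> (P has_real_derivative D x) (at x)"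
    and lim: "(P \<longlongrightarrow> 0) (at_right 0)" and r: "0 < r"
    and M: "\<And>x. x \<in> {0<..r} \<Longrightarrow> \<bar>D x\<bar> \<le> M"
  shows "\<bar>P r\<bar> \<le> M * r"
proof -
  have M0: "M \<ge> 0" using M[of r] r abs_ge_zero[of "D r"] by auto
  have "\<bar>P r - P s\<bar> \<le> M * r" if s: "0 < s" "s < r" for s
  proof -
    obtain z where z: "s < z" "z < r" "P r - P s = (r - s) * D z"
      using MVT2[of s r P D] d s by auto
    have "\<bar>(r - s) * D z\<bar> \<le> r * M"
      unfolding abs_mult using M[of z] z s by (intro mult_mono) auto
    then show ?thesis using z by (simp add: mult.commute)
  qed
  then have "\<forall>\<^sub>F s in at_right 0. \<bar>P r - P s\<bar> \<le> M * r"
    using r by (auto simp: eventually_at_right_field intro!: exI[of _ r])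
  moreover have "((\<lambda>s. \<bar>P r - P s\<bar>) \<longlongrightarrow> \<bar>P r - 0\<bar>) (at_right 0)"
    by (intro tendsto_intros lim)
  ultimately show ?thesis by (auto intro: tendsto_upperbound)
qed

text \<open>A second-derivative test in divergence form: at an interior maximum \<open>f'\<close>
  vanishes, and if \<open>c * f'\<close> increases strictly there, then \<open>f'\<close> is
  positive just to the right. It is applied with the weights \<open>r^2\<close> and
  \<open>r^6\<close>.\<close>

lemma exceeds_of_weighted_deriv_pos:
  fixes f :: "real \<Rightarrow> real"
  assumes f: "\<And>x. x \<in> {a<..<b} \<Longrightarrow> (f has_real_derivative f' x) (at x)"
    and c: "\<And>x. x \<in> {a<..<b} \<Longrightarrow> c x > 0" and x0: "x0 \<in> {a<..<b}"
    and D: "((\<lambda>x. c x * f' x) has_real_derivative D) (at x0)" "D > 0"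
  shows "\<exists>x\<in>{a<..<b}. f x > f x0"
proof (rule ccontr)
  assume "\<not> ?thesis"
  then have mx: "f x \<le> f x0" if "x \<in> {a<..<b}" for x using that by force
  have "f' x0 = 0"
  proof (rule DERIV_local_max[OF f[OF x0]])
    show "0 < min (x0 - a) (b - x0)" using x0 by auto
    show "\<forall>y. \<bar>x0 - y\<bar> < min (x0 - a) (b - x0) \<longrightarrow> f y \<le> f x0"
      using mx by (auto simp: abs_less_iff)
  qed
  moreover obtain d where d: "d > 0" "\<And>h. h > 0 \<Longrightarrow> h < d \<Longrightarrow> c x0 * f' x0 < c (x0 + h) * f' (x0 + h)"
    using DERIV_pos_inc_right[OF D] by blast
  ultimately have pos: "f' (x0 + h) > 0" if "h > 0" "h < d" "x0 + h < b" for h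
    using that c[of "x0 + h"] x0 d(2)[of h] by (auto simp: zero_less_mult_iff)
  define h where "h = min d (b - x0) / 2"
  have h: "0 < h" "h < d" "x0 + h < b" using d x0 by (auto simp: h_def min_def field_simps)
  obtain z where "x0 < z" "z < x0 + h" "f (x0 + h) - f x0 = (x0 + h - x0) * f' z"
    using MVT2[of x0 "x0 + h" f f'] f h x0 by auto
  note z = this
  have "f' z > 0" using pos[of "z - x0"] h z by auto
  with h(1) have "h * f' z > 0" by (rule mult_pos_pos)
  then have "f (x0 + h) > f x0" using z by simp
  then show False using mx[of "x0 + h"] h x0 by auto
qed

lemma bulk_uminus:
  assumes "t > 1" shows "bulk t (- x) = bulk t x + 2 * (h_plus t / t) * x ^ 3"
  unfolding bulk_eq[OF assms] by (simp add: algebra_simps)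

text \<open>The factor \<open>x\<close> of \<open>force t x\<close> is kept, so that any decay of
  \<open>h\<close> at the origin passes on to the force.\<close>

lemma force_linear_bound:
  assumes "t > 1" "\<bar>x\<bar> \<le> C"
  shows "\<bar>force t x\<bar> \<le> (C + 1) * ((1 + 3 * (h_plus t / t)) * C + 1) * \<bar>x\<bar>"
proof -
  note k = h_plus_pos[OF assms(1)]
  have "\<bar>x - 1\<bar> \<le> C + 1" using assms by linarith
  moreover have "\<bar>(1 + 3 * (h_plus t / t)) * x + 1\<bar> \<le> (1 + 3 * (h_plus t / t)) * C + 1"
  proof -
    have "\<bar>(1 + 3 * (h_plus t / t)) * x\<bar> \<le> (1 + 3 * (h_plus t / t)) * C"
      using k assms by (simp add: abs_mult)
    then show ?thesis by linarith
  qed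
  ultimately have "\<bar>x - 1\<bar> * \<bar>(1 + 3 * (h_plus t / t)) * x + 1\<bar> * \<bar>x\<bar>
      \<le> (C + 1) * ((1 + 3 * (h_plus t / t)) * C + 1) * \<bar>x\<bar>"
    using assms by (intro mult_right_mono mult_mono) auto
  then show ?thesis by (simp add: force_def abs_mult mult_ac)
qed

text \<open>The quotient \<open>q = h / r\<^sup>2\<close> turns the equation into \<open>(r\<^sup>6 q')' = r\<^sup>4 force t h\<close>.\<close>

definition profile :: "real \<Rightarrow> real \<Rightarrow> (real \<Rightarrow> real) \<Rightarrow> (real \<Rightarrow> real) \<Rightarrow> (real \<Rightarrow> real) \<Rightarrow> bool" where
  "profile t R h q p \<longleftrightarrow> continuous_on {0..R} q \<and> (\<forall>r\<in>{0..R}. h r = r\<^sup>2 * q r) \<and> h R = 1 \<and>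
     (\<forall>r\<in>{0<..<R}. (q has_real_derivative p r) (at r) \<and>
        ((\<lambda>r. r ^ 6 * p r) has_real_derivative r ^ 4 * force t (h r)) (at r)) \<and>
     ((\<lambda>r. r ^ 6 * p r) \<longlongrightarrow> 0) (at_right 0)"

text \<open>Two rounds of bootstrapping: bounded \<open>h\<close> gives \<open>p = O(1 / r)\<close>,
  hence \<open>h = O(r)\<close>, hence \<open>p\<close> bounded. Then \<open>h / r^2\<close> is
  Lipschitz near 0 and has a limit there, which becomes \<open>q 0\<close>.\<close>

lemma profile_exists:
  assumes t: "t > 1" and R: "R > 0" and hc: "continuous_on {0..R} h" and hR: "h R = 1"
    and h': "\<And>r. r \<in> {0<..<R} \<Longrightarrow> (h has_real_derivative h' r) (at r)"
      "\<And>r. r \<in> {0<..<R} \<Longrightarrow> ((\<lambda>r. r\<^sup>2 * h' r) has_real_derivative 6 * h r + r\<^sup>2 * force t (h r)) (at r)"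
      "\<And>r. r \<in> {0<..<R} \<Longrightarrow> \<bar>r\<^sup>2 * h' r\<bar> \<le> B"
  shows "\<exists>q p. profile t R h q p"
proof -
  define p where "p r = h' r / r\<^sup>2 - 2 * h r / r ^ 3" for r
  define P where "P r = r ^ 6 * p r" for r
  have Peq: "P r = r\<^sup>2 * (r\<^sup>2 * h' r) - 2 * r ^ 3 * h r" if "r > 0" for r
    using that by (simp add: P_def p_def field_simps power2_eq_square power3_eq_cube eval_nat_numeral)
  obtain C where C: "C \<ge> 0" "\<And>x. x \<in> {0..R} \<Longrightarrow> \<bar>h x\<bar> \<le> C" using bounded_icc[OF hc] by metis
  have qd: "((\<lambda>r. h r / r\<^sup>2) has_real_derivative p r) (at r)" if "r \<in> {0<..<R}" for r
    using that h'(1)[OF that] unfolding p_def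
    by (auto intro!: derivative_eq_intros simp: field_simps power2_eq_square power3_eq_cube)
  have Pd: "(P has_real_derivative r ^ 4 * force t (h r)) (at r)" if r: "r \<in> {0<..<R}" for r
  proof (rule has_field_derivative_transform_within_open[where S = "{0<..<R}"])
    show "((\<lambda>r. r\<^sup>2 * (r\<^sup>2 * h' r) - 2 * r ^ 3 * h r) has_real_derivative r ^ 4 * force t (h r)) (at r)"
      by (rule derivative_eq_intros h'(1)[OF r] h'(2)[OF r] refl)+
        (simp add: algebra_simps power2_eq_square power3_eq_cube power4_eq_xxxx)
  qed (use Peq r in auto)
  have B0: "B \<ge> 0" using h'(3)[of "R/2"] R abs_ge_zero[of "(R/2)\<^sup>2 * h' (R/2)"] by auto
  \<comment> \<open>In \<open>P = r^2 (r^2 h') - 2 r^3 h\<close> both brackets are bounded; this is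
    where the singular exponent -3 is ruled out.\<close>
  have Plim: "(P \<longlongrightarrow> 0) (at_right 0)"
  proof (rule Lim_null_comparison)
    have "\<bar>P r\<bar> \<le> r\<^sup>2 * B + 2 * r ^ 3 * C" if r: "r \<in> {0<..<R}" for r
    proof -
      have "\<bar>P r\<bar> \<le> \<bar>r\<^sup>2 * (r\<^sup>2 * h' r)\<bar> + \<bar>2 * r ^ 3 * h r\<bar>" using Peq[of r] r by (simp add: abs_triangle_ineq4)
      also have "\<dots> \<le> r\<^sup>2 * B + 2 * r ^ 3 * C"
        using h'(3)[OF r] C(2)[of r] r unfolding abs_mult by (intro add_mono mult_mono) auto
      finally show ?thesis .
    qed
    then show "\<forall>\<^sub>F r in at_right 0. norm (P r) \<le> r\<^sup>2 * B + 2 * r ^ 3 * C"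
      using R by (auto simp: eventually_at_right_field intro!: exI[of _ R])
    have "((\<lambda>r::real. r\<^sup>2 * B + 2 * r ^ 3 * C) \<longlongrightarrow> 0\<^sup>2 * B + 2 * 0 ^ 3 * C) (at_right 0)"
      by (intro tendsto_intros)
    then show "((\<lambda>r::real. r\<^sup>2 * B + 2 * r ^ 3 * C) \<longlongrightarrow> 0) (at_right 0)" by simp
  qed
  define L where "L = (C + 1) * ((1 + 3 * (h_plus t / t)) * C + 1)"
  have L0: "L \<ge> 0" unfolding L_def using C(1) h_plus_pos[OF t] by (intro mult_nonneg_nonneg add_nonneg_nonneg) auto
  have L: "\<bar>force t (h r)\<bar> \<le> L * \<bar>h r\<bar>" if "r \<in> {0..R}" for r
    unfolding L_def by (rule force_linear_bound[OF t C(2)[OF that]])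
  \<comment> \<open>Bootstrap: a bound \<open>\<bar>h r\<bar> \<le> A r\<^sup>n\<close> near 0 improves to \<open>\<bar>p r\<bar> \<le> L A r\<^sup>n / r\<close>.\<close>
  have boot: "\<bar>p r\<bar> \<le> L * A * r ^ n / r"
    if r: "r \<in> {0<..<R}" and A: "\<And>x. x \<in> {0<..r} \<Longrightarrow> \<bar>h x\<bar> \<le> A * x ^ n" for r A n
  proof -
    have "A * r ^ n \<ge> 0" using A[of r] r abs_ge_zero[of "h r"] by auto
    then have A0: "A \<ge> 0" using r mult_neg_pos[of A "r ^ n"] by (meson greaterThanLessThan_iff not_le zero_less_power)
    have "\<bar>P r\<bar> \<le> (r ^ 4 * (L * (A * r ^ n))) * r"
    proof (rule abs_le_of_deriv_bound[OF _ Plim])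
      fix x assume x: "x \<in> {0<..r}"
      show "(P has_real_derivative x ^ 4 * force t (h x)) (at x)" using Pd x r by auto
      have "\<bar>force t (h x)\<bar> \<le> L * (A * r ^ n)"
      proof -
        have "\<bar>h x\<bar> \<le> A * x ^ n" using A x by auto
        also have "\<dots> \<le> A * r ^ n" using x A0 by (intro mult_left_mono power_mono) auto
        finally show ?thesis using L[of x] x r L0 by (meson mult_left_mono order_trans greaterThanAtMost_iff greaterThanLessThan_iff atLeastAtMost_iff less_imp_le)
      qed
      then show "\<bar>x ^ 4 * force t (h x)\<bar> \<le> r ^ 4 * (L * (A * r ^ n))"
        unfolding abs_mult using x by (intro mult_mono) (auto intro: power_mono)
    qed (use r in auto)
    then have "r ^ 6 * \<bar>p r\<bar> \<le> (r ^ 4 * (L * (A * r ^ n))) * r" using r by (simp add: P_def abs_mult)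
    also have "\<dots> = r ^ 6 * (L * A * r ^ n / r)" using r by (simp add: field_simps eval_nat_numeral)
    finally show ?thesis by (rule mult_left_le_imp_le) (use r in simp)
  qed
  have p1: "\<bar>p r\<bar> \<le> L * C / r" if "r \<in> {0<..<R}" for r
    using boot[of r C 0] C(2) that by auto
  define r1 where "r1 = R / 2"
  have r1: "0 < r1" "r1 < R" using R by (auto simp: r1_def)
  \<comment> \<open>Integrating the bound \<open>L * C / r\<close> for \<open>p\<close> from
    \<open>r\<close> to \<open>r1\<close> bounds \<open>h / r^2\<close> by a constant plus
    \<open>L * C * r1 / r\<close>; multiplication by \<open>r^2\<close> gives
    \<open>A * r\<close>.\<close>
  define A where "A = \<bar>h r1 / r1\<^sup>2\<bar> * r1 + L * C * r1"
  have hA: "\<bar>h r\<bar> \<le> A * r" if r: "r \<in> {0<..r1}" for r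
  proof -
    have "\<bar>h r1 / r1\<^sup>2 - h r / r\<^sup>2\<bar> \<le> L * C / r * r1"
    proof (cases "r = r1")
      case True then show ?thesis using r L0 C(1) by simp
    next
      case False
      then obtain z where z: "r < z" "z < r1" "h r1 / r1\<^sup>2 - h r / r\<^sup>2 = (r1 - r) * p z"
        using MVT2[of r r1 "\<lambda>r. h r / r\<^sup>2" p] qd r r1 by auto
      have "\<bar>p z\<bar> \<le> L * C / z" using p1 z r r1 by auto
      also have "\<dots> \<le> L * C / r" using z r L0 C(1) by (intro divide_left_mono) auto
      finally have "\<bar>(r1 - r) * p z\<bar> \<le> r1 * (L * C / r)"
        unfolding abs_mult using r z r1 L0 C(1) by (intro mult_mono) auto
      then show ?thesis using z by (simp add: mult.commute)
    qed
    then have "\<bar>h r / r\<^sup>2\<bar> \<le> \<bar>h r1 / r1\<^sup>2\<bar> + L * C / r * r1" by linarith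
    then have "\<bar>h r\<bar> \<le> (\<bar>h r1 / r1\<^sup>2\<bar> + L * C / r * r1) * r\<^sup>2" using r by (simp add: pos_divide_le_eq abs_divide)
    also have "\<dots> = (\<bar>h r1 / r1\<^sup>2\<bar> * r + L * C * r1) * r" using r by (simp add: field_simps power2_eq_square)
    also have "\<dots> \<le> (\<bar>h r1 / r1\<^sup>2\<bar> * r1 + L * C * r1) * r"
      using r by (intro mult_right_mono add_right_mono mult_left_mono) auto
    finally show ?thesis by (simp add: A_def)
  qed
  have p2: "\<bar>p r\<bar> \<le> L * A" if "r \<in> {0<..<r1}" for r
    using boot[of r A 1] hA that r1 by auto
  have "uniformly_continuous_on {0<..<r1} (\<lambda>r. h r / r\<^sup>2)"
  proof (rule lipschitz_on_uniformly_continuous)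
    show "(L * A)-lipschitz_on {0<..<r1} (\<lambda>r. h r / r\<^sup>2)"
    proof (rule bounded_derivative_imp_lipschitz[where f' = "\<lambda>r. (*) (p r)"])
      show "((\<lambda>r. h r / r\<^sup>2) has_derivative (*) (p x)) (at x within {0<..<r1})" if "x \<in> {0<..<r1}" for x
        using qd[of x] that r1 unfolding has_field_derivative_def by (auto intro: has_derivative_at_withinI)
      show "onorm ((*) (p x)) \<le> L * A" if "x \<in> {0<..<r1}" for x
        by (rule onorm_bound) (use p2[OF that] in \<open>auto simp: abs_mult mult_right_mono intro: order_trans[OF abs_ge_zero]\<close>)
      show "0 \<le> L * A" using p2[of "r1/2"] r1 abs_ge_zero[of "p (r1/2)"] by auto
    qed auto
  qed
  then obtain l where l: "((\<lambda>r. h r / r\<^sup>2) \<longlongrightarrow> l) (at 0 within {0<..<r1})"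
    using uniformly_continuous_on_extension_at_closure[of "{0<..<r1}" _ 0] r1 by auto
  have l': "((\<lambda>r. h r / r\<^sup>2) \<longlongrightarrow> l) (at_right 0)"
  proof -
    have "at 0 within {0<..<r1} = at_right 0" by (rule at_within_nhd[of 0 "{..<r1}"]) (use r1 in auto)
    then show ?thesis using l by simp
  qed
  define q where "q r = (if r = 0 then l else h r / r\<^sup>2)" for r
  \<comment> \<open>The boundary condition at 0 is not imposed on admissible functions; it follows
    from the finite limit of \<open>h / r^2\<close> and continuity of \<open>h\<close>.\<close>
  have h0: "h 0 = 0"
  proof -
    have "(h \<longlongrightarrow> h 0) (at_right 0)"
      using hc[unfolded continuous_on_def, rule_format, of 0] R at_within_Icc_at_right[of 0 R] by simp
    moreover have "((\<lambda>r. r\<^sup>2 * (h r / r\<^sup>2)) \<longlongrightarrow> 0\<^sup>2 * l) (at_right 0)" by (intro tendsto_intros l')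
    then have "((\<lambda>r. r\<^sup>2 * (h r / r\<^sup>2)) \<longlongrightarrow> 0) (at_right 0)" by simp
    then have "(h \<longlongrightarrow> 0) (at_right 0)"
      by (rule Lim_transform_eventually) (auto simp: eventually_at_right_field intro!: exI[of _ 1])
    ultimately show ?thesis by (rule tendsto_unique[rotated]) simp
  qed
  have "profile t R h q p" unfolding profile_def
  proof (intro conjI ballI)
    show "continuous_on {0..R} q"
      unfolding continuous_on_eq_continuous_within
    proof
      fix x assume x: "x \<in> {0..R}"
      show "continuous (at x within {0..R}) q"
      proof (cases "x = 0")
        case True
        have "(q \<longlongrightarrow> l) (at_right 0)"
          by (rule tendsto_cong[THEN iffD1, OF _ l']) (auto simp: q_def eventually_at_right_field intro!: exI[of _ 1])
        then show ?thesis using True R by (simp add: continuous_within at_within_Icc_at_right q_def)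
      next
        case False
        have "((\<lambda>r. h r / r\<^sup>2) \<longlongrightarrow> h x / x\<^sup>2) (at x within {0..R})"
          using hc x False by (intro tendsto_intros) (auto simp: continuous_on_def)
        moreover have "\<forall>\<^sub>F r in at x within {0..R}. h r / r\<^sup>2 = q r"
          using eventually_neq_at_within[of 0] by eventually_elim (auto simp: q_def)
        ultimately have "(q \<longlongrightarrow> h x / x\<^sup>2) (at x within {0..R})" by (rule Lim_transform_eventually)
        then show ?thesis using False by (simp add: continuous_within q_def)
      qed
    qed
    show "h r = r\<^sup>2 * q r" for r using h0 by (simp add: q_def)
    show "(q has_real_derivative p r) (at r)" if r: "r \<in> {0<..<R}" for r
      by (rule has_field_derivative_transform_within_open[OF qd[OF r], where S = "{0<..<R}"])
        (use r in \<open>auto simp: q_def\<close>)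
    show "((\<lambda>r. r ^ 6 * p r) has_real_derivative r ^ 4 * force t (h r)) (at r)" if "r \<in> {0<..<R}" for r
      using Pd[OF that] unfolding P_def [abs_def] .
    show "((\<lambda>r. r ^ 6 * p r) \<longlongrightarrow> 0) (at_right 0)" using Plim unfolding P_def [abs_def] .
  qed (rule hR)
  then show ?thesis by blast
qed

text \<open>At an interior maximum above 1 both \<open>6 h\<close> and the force are positive, which
  contradicts maximality. Only the equation and the boundary values enter.\<close>

lemma solution_le_1:
  assumes t: "t > 1" and R: "R > 0" and hc: "continuous_on {0..R} h" and h0: "h 0 = 0" and hR: "h R = 1"
    and h': "\<And>r. r \<in> {0<..<R} \<Longrightarrow> (h has_real_derivative h' r) (at r)"
      "\<And>r. r \<in> {0<..<R} \<Longrightarrow> ((\<lambda>r. r\<^sup>2 * h' r) has_real_derivative 6 * h r + r\<^sup>2 * force t (h r)) (at r)"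
    and r: "r \<in> {0..R}"
  shows "h r \<le> 1"
proof (rule ccontr)
  assume "\<not> h r \<le> 1"
  obtain x where x: "x \<in> {0..R}" "\<And>y. y \<in> {0..R} \<Longrightarrow> h y \<le> h x"
    using continuous_attains_sup[OF compact_Icc _ hc] R by (metis atLeastAtMost_iff empty_iff less_imp_le order_refl)
  then have hx: "h x > 1" using \<open>\<not> h r \<le> 1\<close> r by (meson less_le_trans not_le)
  have x': "x \<in> {0<..<R}" using x(1) hx h0 hR by (cases "x = 0 \<or> x = R") auto
  have "force t (h x) > 0" unfolding force_def using hx h_plus_pos[OF t]
    by (intro mult_pos_pos add_pos_pos) auto
  then have "6 * h x + x\<^sup>2 * force t (h x) > 0" using hx x' by (intro add_pos_pos mult_pos_pos) auto
  from exceeds_of_weighted_deriv_pos[OF h'(1) _ x' h'(2)[OF x'] this]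
  obtain y where "y \<in> {0<..<R}" "h y > h x" by auto
  then show False using x(2)[of y] by auto
qed

text \<open>Replacing \<open>h\<close> by its absolute value could create infinitely many corners.
  Reflecting on the one interval between the zeros around \<open>r\<close> leaves two corners,
  within reach of \<open>classical_weak_deriv\<close>.\<close>

lemma minimizer_nonneg:
  assumes t: "t > 1" and R: "R > 0" and min: "global_minimizer t R h" and h0: "h 0 = 0"
    and h': "\<And>r. r \<in> {0<..<R} \<Longrightarrow> (h has_real_derivative h' r) (at r)" "L2_on R h'" "is_weak_deriv R h h'"
    and r: "r \<in> {0..R}"
  shows "h r \<ge> 0"
proof (rule ccontr)
  assume "\<not> h r \<ge> 0"
  then have hr: "h r < 0" by simp
  have hc: "continuous_on {0..R} h" and hR: "h R = 1"
    using minimizer_admissible(1)[OF min] by (auto simp: admissible_def W12_def)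
  have r': "0 < r" "r < R" using r hr h0 hR by (auto simp: less_le)
  have hc': "continuous_on {x..y} h" if "0 \<le> x" "y \<le> R" for x y
    using continuous_on_subset[OF hc] that by auto
  have Z: "compact ({x..y} \<inter> h -` {0})" if "0 \<le> x" "y \<le> R" for x y
  proof -
    have "closed ({x..y} \<inter> h -` {0})"
      using continuous_closed_preimage[OF hc'[OF that], of "{0}"] by auto
    then show ?thesis by (auto simp: compact_eq_bounded_closed intro: bounded_subset[of "{x..y}"])
  qed
  have "{0..r} \<inter> h -` {0} \<noteq> {}" using h0 r by auto
  \<comment> \<open>The last zero before \<open>r\<close>; below, \<open>b\<close> is the first zero
    after \<open>r\<close>, and the intermediate value theorem shows \<open>h \<le> 0\<close>
    between them.\<close>
  then obtain a where a: "a \<in> {0..r} \<inter> h -` {0}" "\<And>x. x \<in> {0..r} \<inter> h -` {0} \<Longrightarrow> x \<le> a"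
    using compact_attains_sup[OF Z[of 0 r]] r by (meson atLeastAtMost_iff order_refl)
  have "\<exists>x\<ge>r. x \<le> R \<and> h x = 0" by (rule IVT') (use hr hR r' hc' in auto)
  then have "{r..R} \<inter> h -` {0} \<noteq> {}" by auto
  then obtain b where b: "b \<in> {r..R} \<inter> h -` {0}" "\<And>x. x \<in> {r..R} \<inter> h -` {0} \<Longrightarrow> b \<le> x"
    using compact_attains_inf[OF Z[of r R]] r by (meson atLeastAtMost_iff order_refl)
  have ab: "0 \<le> a" "a < r" "r < b" "b \<le> R" "h a = 0" "h b = 0" using a(1) b(1) hr by (auto simp: less_le)
  have neg: "h x \<le> 0" if x: "x \<in> {a..b}" for x
  proof (rule ccontr)
    assume "\<not> h x \<le> 0"
    then have hx: "h x > 0" by simp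
    show False
    proof (cases "x \<le> r")
      case True
      have "\<exists>y\<ge>x. y \<le> r \<and> h y = 0" by (rule IVT2') (use True hx hr x ab r' hc' in auto)
      then obtain y where "x \<le> y" "y \<le> r" "h y = 0" by blast
      then have "y = a" using a(2)[of y] x ab by auto
      then show False using \<open>x \<le> y\<close> x hx ab by auto
    next
      case False
      have "\<exists>y\<ge>r. y \<le> x \<and> h y = 0" by (rule IVT') (use False hx hr x ab r' hc' in auto)
      then obtain y where "r \<le> y" "y \<le> x" "h y = 0" by blast
      then have "y = b" using b(2)[of y] x ab by auto
      then show False using \<open>y \<le> x\<close> x hx ab by auto
    qed
  qed
  define s :: "real \<Rightarrow> real" where "s x = (if x \<in> {a..b} then -1 else 1)" for x
  define u where "u x = (if x \<in> {a..b} then - h x else h x)" for x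
  have u_eq: "u x = s x * h x" for x by (simp add: u_def s_def)
  have uc: "continuous_on {0..R} u"
  proof -
    have "continuous_on ({a..b} \<union> ({0..a} \<union> {b..R})) u" unfolding u_def [abs_def]
      by (rule continuous_on_If) (use ab in \<open>auto intro!: continuous_intros continuous_on_subset[OF hc]\<close>)
    moreover have "{a..b} \<union> ({0..a} \<union> {b..R}) = {0..R}" using ab by auto
    ultimately show ?thesis by simp
  qed
  have sm: "s \<in> borel_measurable borel" unfolding s_def by measurable
  have gL: "L2_on R (\<lambda>x. s x * h' x)"
    unfolding L2_on_iff
  proof
    show "(\<lambda>x. s x * h' x) \<in> borel_measurable (icc R)"
      using h'(2) measurable_icc_borel[OF sm] by (auto simp: L2_on_iff)
    have "(s x * h' x)\<^sup>2 = (h' x)\<^sup>2" for x by (simp add: s_def)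
    then show "integrable (icc R) (\<lambda>x. (s x * h' x)\<^sup>2)" using h'(2) by (simp add: L2_on_iff)
  qed
  have uw: "is_weak_deriv R u (\<lambda>x. s x * h' x)"
  proof (rule classical_weak_deriv[OF R _ uc _ gL, of "{a, b}"])
    fix x assume x: "x \<in> {0<..<R} - {a, b}"
    show "(u has_real_derivative s x * h' x) (at x)"
    proof (cases "x \<in> {a..b}")
      case True
      have "((\<lambda>x. - h x) has_real_derivative s x * h' x) (at x)"
        using True h'(1)[of x] x by (auto simp: s_def intro!: derivative_eq_intros)
      then show ?thesis
        by (rule has_field_derivative_transform_within_open[where S = "{a<..<b}"]) (use True x in \<open>auto simp: u_def\<close>)
    next
      case False
      have "(h has_real_derivative s x * h' x) (at x)"
        using False h'(1)[of x] x by (auto simp: s_def)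
      then show ?thesis
        by (rule has_field_derivative_transform_within_open[where S = "- {a..b}"]) (use False x in \<open>auto simp: u_def\<close>)
    qed
  qed auto
  have uR: "u R = 1"
    using ab hR by (cases "b = R") (auto simp: u_def)
  define k where "k = h_plus t / t"
  have k: "k > 0" unfolding k_def by (rule h_plus_pos[OF t])
  \<comment> \<open>The pointwise energy drop caused by the reflection: the cubic term of the bulk
    potential is the only odd contribution.\<close>
  define \<psi> where "\<psi> x = x\<^sup>2 * (k * ((u x) ^ 3 - (h x) ^ 3))" for x
  have \<psi>c: "continuous_on {0..R} \<psi>" unfolding \<psi>_def [abs_def] by (intro continuous_intros uc hc)
  have \<psi>0: "\<psi> x \<ge> 0" if "x \<in> {0..R}" for x
  proof (cases "x \<in> {a..b}")
    case True
    have "0 \<le> (- h x) ^ 3" using neg[OF True] by (intro zero_le_power) simp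
    then have "0 \<le> x\<^sup>2 * (k * (2 * (- h x) ^ 3))" using k by (intro mult_nonneg_nonneg) auto
    then show ?thesis using True by (simp add: \<psi>_def u_def)
  next
    case False then show ?thesis unfolding \<psi>_def u_def by auto
  qed
  have dens: "energy_density t u (\<lambda>x. s x * h' x) x = energy_density t h h' x - \<psi> x" for x
  proof (cases "x \<in> {a..b}")
    case True
    then show ?thesis unfolding energy_density_def u_def \<psi>_def
      by (simp add: s_def bulk_uminus[OF t] k_def[symmetric] algebra_simps)
  next
    case False
    then show ?thesis unfolding energy_density_def u_def \<psi>_def by (auto simp: s_def)
  qed
  have "energy t R h \<le> energy t R u"
    by (rule minimizer_admissible(2)[OF min admissibleI[OF uc gL uw uR]])
  also have "energy t R u = energy t R h - integral\<^sup>L (icc R) \<psi>"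
    unfolding energy_eq[OF R uc gL uw] energy_eq[OF R hc h'(2,3)] dens [abs_def]
    by (intro Bochner_Integration.integral_diff integrable_energy_density hc h' integrable_icc_continuous \<psi>c)
  finally have "integral\<^sup>L (icc R) \<psi> \<le> 0" by simp
  moreover have eq: "integral\<^sup>L (icc R) \<psi> = integral {0..R} \<psi>"
    using integral_unique[OF has_integral_icc[OF integrable_icc_continuous[OF \<psi>c]]] by simp
  moreover have "integral {0..R} \<psi> \<ge> 0"
    by (rule integral_nonneg) (use \<psi>0 \<psi>c in \<open>auto intro: integrable_continuous_real\<close>)
  ultimately have "integral {0..R} \<psi> = 0" by linarith
  then have "\<psi> r = 0" using integral_eq_0_iff[of 0 R \<psi>] \<psi>c R \<psi>0 r by auto
  moreover have "\<psi> r = r\<^sup>2 * (k * (- 2 * (h r) ^ 3))" using ab by (simp add: \<psi>_def u_def)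
  ultimately show False using r' k hr by simp
qed

subsection \<open>Barriers\<close>

lemma nonpos_of_deriv_nonpos:
  fixes P :: "real \<Rightarrow> real"
  assumes d: "\<And>x. x \<in> {0<..r} \<Longrightarrow> (P has_real_derivative D x) (at x)"
    and lim: "(P \<longlongrightarrow> 0) (at_right 0)" and r: "0 < r"
    and M: "\<And>x. x \<in> {0<..r} \<Longrightarrow> D x \<le> 0"
  shows "P r \<le> 0"
proof (rule tendsto_lowerbound[OF lim])
  have "P r \<le> P s" if "0 < s" "s < r" for s
  proof (rule DERIV_nonpos_imp_nonincreasing[of s r P])
    show "\<exists>y. (P has_real_derivative y) (at x) \<and> y \<le> 0" if "s \<le> x" "x \<le> r" for x
      using d[of x] M[of x] that \<open>0 < s\<close> by auto
  qed (use that in auto)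
  then show "\<forall>\<^sub>F s in at_right 0. P r \<le> P s"
    using r by (auto simp: eventually_at_right_field intro!: exI[of _ r])
qed simp

text \<open>Passing to the limit at 0 loses strictness, so the limit argument is run at
  \<open>r / 2\<close> and strict monotonicity is used on \<open>[r/2, r]\<close>.\<close>

lemma pos_of_deriv_pos:
  fixes P :: "real \<Rightarrow> real"
  assumes d: "\<And>x. x \<in> {0<..r} \<Longrightarrow> (P has_real_derivative D x) (at x)"
    and lim: "(P \<longlongrightarrow> 0) (at_right 0)" and r: "0 < r"
    and M: "\<And>x. x \<in> {0<..r} \<Longrightarrow> D x > 0"
  shows "P r > 0"
proof -
  have "- P (r / 2) \<le> 0"
  proof (rule nonpos_of_deriv_nonpos[where P = "\<lambda>x. - P x" and D = "\<lambda>x. - D x"])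
    show "((\<lambda>x. - P x) has_real_derivative - D x) (at x)" if "x \<in> {0<..r/2}" for x
      using d[of x] that r by (auto intro: DERIV_minus)
    show "((\<lambda>x. - P x) \<longlongrightarrow> 0) (at_right 0)" using tendsto_minus[OF lim] by simp
    show "- D x \<le> 0" if "x \<in> {0<..r/2}" for x using M[of x] that r by auto
  qed (use r in auto)
  moreover have "P (r / 2) < P r"
  proof (rule DERIV_pos_imp_increasing[of "r / 2" r P])
    show "\<exists>y. (P has_real_derivative y) (at x) \<and> y > 0" if "r / 2 \<le> x" "x \<le> r" for x
      using d[of x] M[of x] that r by auto
  qed (use r in auto)
  ultimately show ?thesis by simp
qed

section \<open>Monotonicity and positivity of the quotient\<close>

lemma profileD:
  assumes "profile t R h q p"
  shows "continuous_on {0..R} q" "\<And>r. r \<in> {0..R} \<Longrightarrow> h r = r\<^sup>2 * q r" "h R = 1"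
    "\<And>r. r \<in> {0<..<R} \<Longrightarrow> (q has_real_derivative p r) (at r)"
    "\<And>r. r \<in> {0<..<R} \<Longrightarrow> ((\<lambda>r. r ^ 6 * p r) has_real_derivative r ^ 4 * force t (h r)) (at r)"
    "((\<lambda>r. r ^ 6 * p r) \<longlongrightarrow> 0) (at_right 0)"
  using assms unfolding profile_def by blast+

lemma force_nonpos:
  assumes "t > 1" "0 \<le> x" "x \<le> 1" shows "force t x \<le> 0"
proof -
  have "(1 + 3 * (h_plus t / t)) * x + 1 \<ge> 0"
    using h_plus_pos[OF assms(1)] assms by (intro add_nonneg_nonneg mult_nonneg_nonneg) auto
  moreover have "x * (x - 1) \<le> 0" using assms by (intro mult_nonneg_nonpos) auto
  ultimately show ?thesis unfolding force_def by (rule mult_nonpos_nonneg[rotated])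
qed

text \<open>The flux starts at 0 and has nonpositive derivative, so \<open>q\<close> decreases to
  its value at \<open>R\<close>. The positivity gained permits \<open>1 / q\<close> in both sliding
  arguments and yields \<open>a 2 > 0\<close>.\<close>

lemma profile_lower:
  assumes t: "t > 1" and R: "R > 0" and pr: "profile t R h q p"
    and b: "\<And>r. r \<in> {0..R} \<Longrightarrow> 0 \<le> h r \<and> h r \<le> 1" and r: "r \<in> {0..R}"
  shows "1 / R\<^sup>2 \<le> q r"
proof -
  note P = profileD[OF pr]
  have "p x \<le> 0" if x: "x \<in> {0<..<R}" for x
  proof -
    have "x ^ 6 * p x \<le> 0"
    proof (rule nonpos_of_deriv_nonpos[OF _ P(6)])
      fix y assume y: "y \<in> {0<..x}"
      show "((\<lambda>r. r ^ 6 * p r) has_real_derivative y ^ 4 * force t (h y)) (at y)" using P(5) x y by auto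
      show "y ^ 4 * force t (h y) \<le> 0"
        using force_nonpos[OF t] b[of y] x y by (intro mult_nonneg_nonpos) auto
    qed (use x in auto)
    then show ?thesis using x by (auto simp: mult_le_0_iff)
  qed
  note p_nonpos = this
  have "q R \<le> q r"
  proof (cases "r = R")
    case False
    have c: "continuous_on {r..R} q" using r by (intro continuous_on_subset[OF P(1)]) auto
    have "\<exists>l x. r < x \<and> x < R \<and> (q has_real_derivative l) (at x) \<and> q R - q r = (R - r) * l"
    proof (rule MVT[OF _ c])
      show "q differentiable at x" if "r < x" "x < R" for x
        unfolding real_differentiable_def using P(4)[of x] that r by auto
    qed (use False r in auto)
    then obtain l x where x: "r < x" "x < R" "(q has_real_derivative l) (at x)" "q R - q r = (R - r) * l"
      by blast
    then have "l = p x" using P(4)[of x] r by (auto intro: DERIV_unique)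
    then have "(R - r) * l \<le> 0" using p_nonpos[of x] x r by (intro mult_nonneg_nonpos) auto
    then show ?thesis using x by simp
  qed simp
  moreover have "q R = 1 / R\<^sup>2" using P(2)[of R] P(3) R by (simp add: field_simps)
  ultimately show ?thesis by simp
qed

text \<open>The barriers are \<open>\<alpha> r\<^sup>2 / (r\<^sup>2 + c)\<close>. For \<open>z = \<alpha> / (r\<^sup>2 + c)\<close> the residual
  \<open>r\<^sup>4 force t (r\<^sup>2 z) - (r\<^sup>6 z')'\<close> equals \<open>\<alpha> r\<^sup>6 / (r\<^sup>2 + c)\<^sup>3\<close> times the following polynomial
  in \<open>s = r\<^sup>2\<close>, where \<open>\<beta> = \<alpha> - 1\<close>.\<close>

definition residual :: "real \<Rightarrow> real \<Rightarrow> real \<Rightarrow> real \<Rightarrow> real" where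
  "residual m \<beta> c s = 14 * c + 6 * s + (\<beta> * s - c) * ((1 + m * (1 + \<beta>)) * s + c)"

text \<open>With \<open>s = r^2\<close> and \<open>m = 1 + 3 * (h_plus t / t)\<close> the first
  summand is \<open>force t (s * z) / s\<close>, the second is \<open>- (r^6 z')' / r^6\<close>; the
  identity puts them over one denominator.\<close>

lemma barrier_force:
  assumes "s + c > (0::real)" and z: "z = (1 + \<beta>) / (s + c)"
  shows "z * (s * z - 1) * (m * (s * z) + 1) + (1 + \<beta>) * (6 * s + 14 * c) / (s + c) ^ 3
    = (1 + \<beta>) * residual m \<beta> c s / (s + c) ^ 3"
proof -
  define S where "S = s + c"
  define X where "X = (1 + m * (1 + \<beta>)) * s + c"
  have S: "S > 0" "z = (1 + \<beta>) / S" using assms by (auto simp: S_def)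
  have 1: "s * z - 1 = (\<beta> * s - c) / S" "m * (s * z) + 1 = X / S"
    using S(1) unfolding S(2) by (simp_all add: field_simps) (simp_all add: S_def X_def algebra_simps)
  have 2: "\<alpha> / S * (Y / S) * (X / S) + \<alpha> * W / S ^ 3 = \<alpha> * (W + Y * X) / S ^ 3" for \<alpha> Y W
    by (simp add: power3_eq_cube add_divide_distrib distrib_left mult_ac)
  show ?thesis unfolding 1 unfolding S(2) S_def[symmetric] 2
    by (simp add: residual_def X_def algebra_simps)
qed

lemma barrier_deriv:
  assumes "c > 0"
  shows "((\<lambda>r. a / (r\<^sup>2 + c)) has_real_derivative - (2 * a * r) / (r\<^sup>2 + c)\<^sup>2) (at r)"
    "((\<lambda>r. r ^ 6 * (- (2 * a * r) / (r\<^sup>2 + c)\<^sup>2)) has_real_derivative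
        - (r ^ 6 * (a * (6 * r\<^sup>2 + 14 * c) / (r\<^sup>2 + c) ^ 3))) (at r)"
proof -
  have p: "r\<^sup>2 + c > 0" using assms by (simp add: add_nonneg_pos)
  show "((\<lambda>r. a / (r\<^sup>2 + c)) has_real_derivative - (2 * a * r) / (r\<^sup>2 + c)\<^sup>2) (at r)"
    using p by (auto intro!: derivative_eq_intros simp: power2_eq_square)
  define S where "S = r\<^sup>2 + c"
  have p': "(r\<^sup>2 + c)\<^sup>2 \<noteq> 0" using p by simp
  have "((\<lambda>r. - (2 * a) * r ^ 7) has_real_derivative - (2 * a) * (7 * r ^ 6)) (at r)"
    by (auto intro!: derivative_eq_intros)
  moreover have "((\<lambda>r. (r\<^sup>2 + c)\<^sup>2) has_real_derivative 2 * S * (2 * r)) (at r)"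
    by (auto intro!: derivative_eq_intros simp: S_def)
  ultimately have "((\<lambda>r. (- (2 * a) * r ^ 7) / (r\<^sup>2 + c)\<^sup>2) has_real_derivative
    (- (2 * a) * (7 * r ^ 6) * S\<^sup>2 - (- (2 * a) * r ^ 7) * (2 * S * (2 * r))) / (S\<^sup>2 * S\<^sup>2)) (at r)"
    using p' unfolding S_def by (rule DERIV_divide)
  moreover have "(\<lambda>r. (- (2 * a) * r ^ 7) / (r\<^sup>2 + c)\<^sup>2) = (\<lambda>r. r ^ 6 * (- (2 * a * r) / (r\<^sup>2 + c)\<^sup>2))"
    by (simp add: fun_eq_iff eval_nat_numeral)
  \<comment> \<open>One factor \<open>S\<close> is split off for cancellation, and
    \<open>14 S - 8 r^2\<close> is \<open>6 r^2 + 14 c\<close>.\<close>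
  moreover have "(- (2 * a) * (7 * r ^ 6) * S\<^sup>2 - (- (2 * a) * r ^ 7) * (2 * S * (2 * r))) / (S\<^sup>2 * S\<^sup>2)
     = S * (- (r ^ 6 * (a * (14 * S - 8 * r\<^sup>2)))) / (S * S ^ 3)"
    by (rule arg_cong2[where f = "(/)"]) algebra+
  ultimately have "((\<lambda>r. r ^ 6 * (- (2 * a * r) / (r\<^sup>2 + c)\<^sup>2)) has_real_derivative
     S * (- (r ^ 6 * (a * (14 * S - 8 * r\<^sup>2)))) / (S * S ^ 3)) (at r)" by simp
  also have "S * (- (r ^ 6 * (a * (14 * S - 8 * r\<^sup>2)))) / (S * S ^ 3) = - (r ^ 6 * (a * (14 * S - 8 * r\<^sup>2))) / S ^ 3"
    using p by (intro mult_divide_mult_cancel_left) (simp add: S_def)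
  also have "\<dots> = - (r ^ 6 * (a * (6 * r\<^sup>2 + 14 * c) / S ^ 3))"
    by (simp add: S_def algebra_simps minus_divide_left)
  finally show "((\<lambda>r. r ^ 6 * (- (2 * a * r) / (r\<^sup>2 + c)\<^sup>2)) has_real_derivative
        - (r ^ 6 * (a * (6 * r\<^sup>2 + 14 * c) / (r\<^sup>2 + c) ^ 3))) (at r)" unfolding S_def .
qed

text \<open>A strict comparison principle for both sides at once: \<open>\<sigma> = 1\<close> puts
  the barrier above \<open>q\<close>, \<open>\<sigma> = -1\<close> below. The difference
  \<open>d\<close> has a maximum 0 at the contact point, while the derivative of its flux is
  positive there.\<close>

lemma no_touching:
  fixes t \<sigma> \<beta> c :: real
  defines "m \<equiv> 1 + 3 * (h_plus t / t)" and "z \<equiv> \<lambda>r. (1 + \<beta>) / (r\<^sup>2 + c)"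
  assumes R: "R > 0" and pr: "profile t R h q p" and c: "c > 0" and \<beta>: "1 + \<beta> > 0"
    and r0: "r0 \<in> {0..<R}" "q r0 = z r0"
    and le: "\<And>r. r \<in> {0..R} \<Longrightarrow> \<sigma> * (q r - z r) \<le> 0"
    and N: "\<And>r. r \<in> {0..<R} \<Longrightarrow> \<sigma> * residual m \<beta> c (r\<^sup>2) > 0"
  shows False
proof -
  note P = profileD[OF pr]
  have cp: "r\<^sup>2 + c > 0" for r using c by (simp add: add_nonneg_pos)
  then have cn: "r\<^sup>2 + c \<noteq> 0" for r by (metis less_irrefl)
  \<comment> \<open>This is \<open>force t (r^2 x) / r^2\<close>, so the flux equation becomes
    \<open>(r^6 q')' = r^6 G r (q r)\<close>.\<close>
  define G where "G r x = x * (r\<^sup>2 * x - 1) * (m * (r\<^sup>2 * x) + 1)" for r x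
  \<comment> \<open>At the contact point the two \<open>G\<close> terms cancel and only the residual
    remains; continuity extends its sign to a neighbourhood.\<close>
  define K where "K r = \<sigma> * (G r (q r) - G r (z r) + (1 + \<beta>) * residual m \<beta> c (r\<^sup>2) / (r\<^sup>2 + c) ^ 3)" for r
  have Kc: "continuous_on {0..R} K"
    unfolding K_def [abs_def] G_def residual_def z_def using cn
    by (intro continuous_intros P(1)) auto
  have K0: "K r0 > 0"
  proof -
    have "K r0 = (1 + \<beta>) * (\<sigma> * residual m \<beta> c (r0\<^sup>2)) / (r0\<^sup>2 + c) ^ 3"
      unfolding K_def r0(2) by simp
    then show ?thesis using N[OF r0(1)] \<beta> cp[of r0] by simp
  qed
  define d where "d r = \<sigma> * (q r - z r)" for r
  define z' where "z' r = - (2 * (1 + \<beta>) * r) / (r\<^sup>2 + c)\<^sup>2" for r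
  define d' where "d' r = \<sigma> * (p r - z' r)" for r
  have z'1: "(z has_real_derivative z' r) (at r)" for r
    unfolding z_def z'_def by (rule barrier_deriv(1)[OF c])
  define Y where "Y r = (1 + \<beta>) * (6 * r\<^sup>2 + 14 * c) / (r\<^sup>2 + c) ^ 3" for r
  have z'2: "((\<lambda>r. r ^ 6 * z' r) has_real_derivative - (r ^ 6 * Y r)) (at r)" for r
    unfolding z'_def Y_def by (rule barrier_deriv(2)[OF c])
  have fe: "(\<lambda>r. r ^ 6 * d' r) = (\<lambda>r. \<sigma> * (r ^ 6 * p r - r ^ 6 * z' r))"
    unfolding d'_def by (simp add: fun_eq_iff algebra_simps)
  have dd: "(d has_real_derivative d' r) (at r)" if "r \<in> {0<..<R}" for r
    unfolding d_def [abs_def] d'_def by (intro DERIV_cmult DERIV_diff P(4)[OF that] z'1)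
  have d2: "((\<lambda>r. r ^ 6 * d' r) has_real_derivative r ^ 6 * K r) (at r)" if r: "r \<in> {0<..<R}" for r
  proof -
    have "((\<lambda>r. \<sigma> * (r ^ 6 * p r - r ^ 6 * z' r)) has_real_derivative
       \<sigma> * (r ^ 4 * force t (h r) - - (r ^ 6 * Y r))) (at r)"
      by (intro DERIV_cmult DERIV_diff P(5)[OF r] z'2)
    moreover have "r ^ 4 * force t (h r) = r ^ 6 * G r (q r)"
      using P(2)[of r] r by (simp add: force_def G_def m_def eval_nat_numeral mult_ac)
    moreover have "Y r = (1 + \<beta>) * residual m \<beta> c (r\<^sup>2) / (r\<^sup>2 + c) ^ 3 - G r (z r)"
      using barrier_force[OF cp[of r], of "z r" \<beta> m] unfolding G_def z_def Y_def by simp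
    ultimately show ?thesis unfolding fe K_def by (simp add: algebra_simps)
  qed
  show False
  proof (cases "r0 = 0")
    case False
    then have r0': "r0 \<in> {0<..<R}" using r0 by auto
    have "r0 ^ 6 * K r0 > 0" using r0' K0 by simp
    then obtain x where "x \<in> {0<..<R}" "d x > d r0"
      using exceeds_of_weighted_deriv_pos[OF dd _ r0' d2[OF r0']] by auto
    then show False using le[of x] r0 by (auto simp: d_def)
  next
    \<comment> \<open>At the origin no interior test applies. The flux of \<open>d\<close> starts at
      0 with positive derivative, so \<open>d\<close> increases from its supposed maximum.\<close>
    case True
    have "\<forall>\<^sub>F r in at_right 0. K r > 0"
    proof -
      have "(K \<longlongrightarrow> K 0) (at_right 0)"
        using Kc[unfolded continuous_on_def, rule_format, of 0] R at_within_Icc_at_right[of 0 R] by simp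
      then show ?thesis using K0 True by (auto simp: order_tendsto_iff)
    qed
    then obtain e where e: "e > 0" "\<And>r. 0 < r \<Longrightarrow> r < e \<Longrightarrow> K r > 0"
      by (auto simp: eventually_at_right_field)
    define r1 where "r1 = min e R / 2"
    have r1: "0 < r1" "r1 < e" "r1 < R" using e R by (auto simp: r1_def min_def)
    have lim: "((\<lambda>r. r ^ 6 * d' r) \<longlongrightarrow> 0) (at_right 0)"
    proof -
      have "((\<lambda>r. \<sigma> * (r ^ 6 * p r - r ^ 6 * z' r)) \<longlongrightarrow> \<sigma> * (0 - 0 ^ 6 * z' 0)) (at_right 0)"
        unfolding z'_def using c by (intro tendsto_intros P(6)) auto
      then show ?thesis unfolding fe by simp
    qed
    have d'p: "d' r > 0" if r: "r \<in> {0<..r1}" for r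
    proof -
      have "r ^ 6 * d' r > 0"
      proof (rule pos_of_deriv_pos[OF _ lim])
        fix x assume x: "x \<in> {0<..r}"
        show "((\<lambda>r. r ^ 6 * d' r) has_real_derivative x ^ 6 * K x) (at x)" using d2 x r r1 by auto
        show "x ^ 6 * K x > 0" using e(2)[of x] x r r1 by auto
      qed (use r in auto)
      then show ?thesis using r by (auto simp: zero_less_mult_iff)
    qed
    have "d 0 < d r1"
    proof (rule DERIV_pos_imp_increasing_open[OF r1(1)])
      show "\<exists>y. (d has_real_derivative y) (at x) \<and> y > 0" if "0 < x" "x < r1" for x
        using dd[of x] d'p[of x] that r1 by auto
      show "continuous_on {0..r1} d" unfolding d_def [abs_def] z_def using cn r1
        by (intro continuous_intros continuous_on_subset[OF P(1)]) auto
    qed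
    then show False using le[of r1] r0 r1 True by (auto simp: d_def)
  qed
qed

text \<open>The maximum of \<open>1 / q - r\<^sup>2\<close> is the parameter \<open>c\<close> at which the barrier touches \<open>q\<close> from below.\<close>

lemma subsolution_bound:
  assumes t: "t > 1" and R: "R > 0" and pr: "profile t R h q p"
    and b: "\<And>r. r \<in> {0..R} \<Longrightarrow> 0 \<le> h r \<and> h r \<le> 1" and r: "r \<in> {0..R}"
  shows "1 / (r\<^sup>2 + 14) \<le> q r"
proof (rule ccontr)
  assume neg: "\<not> ?thesis"
  note P = profileD[OF pr]
  have qp: "q x > 0" if "x \<in> {0..R}" for x
    using profile_lower[OF t R pr b that] R by (smt (verit) zero_less_divide_1_iff zero_less_power)
  then have qn: "q x \<noteq> 0" if "x \<in> {0..R}" for x using that by (metis less_irrefl)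
  define C where "C x = 1 / q x - x\<^sup>2" for x
  have "continuous_on {0..R} C" unfolding C_def [abs_def] using qn
    by (intro continuous_intros P(1)) auto
  then obtain r0 where r0: "r0 \<in> {0..R}" "\<And>x. x \<in> {0..R} \<Longrightarrow> C x \<le> C r0"
    using continuous_attains_sup[OF compact_Icc, of 0 R C] R by (metis atLeastAtMost_iff empty_iff less_imp_le order_refl)
  define c where "c = C r0"
  have "14 < C r" using neg qp[OF r] by (simp add: C_def field_simps not_le add_pos_nonneg)
  then have c: "c > 14" using r0(2)[OF r] by (simp add: c_def)
  \<comment> \<open>At \<open>R\<close> the touching parameter is 0, far below 14, so the contact
    cannot lie on the boundary.\<close>
  have "q R = 1 / R\<^sup>2" using P(2)[of R] P(3) R by (simp add: field_simps)
  then have "C R = 0" by (simp add: C_def)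
  then have "r0 \<noteq> R" using c by (auto simp: c_def)
  have cp: "x\<^sup>2 + c > 0" for x using c by (simp add: add_nonneg_pos)
  show False
  proof (rule no_touching[OF R pr, of c 0 r0 "-1"])
    show "q r0 = (1 + 0) / (r0\<^sup>2 + c)" using qp[OF r0(1)] by (simp add: c_def C_def)
    show "- 1 * (q x - (1 + 0) / (x\<^sup>2 + c)) \<le> 0" if x: "x \<in> {0..R}" for x
    proof -
      have "1 / q x \<le> x\<^sup>2 + c" using r0(2)[OF x] by (simp add: C_def c_def)
      then have "1 / (x\<^sup>2 + c) \<le> q x" using qp[OF x] cp[of x] by (simp add: field_simps)
      then show ?thesis by simp
    qed
    show "- 1 * residual (1 + 3 * (h_plus t / t)) 0 c (x\<^sup>2) > 0" for x
    proof -
      define k where "k = h_plus t / t"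
      have k: "k > 0" unfolding k_def by (rule h_plus_pos[OF t])
      \<comment> \<open>For \<open>\<beta> = 0\<close> the residual is linear in \<open>x^2\<close>.
        Its constant term is strictly negative exactly because \<open>c\<close> exceeds 14, which
        settles contact at the origin too.\<close>
      have "c * (14 - c) < 0" using c by (intro mult_pos_neg) auto
      moreover have "x\<^sup>2 * (6 - c * (2 + 3 * k)) \<le> 0"
      proof (intro mult_nonneg_nonpos)
        have "c * 2 \<le> c * (2 + 3 * k)" using c k by (intro mult_left_mono) auto
        then show "6 - c * (2 + 3 * k) \<le> 0" using c by linarith
      qed auto
      moreover have "residual (1 + 3 * k) 0 c (x\<^sup>2) = c * (14 - c) + x\<^sup>2 * (6 - c * (2 + 3 * k))"
        unfolding residual_def by algebra
      ultimately show ?thesis unfolding k_def by linarith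
    qed
  qed (use c r0 \<open>r0 \<noteq> R\<close> in auto)
qed

text \<open>As a quadratic in \<open>s\<close> the residual can have a negative linear coefficient,
  but only down to \<open>- 18 \<beta>\<close>. Completing the square against the quadratic term, of
  size at least \<open>\<beta> (1 + m) s^2\<close>, leaves a deficit
  \<open>81 \<beta> / (1 + m)\<close>, which the constant term \<open>c (14 - c)\<close>
  covers.\<close>

lemma residual_pos:
  fixes m \<beta> c s :: real
  assumes m: "m > 1" and \<beta>: "0 < \<beta>" "\<beta> \<le> 1 / 4" and c: "0 < c" "c \<le> (1 + \<beta>) * (6 / (1 + m))" and s: "s \<ge> 0"
  shows "residual m \<beta> c s > 0"
proof -
  have \<beta>4: "4 * \<beta> \<le> 1" using \<beta>(2) by simp
  define b where "b = 6 - c * (1 + m + \<beta> * (m - 1))"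
  have eq: "residual m \<beta> c s = c * (14 - c) + s * b + \<beta> * (1 + m * (1 + \<beta>)) * s\<^sup>2"
    unfolding residual_def b_def by algebra
  have cm: "c * (1 + m) \<le> 6 + 6 * \<beta>" using c m by (simp add: field_simps)
  have "c * 2 \<le> c * (1 + m)" using c m by (intro mult_left_mono) auto
  then have c6: "c \<le> 6" using cm \<beta>4 by linarith
  have q: "\<beta> * (1 + m * (1 + \<beta>)) * s\<^sup>2 \<ge> \<beta> * ((1 + m) * s\<^sup>2)"
  proof -
    have "(1 + m) * s\<^sup>2 \<le> (1 + m * (1 + \<beta>)) * s\<^sup>2"
      using \<beta> m by (intro mult_right_mono) (simp_all add: algebra_simps)
    then have "\<beta> * ((1 + m) * s\<^sup>2) \<le> \<beta> * ((1 + m * (1 + \<beta>)) * s\<^sup>2)"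
      using \<beta> by (intro mult_left_mono) auto
    then show ?thesis by (simp only: mult.assoc)
  qed
  have c8: "c * 8 \<le> c * (14 - c)" using c c6 by (intro mult_left_mono) auto
  show ?thesis
  proof (cases "b \<ge> 0")
    case True
    have "s * b \<ge> 0" "\<beta> * ((1 + m) * s\<^sup>2) \<ge> 0" using True s \<beta> m by auto
    then show ?thesis using eq q c8 c by linarith
  next
    case False
    have "c * (\<beta> * (m - 1)) \<le> \<beta> * 12"
    proof -
      have "c * (m - 1) \<le> c * (1 + m)" using c by (intro mult_left_mono) auto
      then have "c * (m - 1) \<le> 12" using cm \<beta>4 by linarith
      then have "\<beta> * (c * (m - 1)) \<le> \<beta> * 12" using \<beta> by (intro mult_left_mono) auto
      then show ?thesis by (simp add: mult_ac)
    qed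
    moreover have "b = 6 - c * (1 + m) - c * (\<beta> * (m - 1))" by (simp add: b_def algebra_simps)
    ultimately have "b \<ge> - (18 * \<beta>)" using cm by linarith
    then have "s * b \<ge> s * (- (18 * \<beta>))" using s by (intro mult_left_mono)
    moreover have "\<beta> * ((1 + m) * s\<^sup>2) + \<beta> * (81 / (1 + m)) \<ge> 18 * \<beta> * s"
    proof -
      have "0 \<le> ((1 + m) * s - 9)\<^sup>2 / (1 + m)" using m by simp
      also have "((1 + m) * s - 9)\<^sup>2 = (1 + m) * ((1 + m) * s\<^sup>2 - 18 * s) + 81" by algebra
      also have "\<dots> / (1 + m) = (1 + m) * s\<^sup>2 - 18 * s + 81 / (1 + m)"
        using m by (simp add: add_divide_distrib)
      finally have "0 \<le> \<beta> * ((1 + m) * s\<^sup>2 - 18 * s + 81 / (1 + m))" using \<beta> by simp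
      then show ?thesis by (simp add: algebra_simps)
    qed
    \<comment> \<open>A negative \<open>b\<close> keeps \<open>c\<close> away from 0: it forces
      \<open>8 c (1 + m) > 24\<close>, while \<open>\<beta> \<le> 1 / 4\<close> gives
      \<open>81 \<beta> < 24\<close>.\<close>
    moreover have "\<beta> * (81 / (1 + m)) < c * 8"
    proof -
      have "\<beta> * (m - 1) \<le> m - 1" using mult_right_mono[of \<beta> 1 "m - 1"] \<beta> m by simp
      then have "\<beta> * (m - 1) \<le> 1 + m" by linarith
      then have "c * (1 + m + \<beta> * (m - 1)) \<le> c * (2 * (1 + m))" using c by (intro mult_left_mono) auto
      then have "c * (2 * (1 + m)) > 6" using False by (simp add: b_def)
      moreover have "c * (2 * (1 + m)) * 4 = (c * 8) * (1 + m)" by simp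
      ultimately have "\<beta> * 81 < (c * 8) * (1 + m)" using \<beta>4 by linarith
      then have "\<beta> * 81 / (1 + m) < c * 8" using m by (subst pos_divide_less_eq) auto
      then show ?thesis by simp
    qed
    moreover have "s * (- (18 * \<beta>)) = - (18 * \<beta> * s)" by simp
    ultimately show ?thesis using eq q c8 by linarith
  qed
qed

text \<open>The mirror image of the sliding argument: the minimum of
  \<open>(1 + \<beta>) / q - r^2\<close> is the parameter at which the barrier touches
  \<open>q\<close> from above. A violated bound puts this minimum below \<open>c1\<close>, where
  \<open>residual_pos\<close> applies.\<close>

lemma supersolution_bound:
  assumes t: "t > 1" and R: "R > 0" and pr: "profile t R h q p"
    and b: "\<And>r. r \<in> {0..R} \<Longrightarrow> 0 \<le> h r \<and> h r \<le> 1" and r: "r \<in> {0..R}"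
    and \<beta>: "0 < \<beta>" "\<beta> \<le> 1 / 4" and c1: "c1 = (1 + \<beta>) * (6 / (2 + 3 * (h_plus t / t)))" "c1 < \<beta> * R\<^sup>2"
  shows "q r \<le> (1 + \<beta>) / (r\<^sup>2 + c1)"
proof (rule ccontr)
  assume neg: "\<not> ?thesis"
  note P = profileD[OF pr]
  have k: "h_plus t / t > 0" by (rule h_plus_pos[OF t])
  have c1p: "c1 > 0" unfolding c1(1) using \<beta> k by simp
  have qp: "q x > 0" if "x \<in> {0..R}" for x
    using profile_lower[OF t R pr b that] R by (smt (verit) zero_less_divide_1_iff zero_less_power)
  then have qn: "q x \<noteq> 0" if "x \<in> {0..R}" for x using that by (metis less_irrefl)
  define C where "C x = (1 + \<beta>) / q x - x\<^sup>2" for x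
  have "continuous_on {0..R} C" unfolding C_def [abs_def] using qn
    by (intro continuous_intros P(1)) auto
  then obtain r0 where r0: "r0 \<in> {0..R}" "\<And>x. x \<in> {0..R} \<Longrightarrow> C r0 \<le> C x"
    using continuous_attains_inf[OF compact_Icc, of 0 R C] R by (metis atLeastAtMost_iff empty_iff less_imp_le order_refl)
  define c where "c = C r0"
  have "r\<^sup>2 + c1 > 0" using c1p by (simp add: add_nonneg_pos)
  then have "C r < c1" using neg qp[OF r] by (simp add: C_def field_simps not_le)
  then have c: "c < c1" using r0(2)[OF r] by (simp add: c_def)
  \<comment> \<open>The bound \<open>h \<le> 1\<close> is used here: it keeps \<open>r^2 q\<close>
    below \<open>1 + \<beta>\<close>.\<close>
  have cpos: "c > 0"
  proof -
    have "r0\<^sup>2 * q r0 < 1 + \<beta>" using b[OF r0(1)] P(2)[OF r0(1)] \<beta> by simp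
    then show ?thesis using qp[OF r0(1)] by (simp add: c_def C_def field_simps)
  qed
  have "q R = 1 / R\<^sup>2" using P(2)[of R] P(3) R by (simp add: field_simps)
  \<comment> \<open>The gain from \<open>\<beta>\<close>: the touching parameter at \<open>R\<close>
    would be 0 without it, and now exceeds \<open>c1\<close>.\<close>
  then have "C R = \<beta> * R\<^sup>2" by (simp add: C_def algebra_simps)
  then have "r0 \<noteq> R" using c c1(2) by (auto simp: c_def)
  have cp: "x\<^sup>2 + c > 0" for x using cpos by (simp add: add_nonneg_pos)
  show False
  proof (rule no_touching[OF R pr, of c \<beta> r0 1])
    show "q r0 = (1 + \<beta>) / (r0\<^sup>2 + c)" using qp[OF r0(1)] \<beta> by (simp add: c_def C_def)
    show "1 * (q x - (1 + \<beta>) / (x\<^sup>2 + c)) \<le> 0" if x: "x \<in> {0..R}" for x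
    proof -
      have "x\<^sup>2 + c \<le> (1 + \<beta>) / q x" using r0(2)[OF x] by (simp add: C_def c_def)
      then have "q x \<le> (1 + \<beta>) / (x\<^sup>2 + c)" using qp[OF x] cp[of x] by (simp add: field_simps)
      then show ?thesis by simp
    qed
    show "1 * residual (1 + 3 * (h_plus t / t)) \<beta> c (x\<^sup>2) > 0" for x
    proof -
      have "residual (1 + 3 * (h_plus t / t)) \<beta> c (x\<^sup>2) > 0"
        by (rule residual_pos) (use k \<beta> cpos c in \<open>auto simp: c1(1)\<close>)
      then show ?thesis by simp
    qed
  qed (use cpos \<beta> r0 \<open>r0 \<noteq> R\<close> in auto)
qed

subsection \<open>Power series at the origin\<close>

text \<open>In the variable \<open>s = r\<^sup>2\<close> the profile satisfies
  \<open>4 s y'' + 14 y' = - y - 3 k s y\<^sup>2 + (1 + 3 k) s\<^sup>2 y\<^sup>3\<close>, which determines its Taylor coefficients.\<close>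

context
  notes sum.cong [fundef_cong]
begin

fun profile_coeff :: "real \<Rightarrow> real \<Rightarrow> nat \<Rightarrow> real" where
  "profile_coeff k a 0 = a"
| "profile_coeff k a (Suc n) =
    (- profile_coeff k a n
     - 3 * k * (if n = 0 then 0
         else \<Sum>i = 0..n - 1. profile_coeff k a i * profile_coeff k a (n - 1 - i))
     + (1 + 3 * k) * (if n < 2 then 0
         else \<Sum>i = 0..n - 2. profile_coeff k a i *
            (\<Sum>j = 0..n - 2 - i. profile_coeff k a j * profile_coeff k a (n - 2 - i - j))))
    / (real (Suc n) * (4 * real n + 14))"

end

declare profile_coeff.simps(2) [simp del]

lemma convolution_bound:
  fixes u v :: "nat \<Rightarrow> real"
  assumes "\<And>i. i \<le> N \<Longrightarrow> \<bar>u i\<bar> \<le> A * M ^ i" "\<And>i. i \<le> N \<Longrightarrow> \<bar>v i\<bar> \<le> A' * M ^ i" "M > 0"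
  shows "\<bar>\<Sum>i = 0..N. u i * v (N - i)\<bar> \<le> real (Suc N) * (A * A' * M ^ N)"
proof -
  have "\<bar>u i * v (N - i)\<bar> \<le> A * A' * M ^ N" if "i \<le> N" for i
  proof -
    have "\<bar>u i\<bar> * \<bar>v (N - i)\<bar> \<le> (A * M ^ i) * (A' * M ^ (N - i))"
      using assms that order_trans[OF abs_ge_zero assms(1)[OF that]] by (intro mult_mono) auto
    also have "\<dots> = A * A' * (M ^ i * M ^ (N - i))" by simp
    also have "M ^ i * M ^ (N - i) = M ^ N" using that by (simp flip: power_add)
    finally show ?thesis by (simp add: abs_mult)
  qed
  then have "(\<Sum>i = 0..N. \<bar>u i * v (N - i)\<bar>) \<le> (\<Sum>i = 0..N. A * A' * M ^ N)"
    by (intro sum_mono) auto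
  then show ?thesis by (intro order_trans[OF sum_abs]) simp
qed

text \<open>A geometric majorant. The double convolution contributes at most about
  \<open>l^2\<close> terms, and the denominator of the recursion grows quadratically and absorbs
  them.\<close>

lemma profile_coeff_bound:
  fixes k a :: real
  assumes k: "k > 0"
  obtains A M where "A > 0" "M \<ge> 1" "\<And>n. \<bar>profile_coeff k a n\<bar> \<le> A * M ^ n"
proof -
  define A where "A = max 1 \<bar>a\<bar>"
  \<comment> \<open>Makes \<open>A * M\<close> equal to \<open>A + 3 k A^2 + (1 + 3 k) A^3\<close>,
    the sum of the three bounds of the induction step.\<close>
  define M where "M = 1 + 3 * k * A + (1 + 3 * k) * A\<^sup>2"
  have A: "A \<ge> 1" by (simp add: A_def)
  have M: "M \<ge> 1" using k A by (simp add: M_def)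
  let ?b = "profile_coeff k a"
  have "\<bar>?b n\<bar> \<le> A * M ^ n" for n
  proof (induction n rule: less_induct)
    case (less n)
    show ?case
    proof (cases n)
      case 0 then show ?thesis by (simp add: A_def)
    next
      case (Suc l)
      have IH: "\<bar>?b i\<bar> \<le> A * M ^ i" if "i \<le> l" for i using less[of i] that Suc by simp
      define W where "W = real (Suc l) * (4 * real l + 14)"
      have W1: "W \<ge> 1" "W \<ge> real l" "W \<ge> real l * real l"
        by (simp_all add: W_def algebra_simps)
      then have W: "W \<ge> 1" "W \<ge> real l" "W \<ge> real l * real l" "W > 0" by linarith+
      define S2 where "S2 = (if l = 0 then 0 else \<Sum>i = 0..l - 1. ?b i * ?b (l - 1 - i))"
      define S3 where "S3 = (if l < 2 then 0 else \<Sum>i = 0..l - 2. ?b i *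
            (\<Sum>j = 0..l - 2 - i. ?b j * ?b (l - 2 - i - j)))"
      have pw: "M ^ i \<le> M ^ l" if "i \<le> l" for i using M that by (intro power_increasing)
      have b1: "\<bar>?b l\<bar> \<le> W * (A * M ^ l)"
      proof -
        have "\<bar>?b l\<bar> \<le> 1 * (A * M ^ l)" using IH[of l] by simp
        also have "\<dots> \<le> W * (A * M ^ l)" using W A M by (intro mult_right_mono) auto
        finally show ?thesis .
      qed
      have b2: "\<bar>S2\<bar> \<le> W * (A\<^sup>2 * M ^ l)"
      proof (cases "l = 0")
        case True then show ?thesis using W A M by (simp add: S2_def)
      next
        case False
        have "\<bar>\<Sum>i = 0..l - 1. ?b i * ?b (l - 1 - i)\<bar> \<le> real (Suc (l - 1)) * (A * A * M ^ (l - 1))"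
          by (rule convolution_bound) (use IH M in auto)
        also have "\<dots> \<le> W * (A * A * M ^ l)"
          using W A M pw[of "l - 1"] False by (intro mult_mono) auto
        finally show ?thesis using False by (simp add: S2_def power2_eq_square)
      qed
      have b3: "\<bar>S3\<bar> \<le> W * (A ^ 3 * M ^ l)"
      proof (cases "l < 2")
        case True then show ?thesis using W A M by (simp add: S3_def)
      next
        case False
        define N where "N = l - 2"
        have N: "real (Suc N) \<le> real l" using False by (simp add: N_def)
        have in2: "\<bar>\<Sum>j = 0..i. ?b j * ?b (i - j)\<bar> \<le> real (Suc N) * A\<^sup>2 * M ^ i" if "i \<le> N" for i
        proof -
          have "\<bar>\<Sum>j = 0..i. ?b j * ?b (i - j)\<bar> \<le> real (Suc i) * (A * A * M ^ i)"
            by (rule convolution_bound) (use IH M that N_def in auto)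
          also have "\<dots> \<le> real (Suc N) * (A * A * M ^ i)" using that A M by (intro mult_right_mono) auto
          finally show ?thesis by (simp add: power2_eq_square mult_ac)
        qed
        have "\<bar>\<Sum>i = 0..N. ?b i * (\<Sum>j = 0..N - i. ?b j * ?b (N - i - j))\<bar>
            \<le> real (Suc N) * (A * (real (Suc N) * A\<^sup>2) * M ^ N)"
          by (rule convolution_bound[where v = "\<lambda>i. \<Sum>j = 0..i. ?b j * ?b (i - j)"])
            (use IH M in2 N_def in auto)
        also have "\<dots> = (real (Suc N) * real (Suc N)) * (A ^ 3 * M ^ N)"
          by (simp add: power2_eq_square power3_eq_cube mult_ac)
        also have "\<dots> \<le> W * (A ^ 3 * M ^ l)"
        proof (intro mult_mono)
          have "real (Suc N) * real (Suc N) \<le> real l * real l" using N by (intro mult_mono) auto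
          then show "real (Suc N) * real (Suc N) \<le> W" using W by linarith
        qed (use W A M pw[of N] N_def in auto)
        finally show ?thesis using False by (simp add: S3_def N_def)
      qed
      have "\<bar>- ?b l - 3 * k * S2 + (1 + 3 * k) * S3\<bar> \<le> \<bar>?b l\<bar> + 3 * k * \<bar>S2\<bar> + (1 + 3 * k) * \<bar>S3\<bar>"
        using abs_triangle_ineq[of "- ?b l - 3 * k * S2" "(1 + 3 * k) * S3"]
          abs_triangle_ineq4[of "- ?b l" "3 * k * S2"] k by (simp add: abs_mult)
      also have "\<dots> \<le> W * (A * M ^ l) + 3 * k * (W * (A\<^sup>2 * M ^ l)) + (1 + 3 * k) * (W * (A ^ 3 * M ^ l))"
        using b1 b2 b3 k by (intro add_mono mult_left_mono) auto
      also have "\<dots> = W * (A * M ^ Suc l)"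
        unfolding power_Suc M_def by (simp add: algebra_simps power2_eq_square power3_eq_cube)
      finally have "\<bar>- ?b l - 3 * k * S2 + (1 + 3 * k) * S3\<bar> / W \<le> A * M ^ Suc l"
        using W by (simp add: pos_divide_le_eq mult.commute)
      moreover have "?b n = (- ?b l - 3 * k * S2 + (1 + 3 * k) * S3) / W"
        unfolding Suc profile_coeff.simps(2) S2_def S3_def W_def ..
      ultimately show ?thesis using W Suc by (simp add: abs_divide)
    qed
  qed
  then show ?thesis using that A M by (metis less_le_trans zero_less_one)
qed

text \<open>The equation is checked coefficientwise as an identity of formal power series and then
  evaluated inside the disc of convergence. Halving the radius \<open>1 / M\<close> gives a
  geometric majorant of ratio 1/2.\<close>

lemma profile_series:
  fixes k a :: real
  assumes k: "k > 0"
  obtains B \<rho> where "\<rho> > 0" "ereal \<rho> \<le> fps_conv_radius B" "fps_nth B 0 = a" "fps_nth B 1 = - a / 14"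
    "\<And>s. \<bar>s\<bar> < \<rho> \<Longrightarrow> 4 * s * eval_fps (fps_deriv (fps_deriv B)) s + 14 * eval_fps (fps_deriv B) s
      = - eval_fps B s - 3 * k * s * (eval_fps B s)\<^sup>2 + (1 + 3 * k) * s\<^sup>2 * (eval_fps B s) ^ 3"
proof -
  obtain A M where AM: "A > 0" "M \<ge> 1" "\<And>n. \<bar>profile_coeff k a n\<bar> \<le> A * M ^ n"
    using profile_coeff_bound[OF k] by blast
  define B where "B = Abs_fps (profile_coeff k a)"
  define \<rho> where "\<rho> = 1 / (2 * M)"
  have \<rho>: "\<rho> > 0" using AM by (simp add: \<rho>_def)
  have rad: "ereal \<rho> \<le> fps_conv_radius B"
  proof -
    have "summable (\<lambda>n. profile_coeff k a n * \<rho> ^ n)"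
    proof (rule summable_comparison_test')
      show "summable (\<lambda>n. A * (1 / 2 :: real) ^ n)" by (intro summable_mult summable_geometric) simp
      fix n
      have "\<bar>profile_coeff k a n\<bar> * \<rho> ^ n \<le> A * M ^ n * \<rho> ^ n"
        using AM(3) \<rho> by (intro mult_right_mono) auto
      also have "\<dots> = A * (M * \<rho>) ^ n" by (simp add: power_mult_distrib)
      also have "M * \<rho> = 1 / 2" using AM by (simp add: \<rho>_def)
      finally show "norm (profile_coeff k a n * \<rho> ^ n) \<le> A * (1 / 2) ^ n"
        using \<rho> by (simp add: abs_mult)
    qed
    from conv_radius_geI[OF this] show ?thesis
      using \<rho> by (simp add: fps_conv_radius_def B_def fps_nth_Abs_fps[abs_def])
  qed
  have ode: "fps_const 4 * (fps_X * fps_deriv (fps_deriv B)) + fps_const 14 * fps_deriv B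
     = - B - fps_const (3 * k) * (fps_X * (B * B)) + fps_const (1 + 3 * k) * (fps_X * (fps_X * (B * (B * B))))"
    (is "?l = ?r")
  proof (rule fps_ext)
    fix n
    have "fps_nth ?l n = real (Suc n) * (4 * real n + 14) * profile_coeff k a (Suc n)"
      by (cases n) (simp_all add: B_def algebra_simps)
    also have "\<dots> = - profile_coeff k a n
       - 3 * k * (if n = 0 then 0
           else \<Sum>i = 0..n - 1. profile_coeff k a i * profile_coeff k a (n - 1 - i))
       + (1 + 3 * k) * (if n < 2 then 0
           else \<Sum>i = 0..n - 2. profile_coeff k a i *
            (\<Sum>j = 0..n - 2 - i. profile_coeff k a j * profile_coeff k a (n - 2 - i - j)))"
    proof -
      have c: "c * (x / c) = x" if "c \<noteq> 0" for c x :: real using that by simp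
      show ?thesis unfolding profile_coeff.simps(2) by (rule c) simp
    qed
    also have "\<dots> = fps_nth ?r n"
    proof -
      have B: "fps_nth B j = profile_coeff k a j" for j by (simp add: B_def)
      have BB: "fps_nth (B * B) j = (\<Sum>i = 0..j. profile_coeff k a i * profile_coeff k a (j - i))" for j
        by (simp add: fps_mult_nth B_def)
      have BBB: "fps_nth (B * (B * B)) l = (\<Sum>i = 0..l. profile_coeff k a i *
            (\<Sum>j = 0..l - i. profile_coeff k a j * profile_coeff k a (l - i - j)))" for l
        by (subst fps_mult_nth) (simp add: BB B)
      show ?thesis
        by (simp add: BB BBB B numeral_2_eq_2 less_Suc_eq_0_disj)
    qed
    finally show "fps_nth ?l n = fps_nth ?r n" .
  qed
  have eval: "4 * s * eval_fps (fps_deriv (fps_deriv B)) s + 14 * eval_fps (fps_deriv B) s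
      = - eval_fps B s - 3 * k * s * (eval_fps B s)\<^sup>2 + (1 + 3 * k) * s\<^sup>2 * (eval_fps B s) ^ 3"
    if s: "\<bar>s\<bar> < \<rho>" for s
  proof -
    have r0: "ereal (\<bar>s\<bar>) < fps_conv_radius B" using s rad by (auto intro: less_le_trans[of _ "ereal \<rho>"])
    then have r1: "ereal (\<bar>s\<bar>) < fps_conv_radius (fps_deriv B)"
      using fps_conv_radius_deriv[of B] by (rule less_le_trans)
    then have r2: "ereal (\<bar>s\<bar>) < fps_conv_radius (fps_deriv (fps_deriv B))"
      using fps_conv_radius_deriv[of "fps_deriv B"] by (rule less_le_trans)
    have mult: "ereal (\<bar>s\<bar>) < fps_conv_radius (f * g)"
      if "ereal (\<bar>s\<bar>) < fps_conv_radius f" "ereal (\<bar>s\<bar>) < fps_conv_radius g" for f g :: "real fps"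
      using that fps_conv_radius_mult[of f g] by (auto simp: min_le_iff_disj intro: less_le_trans)
    have sub: "ereal (\<bar>s\<bar>) < fps_conv_radius (f - g)" "ereal (\<bar>s\<bar>) < fps_conv_radius (f + g)"
      if "ereal (\<bar>s\<bar>) < fps_conv_radius f" "ereal (\<bar>s\<bar>) < fps_conv_radius g" for f g :: "real fps"
      using that fps_conv_radius_diff[of f g] fps_conv_radius_add[of f g]
      by (auto simp: min_le_iff_disj intro: less_le_trans)
    note rs = r0 r1 r2 mult sub
    have "eval_fps (fps_const 4 * (fps_X * fps_deriv (fps_deriv B)) + fps_const 14 * fps_deriv B) s
      = 4 * (s * eval_fps (fps_deriv (fps_deriv B)) s) + 14 * eval_fps (fps_deriv B) s"
      by (simp add: eval_fps_add eval_fps_mult rs)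
    moreover have "eval_fps (- B - fps_const (3 * k) * (fps_X * (B * B))
        + fps_const (1 + 3 * k) * (fps_X * (fps_X * (B * (B * B))))) s
      = - eval_fps B s - 3 * k * (s * (eval_fps B s * eval_fps B s))
        + (1 + 3 * k) * (s * (s * (eval_fps B s * (eval_fps B s * eval_fps B s))))"
      by (simp add: eval_fps_add eval_fps_diff eval_fps_mult eval_fps_minus rs)
    ultimately show ?thesis unfolding ode by (simp add: power2_eq_square power3_eq_cube mult_ac)
  qed
  have b1: "fps_nth B 1 = - a / 14" by (simp add: B_def profile_coeff.simps(2))
  show ?thesis by (rule that[OF \<rho> rad _ b1 eval]) (simp_all add: B_def)
qed

text \<open>The equation is singular at 0, so the standard uniqueness theorem does not apply. With
  both fluxes vanishing at 0, the difference of derivatives is at most \<open>L M r\<close>, where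
  \<open>M\<close> is the maximal difference; integrating gives
  \<open>M \<le> L \<delta>^2 M\<close>. The value at 0 is the only free datum.\<close>

lemma profile_unique:
  assumes \<delta>: "\<delta> > 0"
    and q: "continuous_on {0..\<delta>} u" "continuous_on {0..\<delta>} v" "u 0 = (v 0 :: real)"
    and d: "\<And>r. r \<in> {0<..<\<delta>} \<Longrightarrow> (u has_real_derivative u' r) (at r)"
      "\<And>r. r \<in> {0<..<\<delta>} \<Longrightarrow> (v has_real_derivative v' r) (at r)"
    and e: "\<And>r. r \<in> {0<..<\<delta>} \<Longrightarrow> ((\<lambda>r. r ^ 6 * u' r) has_real_derivative r ^ 6 * G r (u r)) (at r)"
      "\<And>r. r \<in> {0<..<\<delta>} \<Longrightarrow> ((\<lambda>r. r ^ 6 * v' r) has_real_derivative r ^ 6 * G r (v r)) (at r)"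
    and lim: "((\<lambda>r. r ^ 6 * u' r) \<longlongrightarrow> 0) (at_right 0)" "((\<lambda>r. r ^ 6 * v' r) \<longlongrightarrow> 0) (at_right 0)"
    and lip: "\<And>r. r \<in> {0..\<delta>} \<Longrightarrow> \<bar>G r (u r) - G r (v r)\<bar> \<le> L * \<bar>u r - v r\<bar>"
    and small: "L * \<delta>\<^sup>2 < 1" and L: "L \<ge> 0" and r: "r \<in> {0..\<delta>}"
  shows "u r = v r"
proof -
  define d where "d r = u r - v r" for r
  have dc: "continuous_on {0..\<delta>} d" unfolding d_def [abs_def] by (intro continuous_intros q)
  then obtain x where x: "x \<in> {0..\<delta>}" "\<And>y. y \<in> {0..\<delta>} \<Longrightarrow> \<bar>d y\<bar> \<le> \<bar>d x\<bar>"
    using continuous_attains_sup[OF compact_Icc, of 0 \<delta> "\<lambda>r. \<bar>d r\<bar>"] \<delta>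
    by (metis atLeastAtMost_iff continuous_on_rabs empty_iff less_imp_le order_refl)
  define M where "M = \<bar>d x\<bar>"
  have pb: "\<bar>u' r - v' r\<bar> \<le> L * M * \<delta>" if r: "r \<in> {0<..<\<delta>}" for r
  proof -
    have "\<bar>r ^ 6 * u' r - r ^ 6 * v' r\<bar> \<le> (r ^ 6 * (L * M)) * r"
    proof (rule abs_le_of_deriv_bound)
      fix y assume y: "y \<in> {0<..r}"
      show "((\<lambda>r. r ^ 6 * u' r - r ^ 6 * v' r) has_real_derivative y ^ 6 * G y (u y) - y ^ 6 * G y (v y)) (at y)"
        using e y r by (intro DERIV_diff) auto
      have "\<bar>G y (u y) - G y (v y)\<bar> \<le> L * M"
        using lip[of y] x(2)[of y] y r L unfolding M_def d_def
        by (meson atLeastAtMost_iff greaterThanAtMost_iff greaterThanLessThan_iff less_imp_le mult_left_mono order_trans)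
      moreover have "y ^ 6 \<le> r ^ 6" using y by (intro power_mono) auto
      ultimately have "y ^ 6 * \<bar>G y (u y) - G y (v y)\<bar> \<le> r ^ 6 * (L * M)"
        using y by (intro mult_mono) auto
      then show "\<bar>y ^ 6 * G y (u y) - y ^ 6 * G y (v y)\<bar> \<le> r ^ 6 * (L * M)"
        using y by (simp add: abs_mult flip: right_diff_distrib)
    next
      show "((\<lambda>r. r ^ 6 * u' r - r ^ 6 * v' r) \<longlongrightarrow> 0) (at_right 0)"
        using tendsto_diff[OF lim] by simp
    qed (use r in auto)
    moreover have "\<bar>r ^ 6 * u' r - r ^ 6 * v' r\<bar> = r ^ 6 * \<bar>u' r - v' r\<bar>"
      using r by (simp add: abs_mult flip: right_diff_distrib)
    ultimately have "r ^ 6 * \<bar>u' r - v' r\<bar> \<le> r ^ 6 * (L * M * r)" by (simp add: mult.assoc)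
    then have "\<bar>u' r - v' r\<bar> \<le> L * M * r" by (rule mult_left_le_imp_le) (use r in simp)
    also have "\<dots> \<le> L * M * \<delta>" using r L by (intro mult_left_mono) (auto simp: M_def)
    finally show ?thesis .
  qed
  have "\<bar>d x\<bar> \<le> L * M * \<delta> * \<delta>"
  proof (cases "x = 0")
    case True
    then show ?thesis using q(3) L \<delta> by (simp add: d_def M_def)
  next
    case False
    have "\<exists>l z. 0 < z \<and> z < x \<and> (d has_real_derivative l) (at z) \<and> d x - d 0 = (x - 0) * l"
    proof (rule MVT)
      show "continuous_on {0..x} d" using x by (intro continuous_on_subset[OF dc]) auto
      show "d differentiable at z" if "0 < z" "z < x" for z
        unfolding d_def [abs_def] real_differentiable_def using d that x
        by (intro exI[of _ "u' z - v' z"] DERIV_diff) auto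
    qed (use False x in auto)
    then obtain l z where z: "0 < z" "z < x" "(d has_real_derivative l) (at z)" "d x - d 0 = (x - 0) * l"
      by blast
    have "(d has_real_derivative u' z - v' z) (at z)"
      unfolding d_def [abs_def] using d z x by (intro DERIV_diff) auto
    then have "l = u' z - v' z" using z DERIV_unique by blast
    then have "\<bar>d x\<bar> = \<bar>u' z - v' z\<bar> * x" using z x q(3) by (simp add: d_def abs_mult)
    also have "\<dots> \<le> L * M * \<delta> * \<delta>" using pb[of z] z x \<delta> by (intro mult_mono) auto
    finally show ?thesis .
  qed
  then have "M \<le> (L * \<delta>\<^sup>2) * M" by (simp add: M_def power2_eq_square mult_ac)
  then have "M * (1 - L * \<delta>\<^sup>2) \<le> 0" by (simp add: algebra_simps)
  then have "M \<le> 0" using small by (simp add: mult_le_0_iff)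
  then have "\<bar>d r\<bar> \<le> 0" using x(2)[OF r] by (simp add: M_def)
  then show ?thesis by (simp add: d_def)
qed

lemma profile_expansion:
  assumes t: "t > 1" and R: "R > 0" and pr: "profile t R h q p"
  obtains B \<delta> where "0 < \<delta>" "\<delta> < R" "ereal (\<delta>\<^sup>2) < fps_conv_radius B" "fps_nth B 0 = q 0" "fps_nth B 1 = - q 0 / 14"
    "\<And>r. r \<in> {0..\<delta>} \<Longrightarrow> q r = eval_fps B (r\<^sup>2)"
proof -
  note P = profileD[OF pr]
  define k where "k = h_plus t / t"
  have k: "k > 0" unfolding k_def by (rule h_plus_pos[OF t])
  obtain B \<rho> where B: "\<rho> > 0" "ereal \<rho> \<le> fps_conv_radius B" "fps_nth B 0 = q 0" "fps_nth B 1 = - q 0 / 14"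
    "\<And>s. \<bar>s\<bar> < \<rho> \<Longrightarrow> 4 * s * eval_fps (fps_deriv (fps_deriv B)) s + 14 * eval_fps (fps_deriv B) s
      = - eval_fps B s - 3 * k * s * (eval_fps B s)\<^sup>2 + (1 + 3 * k) * s\<^sup>2 * (eval_fps B s) ^ 3"
    using profile_series[OF k, of "q 0"] by metis
  \<comment> \<open>The bounds 1 and \<open>\<rho> / 2\<close> ensure
    \<open>r^2 \<le> \<delta>0 < \<rho>\<close> and \<open>r^2 \<le> 1\<close>.\<close>
  define \<delta>0 where "\<delta>0 = min (R / 2) (min 1 (\<rho> / 2))"
  have \<delta>0: "0 < \<delta>0" "\<delta>0 < R" "\<delta>0 \<le> 1" "\<delta>0 < \<rho>" using R B(1) by (auto simp: \<delta>0_def min_def)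
  have sq: "r\<^sup>2 < \<rho>" "r\<^sup>2 \<le> 1" if "r \<in> {0..\<delta>0}" for r
  proof -
    have "r\<^sup>2 \<le> \<delta>0 * 1" unfolding power2_eq_square using that \<delta>0 by (intro mult_mono) auto
    then show "r\<^sup>2 < \<rho>" "r\<^sup>2 \<le> 1" using \<delta>0 by auto
  qed
  have rad: "ereal \<bar>r\<^sup>2\<bar> < fps_conv_radius B" if "r \<in> {0..\<delta>0}" for r
    using sq(1)[OF that] B(2) by (auto intro: less_le_trans[of _ "ereal \<rho>"])
  define y where "y = eval_fps B"
  define y' where "y' = eval_fps (fps_deriv B)"
  define y'' where "y'' = eval_fps (fps_deriv (fps_deriv B))"
  have yd: "(y has_real_derivative y' (r\<^sup>2)) (at (r\<^sup>2))" "(y' has_real_derivative y'' (r\<^sup>2)) (at (r\<^sup>2))"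
    if "r \<in> {0..\<delta>0}" for r
    unfolding y_def y'_def y''_def using rad[OF that] fps_conv_radius_deriv[of B]
    by (auto intro!: has_field_derivative_eval_fps intro: less_le_trans)
  define p2 where "p2 r = 2 * r * y' (r\<^sup>2)" for r
  have sqd: "((\<lambda>r. r\<^sup>2) has_real_derivative 2 * r) (at r)" for r :: real
    by (auto intro!: derivative_eq_intros)
  have q2d: "((\<lambda>r. y (r\<^sup>2)) has_real_derivative p2 r) (at r)" if "r \<in> {0..\<delta>0}" for r
    using DERIV_chain2[OF yd(1)[OF that] sqd] by (simp add: p2_def mult_ac)
  have q2c: "continuous_on {0..\<delta>0} (\<lambda>r. y (r\<^sup>2))"
    by (intro continuous_at_imp_continuous_on ballI DERIV_isCont[OF q2d])
  obtain C1 where C1: "C1 \<ge> 0" "\<And>x. x \<in> {0..R} \<Longrightarrow> \<bar>q x\<bar> \<le> C1" using bounded_icc[OF P(1)] by metis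
  obtain C2 where C2: "C2 \<ge> 0" "\<And>x. x \<in> {0..\<delta>0} \<Longrightarrow> \<bar>y (x\<^sup>2)\<bar> \<le> C2" using bounded_icc[OF q2c] by metis
  define C where "C = C1 + C2"
  have C: "C \<ge> 0" "\<And>x. x \<in> {0..\<delta>0} \<Longrightarrow> \<bar>q x\<bar> \<le> C" "\<And>x. x \<in> {0..\<delta>0} \<Longrightarrow> \<bar>y (x\<^sup>2)\<bar> \<le> C"
  proof -
    show "C \<ge> 0" using C1(1) C2(1) by (simp add: C_def)
    show "\<bar>q x\<bar> \<le> C" if "x \<in> {0..\<delta>0}" for x using C1(2)[of x] C2(1) \<delta>0 that by (simp add: C_def)
    show "\<bar>y (x\<^sup>2)\<bar> \<le> C" if "x \<in> {0..\<delta>0}" for x using C2(2)[OF that] C1(1) by (simp add: C_def)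
  qed
  \<comment> \<open>A Lipschitz constant of \<open>G r\<close> on \<open>[-C,C]\<close> for
    \<open>r \<le> 1\<close>; its summands bound the cubic, quadratic and linear parts.\<close>
  define L where "L = (1 + 3 * k) * (3 * C\<^sup>2) + 3 * k * (2 * C) + 1"
  have L: "L \<ge> 1" using k C(1) by (simp add: L_def)
  \<comment> \<open>Together with \<open>\<delta> \<le> 1\<close> this gives
    \<open>L \<delta>^2 \<le> 1/2\<close>, the contraction needed for uniqueness.\<close>
  define \<delta> where "\<delta> = min \<delta>0 (1 / (2 * L))"
  have \<delta>: "0 < \<delta>" "\<delta> \<le> \<delta>0" "\<delta> \<le> 1 / (2 * L)" using \<delta>0 L by (auto simp: \<delta>_def)
  define G where "G r x = x * (r\<^sup>2 * x - 1) * ((1 + 3 * k) * (r\<^sup>2 * x) + 1)" for r x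
  have eq: "q r = y (r\<^sup>2)" if r: "r \<in> {0..\<delta>}" for r
  proof (rule profile_unique[where u = q and v = "\<lambda>r. y (r\<^sup>2)" and \<delta> = \<delta> and L = L and G = G and u' = p and v' = p2])
    show "continuous_on {0..\<delta>} q" using \<delta> \<delta>0 by (intro continuous_on_subset[OF P(1)]) auto
    show "continuous_on {0..\<delta>} (\<lambda>r. y (r\<^sup>2))" using \<delta> by (intro continuous_on_subset[OF q2c]) auto
    show "q 0 = y (0\<^sup>2)" using B(3) by (simp add: y_def eval_fps_at_0)
    show "(q has_real_derivative p r) (at r)" if "r \<in> {0<..<\<delta>}" for r using P(4)[of r] that \<delta> \<delta>0 by auto
    show "((\<lambda>r. y (r\<^sup>2)) has_real_derivative p2 r) (at r)" if "r \<in> {0<..<\<delta>}" for r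
      using q2d[of r] that \<delta> by auto
    show "((\<lambda>r. r ^ 6 * p r) has_real_derivative r ^ 6 * G r (q r)) (at r)" if r: "r \<in> {0<..<\<delta>}" for r
    proof -
      have "r ^ 4 * force t (h r) = r ^ 6 * G r (q r)"
        using P(2)[of r] r \<delta> \<delta>0 by (simp add: force_def G_def k_def eval_nat_numeral mult_ac)
      then show ?thesis using P(5)[of r] r \<delta> \<delta>0 by auto
    qed
    show "((\<lambda>r. r ^ 6 * p2 r) has_real_derivative r ^ 6 * G r (y (r\<^sup>2))) (at r)" if r: "r \<in> {0<..<\<delta>}" for r
    proof -
      have r': "r \<in> {0..\<delta>0}" using r \<delta> by auto
      have "((\<lambda>r. 2 * r ^ 7 * y' (r\<^sup>2)) has_real_derivative 2 * (7 * r ^ 6) * y' (r\<^sup>2) + (y'' (r\<^sup>2) * (2 * r)) * (2 * r ^ 7)) (at r)"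
        by (intro DERIV_mult DERIV_chain2[OF yd(2)[OF r'] sqd]) (auto intro!: derivative_eq_intros)
      moreover have "(\<lambda>r. 2 * r ^ 7 * y' (r\<^sup>2)) = (\<lambda>r. r ^ 6 * p2 r)"
        by (simp add: p2_def fun_eq_iff eval_nat_numeral)
      moreover have "2 * (7 * r ^ 6) * y' (r\<^sup>2) + (y'' (r\<^sup>2) * (2 * r)) * (2 * r ^ 7)
         = r ^ 6 * (4 * r\<^sup>2 * y'' (r\<^sup>2) + 14 * y' (r\<^sup>2))" by algebra
      moreover have "4 * r\<^sup>2 * y'' (r\<^sup>2) + 14 * y' (r\<^sup>2) = G r (y (r\<^sup>2))"
      proof -
        have "4 * r\<^sup>2 * y'' (r\<^sup>2) + 14 * y' (r\<^sup>2) = - y (r\<^sup>2) - 3 * k * r\<^sup>2 * (y (r\<^sup>2))\<^sup>2 + (1 + 3 * k) * (r\<^sup>2)\<^sup>2 * (y (r\<^sup>2)) ^ 3"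
          using B(5)[of "r\<^sup>2"] sq(1)[OF r'] unfolding y_def y'_def y''_def by simp
        also have "\<dots> = G r (y (r\<^sup>2))" unfolding G_def by algebra
        finally show ?thesis .
      qed
      ultimately show ?thesis by simp
    qed
    show "((\<lambda>r. r ^ 6 * p r) \<longlongrightarrow> 0) (at_right 0)" by (rule P(6))
    show "((\<lambda>r. r ^ 6 * p2 r) \<longlongrightarrow> 0) (at_right 0)"
    proof -
      have "isCont y' (0\<^sup>2)" using yd(2)[of 0] \<delta>0 by (auto intro: DERIV_isCont)
      then have "((\<lambda>r. y' (r\<^sup>2)) \<longlongrightarrow> y' (0\<^sup>2)) (at_right 0)"
        by (intro isCont_tendsto_compose[of "0\<^sup>2" y'] tendsto_intros)
      then have "((\<lambda>r. r ^ 6 * (2 * r * y' (r\<^sup>2))) \<longlongrightarrow> 0 ^ 6 * (2 * 0 * y' (0\<^sup>2))) (at_right 0)"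
        by (intro tendsto_intros)
      then show ?thesis by (simp add: p2_def)
    qed
    show "\<bar>G r (q r) - G r (y (r\<^sup>2))\<bar> \<le> L * \<bar>q r - y (r\<^sup>2)\<bar>" if r: "r \<in> {0..\<delta>}" for r
    proof -
      have r': "r \<in> {0..\<delta>0}" using r \<delta> by auto
      define x where "x = q r"
      define z where "z = y (r\<^sup>2)"
      have xz: "\<bar>x\<bar> \<le> C" "\<bar>z\<bar> \<le> C" using C(2,3)[OF r'] by (auto simp: x_def z_def)
      define u where "u = (r\<^sup>2)\<^sup>2 * (x\<^sup>2 + x * z + z\<^sup>2)"
      define v where "v = r\<^sup>2 * (x + z)"
      have "\<bar>x\<^sup>2 + x * z + z\<^sup>2\<bar> \<le> 3 * C\<^sup>2"
      proof -
        have "\<bar>x * x\<bar> \<le> C * C" "\<bar>x * z\<bar> \<le> C * C" "\<bar>z * z\<bar> \<le> C * C"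
          unfolding abs_mult using xz C(1) by (intro mult_mono; simp)+
        then show ?thesis unfolding power2_eq_square by linarith
      qed
      then have u: "\<bar>u\<bar> \<le> 1 * (3 * C\<^sup>2)" unfolding u_def abs_mult
        using power_le_one[OF zero_le_power2 sq(2)[OF r'], of 2] by (intro mult_mono) simp_all
      have "\<bar>x + z\<bar> \<le> 2 * C" using xz by linarith
      then have v: "\<bar>v\<bar> \<le> 1 * (2 * C)" unfolding v_def abs_mult
        using sq(2)[OF r'] by (intro mult_mono) auto
      have "G r x - G r z = ((1 + 3 * k) * u - 3 * k * v - 1) * (x - z)"
        unfolding G_def u_def v_def by algebra
      moreover have "\<bar>(1 + 3 * k) * u - 3 * k * v - 1\<bar> \<le> L"
      proof -
        have "\<bar>(1 + 3 * k) * u\<bar> \<le> (1 + 3 * k) * (3 * C\<^sup>2)" "\<bar>3 * k * v\<bar> \<le> 3 * k * (2 * C)"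
          unfolding abs_mult using u v k by (intro mult_mono; simp)+
        then show ?thesis unfolding L_def by linarith
      qed
      ultimately show ?thesis unfolding x_def[symmetric] z_def[symmetric]
        by (simp add: abs_mult mult_right_mono)
    qed
    show "L * \<delta>\<^sup>2 < 1"
    proof -
      have "L * \<delta>\<^sup>2 \<le> L * (\<delta> * 1)" unfolding power2_eq_square
        using \<delta> \<delta>0 L by (intro mult_left_mono) auto
      also have "\<dots> \<le> L * (1 / (2 * L))" using \<delta> L by (intro mult_left_mono) auto
      also have "\<dots> < 1" using L by simp
      finally show ?thesis .
    qed
  qed (use \<delta> L r in auto)
  show ?thesis
  proof (rule that[of \<delta> B])
    show "ereal (\<delta>\<^sup>2) < fps_conv_radius B" using rad[of \<delta>] \<delta> by auto
  qed (use \<delta> \<delta>0 B eq y_def in auto)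
qed

section \<open>The expansion of \<open>h\<close> and its leading coefficient\<close>

lemma origin_expansion_exists:
  assumes t: "t > 1" and R: "R > 0" and pr: "profile t R h q p" and q0: "q 0 > 0"
  shows "\<exists>a. origin_expansion R h a"
proof -
  note P = profileD[OF pr]
  obtain B \<delta> where B: "0 < \<delta>" "\<delta> < R" "ereal (\<delta>\<^sup>2) < fps_conv_radius B" "fps_nth B 0 = q 0" "fps_nth B 1 = - q 0 / 14"
    "\<And>r. r \<in> {0..\<delta>} \<Longrightarrow> q r = eval_fps B (r\<^sup>2)"
    using profile_expansion[OF t R pr] by metis
  \<comment> \<open>\<open>h\<close> is \<open>r^2\<close> times a series in \<open>r^2\<close>, so
    coefficient \<open>n\<close> of \<open>B\<close> moves to index \<open>2 n + 2\<close>.\<close>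
  define a where "a n = (if even n \<and> n \<ge> 2 then fps_nth B (n div 2 - 1) else 0)" for n
  have a2: "a 2 = q 0" by (simp add: a_def B(4))
  \<comment> \<open>Solved from the required identity. That it is \<open>o(r^2)\<close> is the
    differentiability of the series at 0, with derivative \<open>- q 0 / 14\<close>.\<close>
  define \<rho> where "\<rho> r = h r / (a 2 * r\<^sup>2) - 1 + r\<^sup>2 / 14" for r
  have sums: "(\<lambda>n. a n * r ^ n) sums h r" if r: "r \<in> {0..<\<delta>}" for r
  proof -
    have "r\<^sup>2 \<le> \<delta>\<^sup>2" using r by (intro power_mono) auto
    then have "ereal (norm (r\<^sup>2)) < fps_conv_radius B" using B(3) by (auto intro: le_less_trans[of _ "ereal (\<delta>\<^sup>2)"])
    from sums_eval_fps[OF this] have "(\<lambda>n. fps_nth B n * (r\<^sup>2) ^ n) sums q r" using B(6)[of r] r by simp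
    then have "(\<lambda>n. r\<^sup>2 * (fps_nth B n * (r\<^sup>2) ^ n)) sums (r\<^sup>2 * q r)" by (rule sums_mult)
    moreover have "r\<^sup>2 * q r = h r" using P(2)[of r] r B(2) by simp
    moreover have "r\<^sup>2 * (fps_nth B n * (r\<^sup>2) ^ n) = a (2 * n + 2) * r ^ (2 * n + 2)" for n
    proof -
      have "r ^ (2 * n + 2) = (r\<^sup>2) ^ n * r\<^sup>2" by (simp only: power_add power_mult)
      moreover have "a (2 * n + 2) = fps_nth B n" by (simp add: a_def)
      ultimately show ?thesis by (simp only: mult_ac)
    qed
    ultimately have s: "(\<lambda>n. a (2 * n + 2) * r ^ (2 * n + 2)) sums h r" by simp
    have "a n * r ^ n = 0" if "n \<notin> range (\<lambda>n. 2 * n + 2)" for n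
    proof -
      have "\<not> (even n \<and> n \<ge> 2)"
      proof
        assume "even n \<and> n \<ge> 2"
        then have "n = 2 * (n div 2 - 1) + 2" by presburger
        then show False using that by (metis rangeI)
      qed
      then show ?thesis by (simp only: a_def if_False mult_zero_left)
    qed
    moreover have "strict_mono (\<lambda>n::nat. 2 * n + 2)" by (simp add: strict_mono_def)
    ultimately show ?thesis
      using sums_mono_reindex[of "\<lambda>n. 2 * n + 2" "\<lambda>n. a n * r ^ n" "h r"] s by blast
  qed
  have "\<rho> \<in> o[at_right 0](\<lambda>r. r\<^sup>2)"
  proof (rule smalloI_tendsto)
    have "ereal \<bar>0\<bar> < fps_conv_radius B" using B(1,3) by (auto intro: less_trans[of _ "ereal (\<delta>\<^sup>2)"])
    then have "(eval_fps B has_real_derivative eval_fps (fps_deriv B) 0) (at 0)"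
      by (intro has_field_derivative_eval_fps) simp
    then have "((\<lambda>s. (eval_fps B s - q 0) / s) \<longlongrightarrow> - q 0 / 14) (at 0)"
      by (simp add: has_field_derivative_iff eval_fps_at_0 B(4) B(5)[simplified])
    moreover have "filterlim (\<lambda>r::real. r\<^sup>2) (at 0) (at_right 0)"
    proof (rule filterlim_atI)
      show "((\<lambda>r::real. r\<^sup>2) \<longlongrightarrow> 0) (at_right 0)" by real_asymp
      show "\<forall>\<^sub>F r in at_right 0. r\<^sup>2 \<noteq> (0::real)" by (auto simp: eventually_at_right_field intro!: exI[of _ 1])
    qed
    ultimately have "((\<lambda>r. (eval_fps B (r\<^sup>2) - q 0) / r\<^sup>2) \<longlongrightarrow> - q 0 / 14) (at_right 0)"
      by (rule filterlim_compose)
    note lim = this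
    have "((\<lambda>r. (eval_fps B (r\<^sup>2) - q 0) / r\<^sup>2 / q 0 + 1 / 14) \<longlongrightarrow> - q 0 / 14 / q 0 + 1 / 14) (at_right 0)"
      using q0 by (intro tendsto_add tendsto_divide[OF lim tendsto_const] tendsto_const) auto
    then have "((\<lambda>r. (eval_fps B (r\<^sup>2) - q 0) / r\<^sup>2 / q 0 + 1 / 14) \<longlongrightarrow> 0) (at_right 0)" using q0 by simp
    moreover have "\<forall>\<^sub>F r in at_right 0. (eval_fps B (r\<^sup>2) - q 0) / r\<^sup>2 / q 0 + 1 / 14 = \<rho> r / r\<^sup>2"
    proof -
      have "(eval_fps B (r\<^sup>2) - q 0) / r\<^sup>2 / q 0 + 1 / 14 = \<rho> r / r\<^sup>2" if r: "0 < r" "r < \<delta>" for r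
      proof -
        have "h r = r\<^sup>2 * eval_fps B (r\<^sup>2)" using P(2)[of r] B(6)[of r] r B(2) by simp
        then show ?thesis using r q0 by (simp add: \<rho>_def a2 field_simps)
      qed
      then show ?thesis using B(1) by (auto simp: eventually_at_right_field intro!: exI[of _ \<delta>])
    qed
    ultimately show "((\<lambda>r. \<rho> r / r\<^sup>2) \<longlongrightarrow> 0) (at_right 0)" by (rule Lim_transform_eventually)
    show "\<forall>\<^sub>F r in at_right 0. r\<^sup>2 \<noteq> (0::real)" by (auto simp: eventually_at_right_field intro!: exI[of _ 1])
  qed
  moreover have "h r = a 2 * r\<^sup>2 * (1 - r\<^sup>2 / 14 + \<rho> r)" if "r \<in> {0..<\<delta>}" for r
    using q0 P(2)[of 0] R by (cases "r = 0") (simp_all add: \<rho>_def a2 field_simps)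
  moreover have "\<forall>n. odd n \<longrightarrow> a n = 0" by (simp add: a_def)
  ultimately have "origin_expansion R h a"
    unfolding origin_expansion_def using B(1,2) q0 a2 sums by (intro conjI exI[of _ \<delta>] exI[of _ \<rho>]) auto
  then show ?thesis by blast
qed

text \<open>Any expansion determines \<open>a 2\<close> as the limit of \<open>h / r^2\<close>, so
  bounds on \<open>q 0\<close> hold for every admissible coefficient sequence and not just for the
  one constructed.\<close>

lemma origin_expansion_coeff:
  assumes R: "R > 0" and pr: "profile t R h q p" and e: "origin_expansion R h a"
  shows "a 2 = q 0"
proof -
  note P = profileD[OF pr]
  obtain \<delta> \<rho> where d: "0 < \<delta>" "\<delta> \<le> R" "\<rho> \<in> o[at_right 0](\<lambda>r::real. r\<^sup>2)"
    "\<And>r. r \<in> {0..<\<delta>} \<Longrightarrow> h r = a 2 * r\<^sup>2 * (1 - r\<^sup>2 / 14 + \<rho> r)"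
    using e unfolding origin_expansion_def by blast
  note small = smalloD_tendsto[OF d(3)]
  have "((\<lambda>r. a 2 * (1 - r\<^sup>2 / 14 + (\<rho> r / r\<^sup>2) * r\<^sup>2)) \<longlongrightarrow> a 2 * (1 - 0\<^sup>2 / 14 + 0 * 0\<^sup>2)) (at_right 0)"
    by (intro tendsto_intros small) auto
  then have "((\<lambda>r. a 2 * (1 - r\<^sup>2 / 14 + (\<rho> r / r\<^sup>2) * r\<^sup>2)) \<longlongrightarrow> a 2) (at_right 0)" by simp
  moreover have "\<forall>\<^sub>F r in at_right 0. a 2 * (1 - r\<^sup>2 / 14 + (\<rho> r / r\<^sup>2) * r\<^sup>2) = q r"
  proof -
    have "a 2 * (1 - r\<^sup>2 / 14 + (\<rho> r / r\<^sup>2) * r\<^sup>2) = q r" if r: "0 < r" "r < \<delta>" for r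
    proof -
      have "r\<^sup>2 * q r = r\<^sup>2 * (a 2 * (1 - r\<^sup>2 / 14 + \<rho> r))" using d(4)[of r] P(2)[of r] r d(2) by simp
      then show ?thesis using r by simp
    qed
    then show ?thesis using d(1) by (auto simp: eventually_at_right_field intro!: exI[of _ \<delta>])
  qed
  ultimately have "(q \<longlongrightarrow> a 2) (at_right 0)" by (rule Lim_transform_eventually)
  moreover have "(q \<longlongrightarrow> q 0) (at_right 0)"
    using P(1)[unfolded continuous_on_def, rule_format, of 0] R at_within_Icc_at_right[of 0 R] by simp
  ultimately show ?thesis by (rule tendsto_unique[rotated]) simp
qed

subsection \<open>Asymptotics of minimizers\<close>

lemma minimizer_profile:
  assumes t: "t > 1" and R: "R > 0" and min: "global_minimizer t R h"
  obtains q p where "profile t R h q p" "\<And>r. r \<in> {0..R} \<Longrightarrow> 0 \<le> h r \<and> h r \<le> 1" "solves_bvp t R h"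
proof -
  have hc: "continuous_on {0..R} h" and hR: "h R = 1"
    using minimizer_admissible(1)[OF min] by (auto simp: admissible_def W12_def)
  obtain h' C where h': "\<And>r. r \<in> {0<..<R} \<Longrightarrow> (h has_real_derivative h' r) (at r)"
    "\<And>r. r \<in> {0<..<R} \<Longrightarrow> ((\<lambda>r. r\<^sup>2 * h' r) has_real_derivative 6 * h r + r\<^sup>2 * force t (h r)) (at r)"
    "\<And>r. r \<in> {0<..<R} \<Longrightarrow> \<bar>r\<^sup>2 * h' r\<bar> \<le> C" "L2_on R h'" "is_weak_deriv R h h'"
    by (rule minimizer_regularity[OF t R min]) (rule that; assumption)
  obtain q p where pr: "profile t R h q p" using profile_exists[OF t R hc hR h'(1-3)] by blast
  have h0: "h 0 = 0" using profileD(2)[OF pr, of 0] R by simp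
  have b: "0 \<le> h r \<and> h r \<le> 1" if "r \<in> {0..R}" for r
    using minimizer_nonneg[OF t R min h0 h'(1,4,5) that] solution_le_1[OF t R hc h0 hR h'(1,2) that] by blast
  have "solves_bvp t R h" unfolding solves_bvp_def
  proof (intro conjI exI ballI)
    fix r assume r: "r \<in> {0<..<R}"
    show "(h has_real_derivative h' r) (at r)" by (rule h'(1)[OF r])
    let ?h2 = "\<lambda>r. (6 * h r + r\<^sup>2 * force t (h r) - 2 * r * h' r) / r\<^sup>2"
    show "(h' has_real_derivative ?h2 r) (at r)"
    proof (rule has_field_derivative_transform_within_open[where S = "{0<..<R}"])
      have "((\<lambda>r. (r\<^sup>2 * h' r) / r\<^sup>2) has_real_derivative
        ((6 * h r + r\<^sup>2 * force t (h r)) * r\<^sup>2 - (r\<^sup>2 * h' r) * (2 * r)) / (r\<^sup>2 * r\<^sup>2)) (at r)"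
        using r by (intro DERIV_divide h'(2)) (auto intro!: derivative_eq_intros)
      also have "((6 * h r + r\<^sup>2 * force t (h r)) * r\<^sup>2 - (r\<^sup>2 * h' r) * (2 * r)) / (r\<^sup>2 * r\<^sup>2)
        = (r\<^sup>2 * (6 * h r + r\<^sup>2 * force t (h r) - 2 * r * h' r)) / (r\<^sup>2 * r\<^sup>2)"
        by (simp add: algebra_simps)
      also have "\<dots> = ?h2 r" using r by (intro mult_divide_mult_cancel_left) auto
      finally show "((\<lambda>r. (r\<^sup>2 * h' r) / r\<^sup>2) has_real_derivative ?h2 r) (at r)" .
    qed (use r in auto)
    have "?h2 r + 2 / r * h' r - 6 * h r / r\<^sup>2 = force t (h r)"
      using r by (simp add: field_simps power2_eq_square)
    also have "\<dots> = - h r + (h r) ^ 3 + 3 * (h_plus t / t) * ((h r) ^ 3 - (h r)\<^sup>2)"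
      unfolding force_def by algebra
    also have "3 * (h_plus t / t) = 3 * h_plus t / t" by simp
    finally show "?h2 r + 2 / r * h' r - 6 * h r / r\<^sup>2 = - h r + (h r) ^ 3 + 3 * h_plus t / t * ((h r) ^ 3 - (h r)\<^sup>2)" .
  qed (fact hc h0 hR)+
  with pr b show ?thesis by (rule that)
qed

text \<open>Identifies the constant of the theorem with the critical barrier parameter
  \<open>6 / (1 + m)\<close> of \<open>residual_pos\<close>, where
  \<open>m = 1 + 3 * (h_plus t / t)\<close>.\<close>

lemma t_lambda_sq:
  assumes "t > 1" shows "t * lambda_sq t = 6 / (2 + 3 * (h_plus t / t))"
proof -
  define s where "s = sqrt (9 + 8 * t)"
  have s: "h_plus t = (3 + s) / 4" "lambda_sq t = 24 / (9 + 8 * t + 3 * s)"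
    by (simp_all add: h_plus_def lambda_sq_def s_def)
  have "s \<ge> 0" unfolding s_def using assms by simp
  then have p: "9 + 8 * t + 3 * s > 0" using assms by simp
  have "2 + 3 * (h_plus t / t) = (9 + 8 * t + 3 * s) / (4 * t)"
    unfolding s using assms by (simp add: field_simps)
  then show ?thesis unfolding s using p assms by simp
qed

lemma lambda_sq_le:
  assumes "t > 1" shows "lambda_sq t \<le> 3 / t"
proof -
  have "6 / (2 + 3 * (h_plus t / t)) \<le> 3"
    using h_plus_pos[OF assms] by (simp add: pos_divide_le_eq)
  then show ?thesis unfolding t_lambda_sq[OF assms, symmetric] using assms by (simp add: field_simps)
qed

theorem proposition3p1:
  fixes t :: real
  assumes "t > 1"
  shows
    "(\<forall>R h. R > 0 \<longrightarrow> global_minimizer t R h \<longrightarrow>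
        solves_bvp t R h \<and> (\<exists>a. origin_expansion R h a)) \<and>
     (\<forall>hs :: real \<Rightarrow> real \<Rightarrow> real. (\<forall>R>0. global_minimizer t R (hs R)) \<longrightarrow>
        (\<forall>r>0. ereal (r\<^sup>2 / (r\<^sup>2 + 14)) \<le> Liminf at_top (\<lambda>R. ereal (hs R r)) \<and>
               Liminf at_top (\<lambda>R. ereal (hs R r)) \<le> Limsup at_top (\<lambda>R. ereal (hs R r)) \<and>
               Limsup at_top (\<lambda>R. ereal (hs R r)) \<le> ereal (r\<^sup>2 / (r\<^sup>2 + t * lambda_sq t)))) \<and>
     lambda_sq t \<le> 3 / t \<and> 3 / t \<le> 3 \<and>
     (\<exists>R0>0. \<forall>R\<ge>R0. \<forall>h a. global_minimizer t R h \<longrightarrow> origin_expansion R h a \<longrightarrow>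
        1 / 14 \<le> a 2 \<and> a 2 \<le> 1 / 3 + 3 / (8 * t) + 1 / (8 * t) * sqrt (9 + 8 * t))"
proof -
  note t = assms
  define c where "c = t * lambda_sq t"
  have c_eq: "c = 6 / (2 + 3 * (h_plus t / t))" unfolding c_def by (rule t_lambda_sq[OF t])
  have c: "c > 0" "c \<le> 3" unfolding c_eq using h_plus_pos[OF t] by (auto simp: pos_divide_le_eq)
  have part1: "solves_bvp t R h \<and> (\<exists>a. origin_expansion R h a)" if R: "R > 0" and min: "global_minimizer t R h" for R h
  proof -
    obtain q p where qp: "profile t R h q p" "\<And>r. r \<in> {0..R} \<Longrightarrow> 0 \<le> h r \<and> h r \<le> 1" "solves_bvp t R h"
      using minimizer_profile[OF t R min] by metis
    have "1 / R\<^sup>2 \<le> q 0" using profile_lower[OF t R qp(1,2)] R by simp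
    then have "q 0 > 0" using R by (smt (verit) zero_less_divide_1_iff zero_less_power)
    then show ?thesis using origin_expansion_exists[OF t R qp(1)] qp(3) by blast
  qed
  have lower: "r\<^sup>2 / (r\<^sup>2 + 14) \<le> h r"
    if R: "R > 0" and min: "global_minimizer t R h" and r: "r \<in> {0..R}" for R h r
  proof -
    obtain q p where qp: "profile t R h q p" "\<And>r. r \<in> {0..R} \<Longrightarrow> 0 \<le> h r \<and> h r \<le> 1"
      using minimizer_profile[OF t R min] by metis
    have "r\<^sup>2 * (1 / (r\<^sup>2 + 14)) \<le> r\<^sup>2 * q r"
      using subsolution_bound[OF t R qp r] by (intro mult_left_mono) auto
    then show ?thesis using profileD(2)[OF qp(1) r] by simp
  qed
  have upper: "h r \<le> (1 + \<beta>) * r\<^sup>2 / (r\<^sup>2 + (1 + \<beta>) * c)"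
    if R: "R > 0" and min: "global_minimizer t R h" and r: "r \<in> {0..R}"
      and \<beta>: "0 < \<beta>" "\<beta> \<le> 1 / 4" "(1 + \<beta>) * c < \<beta> * R\<^sup>2" for R h r \<beta>
  proof -
    obtain q p where qp: "profile t R h q p" "\<And>r. r \<in> {0..R} \<Longrightarrow> 0 \<le> h r \<and> h r \<le> 1"
      using minimizer_profile[OF t R min] by metis
    have "r\<^sup>2 * q r \<le> r\<^sup>2 * ((1 + \<beta>) / (r\<^sup>2 + (1 + \<beta>) * c))"
      using supersolution_bound[OF t R qp r \<beta>(1,2) _ \<beta>(3)] c_eq by (intro mult_left_mono) auto
    then show ?thesis using profileD(2)[OF qp(1) r] by (simp add: mult.commute)
  qed
  have part2: "ereal (r\<^sup>2 / (r\<^sup>2 + 14)) \<le> Liminf at_top (\<lambda>R. ereal (hs R r)) \<and>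
               Liminf at_top (\<lambda>R. ereal (hs R r)) \<le> Limsup at_top (\<lambda>R. ereal (hs R r)) \<and>
               Limsup at_top (\<lambda>R. ereal (hs R r)) \<le> ereal (r\<^sup>2 / (r\<^sup>2 + c))"
    if hs: "\<And>R. R > 0 \<Longrightarrow> global_minimizer t R (hs R)" and r: "r > 0" for hs :: "real \<Rightarrow> real \<Rightarrow> real" and r
  proof (intro conjI)
    show "ereal (r\<^sup>2 / (r\<^sup>2 + 14)) \<le> Liminf at_top (\<lambda>R. ereal (hs R r))"
    proof (rule Liminf_bounded)
      show "\<forall>\<^sub>F R in at_top. ereal (r\<^sup>2 / (r\<^sup>2 + 14)) \<le> ereal (hs R r)"
      proof (rule eventually_mono[OF eventually_ge_at_top[of r]])
        show "ereal (r\<^sup>2 / (r\<^sup>2 + 14)) \<le> ereal (hs R r)" if "R \<ge> r" for R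
          using lower[of R "hs R" r] hs[of R] that r by simp
      qed
    qed
    show "Liminf at_top (\<lambda>R. ereal (hs R r)) \<le> Limsup at_top (\<lambda>R. ereal (hs R r))"
      by (intro Liminf_le_Limsup) simp
    \<comment> \<open>The shift by 4 keeps \<open>\<beta> n \<le> 1 / 4\<close> from
      \<open>n = 0\<close> on.\<close>
    define \<beta> where "\<beta> n = 1 / (real n + 4)" for n
    \<comment> \<open>\<open>R\<close> goes to infinity with \<open>\<beta> n\<close> fixed, so the
      condition on \<open>\<beta> * R^2\<close> holds eventually; only afterwards does
      \<open>\<beta> n\<close> tend to 0.\<close>
    have "Limsup at_top (\<lambda>R. ereal (hs R r)) \<le> ereal ((1 + \<beta> n) * r\<^sup>2 / (r\<^sup>2 + (1 + \<beta> n) * c))" for n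
    proof (rule Limsup_bounded)
      have \<beta>: "0 < \<beta> n" "\<beta> n \<le> 1 / 4" by (simp_all add: \<beta>_def field_simps)
      have "filterlim (\<lambda>R::real. \<beta> n * R\<^sup>2) at_top at_top"
        using \<beta>(1) by (intro filterlim_tendsto_pos_mult_at_top[OF tendsto_const] filterlim_pow_at_top filterlim_ident) auto
      then have "\<forall>\<^sub>F R in at_top. (1 + \<beta> n) * c < \<beta> n * R\<^sup>2" by (simp add: filterlim_at_top_dense)
      then show "\<forall>\<^sub>F R in at_top. ereal (hs R r) \<le> ereal ((1 + \<beta> n) * r\<^sup>2 / (r\<^sup>2 + (1 + \<beta> n) * c))"
      proof (rule eventually_mono[OF eventually_conj[OF eventually_ge_at_top[of r]]])
        show "ereal (hs R r) \<le> ereal ((1 + \<beta> n) * r\<^sup>2 / (r\<^sup>2 + (1 + \<beta> n) * c))"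
          if "R \<ge> r \<and> (1 + \<beta> n) * c < \<beta> n * R\<^sup>2" for R
          using upper[of R "hs R" r "\<beta> n"] hs[of R] that r \<beta> by simp
      qed
    qed
    note le = this
    have "(\<lambda>n. ereal ((1 + \<beta> n) * r\<^sup>2 / (r\<^sup>2 + (1 + \<beta> n) * c))) \<longlonglongrightarrow> ereal ((1 + 0) * r\<^sup>2 / (r\<^sup>2 + (1 + 0) * c))"
    proof -
      have "\<beta> \<longlonglongrightarrow> 0" unfolding \<beta>_def [abs_def] by real_asymp
      then show ?thesis using c r by (intro tendsto_intros) (auto simp: add_nonneg_eq_0_iff)
    qed
    then have "Limsup at_top (\<lambda>R. ereal (hs R r)) \<le> ereal ((1 + 0) * r\<^sup>2 / (r\<^sup>2 + (1 + 0) * c))"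
      by (rule LIMSEQ_le_const) (intro exI allI impI le)
    then show "Limsup at_top (\<lambda>R. ereal (hs R r)) \<le> ereal (r\<^sup>2 / (r\<^sup>2 + c))" by simp
  qed
  \<comment> \<open>With \<open>\<beta> = 1 / 4\<close> and \<open>c \<le> 3\<close> the condition
    \<open>5 c / 4 < R^2 / 4\<close> holds from \<open>R = 4\<close> on. At \<open>r = 0\<close> the
    factor \<open>1 + \<beta>\<close> cancels, so the fixed \<open>\<beta>\<close> costs nothing and
    the bound is \<open>1 / c\<close>.\<close>
  have part4: "1 / 14 \<le> a 2 \<and> a 2 \<le> 1 / 3 + 3 / (8 * t) + 1 / (8 * t) * sqrt (9 + 8 * t)"
    if R: "R \<ge> 4" and min: "global_minimizer t R h" and e: "origin_expansion R h a" for R h a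
  proof -
    have R0: "R > 0" using R by simp
    obtain q p where qp: "profile t R h q p" "\<And>r. r \<in> {0..R} \<Longrightarrow> 0 \<le> h r \<and> h r \<le> 1"
      using minimizer_profile[OF t R0 min] by metis
    have a: "a 2 = q 0" by (rule origin_expansion_coeff[OF R0 qp(1) e])
    have "R\<^sup>2 \<ge> 4\<^sup>2" using R by (intro power_mono) auto
    then have "(1 + 1 / 4) * c < 1 / 4 * R\<^sup>2" using c by simp
    then have "q 0 \<le> (1 + 1 / 4) / (0\<^sup>2 + (1 + 1 / 4) * c)"
      using R0 c_eq by (intro supersolution_bound[OF t R0 qp]) auto
    also have "\<dots> = 1 / c" using c by simp
    also have "\<dots> = 1 / 3 + 3 / (8 * t) + 1 / (8 * t) * sqrt (9 + 8 * t)"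
      unfolding c_eq h_plus_def using t by (simp add: field_simps)
    finally show ?thesis using subsolution_bound[OF t R0 qp, of 0] R0 a by simp
  qed
  have "3 / t \<le> 3" using t by (simp add: pos_divide_le_eq)
  moreover have "\<exists>R0>0. \<forall>R\<ge>R0. \<forall>h a. global_minimizer t R h \<longrightarrow> origin_expansion R h a \<longrightarrow>
        1 / 14 \<le> a 2 \<and> a 2 \<le> 1 / 3 + 3 / (8 * t) + 1 / (8 * t) * sqrt (9 + 8 * t)"
    using part4 by (intro exI[of _ "4::real"]) auto
  ultimately show ?thesis
    using part1 part2 lambda_sq_le[OF t] unfolding c_def by blast
qed

end
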